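(* Let $d\ge 1$ and let $S$ be a quasihyperbolic endomorphism of $\mathbb{T}^d=\mathbb{R}^d/\mathbb{Z}^d$. Let $\{T_k\}_k$ be a countable collection of quasihyperbolic automorphisms of $\mathbb{T}^d$. Let $\mathfrak{s}_-$ (resp. $\mathfrak{t}^k_-$) be the subspace of $\mathbb{R}^d$ contracted by $S$ (resp. by $T_k$), and let $\mathfrak{s}_0'$ (resp. $(\mathfrak{t}^k_0)'$) be the sum of the eigenspaces of $S$ (resp. of $T_k$) for eigenvalues of modulus $1$. Assume that for every $k$, $\mathbb{R}^d$ is spanned by $\mathfrak{s}_-\oplus\mathfrak{s}_0'$ and $\mathfrak{t}^k_-\oplus(\mathfrak{t}^k_0)'$. Then $$\dim\Big(Eq(S)\cap\bigcap_k ND(T_k)\Big)=d,$$ where $\dim$ denotes Hausdorff dimension.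
   Context: An endomorphism $S$ of $\mathbb{T}^d$ is identified with a nonsingular $d\times d$ integer matrix, acting on both $\mathbb{R}^d$ and $\mathbb{T}^d$; it is an automorphism if its determinant is $\pm1$. It is quasihyperbolic if no eigenvalue of the matrix is a root of unity (equivalently, $S$ is ergodic for Haar measure). The subspace $\mathfrak{s}_-\subset\mathbb{R}^d$ contracted by $S$ is the real subspace corresponding to the generalized eigenspaces of $S$ for eigenvalues of modulus less than $1$, i.e. $\mathbb{R}^d\cap\bigoplus_{|\lambda|<1}\ker_{\mathbb{C}^d}(S-\lambda)^d$. The space $\mathfrak{s}_0'$ is the real subspace corresponding to the genuine (not generalized) eigenspaces for eigenvalues of modulus $1$, i.e. $\mathfrak{s}_0'=\mathbb{R}^d\cap\bigoplus_{|\lambda|=1}\ker_{\mathbb{C}^d}(S-\lambda)$. The spaces $\mathfrak{t}^k_-,(\mathfrak{t}^k_0)'$ are defined in the same way for $T_k$. "Spanned by" means that the (not necessarily direct) sum of the two subspaces is $\mathbb{R}^d$. Let $m$ be the Haar probability measure on $\mathbb{T}^d$. Then $$Eq(S)=\Big\{x\in\mathbb{T}^d:\ \tfrac1N\sum_{n=0}^{N-1}f(S^nx)\to\int f\,dm\ (N\to\infty)\ \text{for all } f\in C(\mathbb{T}^d)\Big\},$$ $D(T)=\{x\in\mathbb{T}^d:\ \overline{\{T^nx: n\ge 0\}}=\mathbb{T}^d\}$ and $ND(T)=\mathbb{T}^d\setminus D(T)$. *)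

theory Defs
  imports "HOL-Analysis.Analysis"
begin

definition lattice_eq :: "real^'d \<Rightarrow> real^'d \<Rightarrow> bool" where
  "lattice_eq x y \<longleftrightarrow> (\<forall>i. x $ i - y $ i \<in> \<int>)"

lemma lattice_eq_refl: "lattice_eq x x"
  by (simp add: lattice_eq_def)

lemma lattice_eq_sym: "lattice_eq x y \<Longrightarrow> lattice_eq y x"
  unfolding lattice_eq_def by (metis Ints_minus minus_diff_eq)

lemma lattice_eq_trans: "lattice_eq x y \<Longrightarrow> lattice_eq y z \<Longrightarrow> lattice_eq x z"
  unfolding lattice_eq_def
proof
  fix i
  assume "\<forall>i. x $ i - y $ i \<in> \<int>" "\<forall>i. y $ i - z $ i \<in> \<int>"
  then have "(x $ i - y $ i) + (y $ i - z $ i) \<in> \<int>"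
    by (intro Ints_add) auto
  then show "x $ i - z $ i \<in> \<int>" by simp
qed

quotient_type 'd torus = "real^('d::finite)" / lattice_eq
  by (intro equivpI reflpI sympI transpI)
    (blast intro: lattice_eq_refl lattice_eq_sym lattice_eq_trans)+

lift_definition torus_proj :: "real^'d \<Rightarrow> 'd::finite torus" is "\<lambda>x. x" .

lemma torus_proj_eq_iff: "torus_proj x = torus_proj y \<longleftrightarrow> lattice_eq x y"
  by transfer simp

lemma torus_proj_surj: "\<exists>x. X = torus_proj x"
  by transfer (blast intro: lattice_eq_refl)

lemma torus_proj_cases: obtains x where "X = torus_proj x"
  using torus_proj_surj by blast

definition torus_fibre :: "'d::finite torus \<Rightarrow> (real^'d) set" where
  "torus_fibre X = {x. torus_proj x = X}"

lemma torus_fibre_nonempty: "torus_fibre X \<noteq> {}"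
  unfolding torus_fibre_def by (metis (mono_tags) empty_Collect_eq torus_proj_cases)

lemma torus_fibre_proj: "torus_fibre (torus_proj y) = {x. lattice_eq x y}"
  by (simp add: torus_fibre_def torus_proj_eq_iff)

lemma closed_torus_fibre: "closed (torus_fibre X)"
proof -
  obtain y where y: "X = torus_proj y" by (rule torus_proj_cases)
  have "closed ((\<lambda>x. x $ i - y $ i) -` \<int>)" for i
    by (intro closed_vimage closed_Ints continuous_intros)
  then have "closed (\<Inter>i. (\<lambda>x. x $ i - y $ i) -` \<int>)"
    by blast
  also have "(\<Inter>i. (\<lambda>x. x $ i - y $ i) -` \<int>) = torus_fibre X"
    by (auto simp: y torus_fibre_proj lattice_eq_def)
  finally show ?thesis .
qed

lemma setdist_torus_fibre:
  assumes a: "torus_proj a = X"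
  shows "setdist (torus_fibre X) (torus_fibre Y) = setdist {a} (torus_fibre Y)"
proof (rule antisym)
  show "setdist (torus_fibre X) (torus_fibre Y) \<le> setdist {a} (torus_fibre Y)"
    using a by (intro setdist_subset_left) (auto simp: torus_fibre_def)
  show "setdist {a} (torus_fibre Y) \<le> setdist (torus_fibre X) (torus_fibre Y)"
  proof (rule le_setdistI)
    fix x y
    assume x: "x \<in> torus_fibre X" and y: "y \<in> torus_fibre Y"
    have "lattice_eq x a"
      using x a by (simp add: torus_fibre_def flip: torus_proj_eq_iff)
    then have "lattice_eq (y + (a - x)) y"
      using lattice_eq_sym by (fastforce simp: lattice_eq_def)
    then have "y + (a - x) \<in> torus_fibre Y"
      using y by (simp add: torus_fibre_def flip: torus_proj_eq_iff)
    then have "setdist {a} (torus_fibre Y) \<le> dist a (y + (a - x))"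
      by (intro setdist_le_dist) auto
    also have "\<dots> = dist x y"
      by (simp add: dist_norm algebra_simps)
    finally show "setdist {a} (torus_fibre Y) \<le> dist x y" .
  qed (use torus_fibre_nonempty in auto)
qed

text \<open>Flat quotient metric: the distance between the fibres, as subsets of \<open>\<real>\<^sup>d\<close>.\<close>

instantiation torus :: (finite) metric_space
begin

definition dist_torus :: "'a torus \<Rightarrow> 'a torus \<Rightarrow> real" where
  "dist_torus X Y = setdist (torus_fibre X) (torus_fibre Y)"

definition uniformity_torus :: "('a torus \<times> 'a torus) filter" where
  "uniformity_torus = (INF e\<in>{0<..}. principal {(X, Y). dist X Y < e})"

definition open_torus :: "'a torus set \<Rightarrow> bool" where
  "open_torus U \<longleftrightarrow> (\<forall>X\<in>U. eventually (\<lambda>(X', Y). X' = X \<longrightarrow> Y \<in> U) uniformity)"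

instance
proof
  fix X Y Z :: "'a torus"
  obtain a where a: "X = torus_proj a" by (rule torus_proj_cases)
  obtain c where c: "Z = torus_proj c" by (rule torus_proj_cases)
  show "dist X Y = 0 \<longleftrightarrow> X = Y"
    unfolding dist_torus_def setdist_torus_fibre[OF a[symmetric]]
    using closed_torus_fibre[of Y] torus_fibre_nonempty[of Y]
    by (simp add: setdist_eq_0_sing_1 a) (simp add: torus_fibre_def)
  have "dist X Y \<le> setdist (torus_fibre X) {c} + setdist {c} (torus_fibre Y)"
    unfolding dist_torus_def by (rule setdist_triangle)
  then show "dist X Y \<le> dist X Z + dist Y Z"
    unfolding dist_torus_def
    by (metis c setdist_sym setdist_torus_fibre)
qed (rule uniformity_torus_def open_torus_def)+

end

lemma dist_torus_proj: "dist (torus_proj a) Y = setdist {a} (torus_fibre Y)"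
  by (simp add: dist_torus_def setdist_torus_fibre)

lemma dist_torus_proj_le: "dist (torus_proj a) (torus_proj b) \<le> dist a b"
  unfolding dist_torus_proj by (intro setdist_le_dist) (auto simp: torus_fibre_def)

lemma continuous_on_torus_proj: "continuous_on A torus_proj"
  unfolding continuous_on_iff by (meson dist_torus_proj_le le_less_trans)

lemma open_torus_iff: "open U \<longleftrightarrow> open (torus_proj -` U)"
proof
  assume "open U"
  then show "open (torus_proj -` U)"
    by (intro open_vimage continuous_on_torus_proj)
next
  assume *: "open (torus_proj -` U)"
  show "open U"
    unfolding open_dist
  proof
    fix X assume "X \<in> U"
    obtain a where a: "X = torus_proj a" by (rule torus_proj_cases)
    obtain e where e: "e > 0" "\<And>b. dist b a < e \<Longrightarrow> torus_proj b \<in> U"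
      using * \<open>X \<in> U\<close> unfolding open_dist a by auto
    have "Y \<in> U" if "dist Y X < e" for Y
    proof -
      have "setdist {a} (torus_fibre Y) < e"
        using that by (simp add: a dist_commute flip: dist_torus_proj)
      then obtain b where "b \<in> torus_fibre Y" "dist a b < e"
        using setdist_ltE[of "{a}" "torus_fibre Y" e] torus_fibre_nonempty[of Y] by auto
      then show ?thesis
        using e(2)[of b] by (simp add: torus_fibre_def dist_commute)
    qed
    then show "\<exists>e>0. \<forall>Y. dist Y X < e \<longrightarrow> Y \<in> U"
      using \<open>e > 0\<close> by blast
  qed
qed

text \<open>Haar probability measure: the image of Lebesgue measure on the unit cube.\<close>

definition haar_torus :: "'d::finite torus measure" where
  "haar_torus = distr (restrict_space lborel (cbox 0 1)) borel torus_proj"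

lemma torus_proj_measurable: "torus_proj \<in> borel_measurable (restrict_space lborel A)"
  by (intro measurable_restrict_space1)
    (simp add: borel_measurable_continuous_onI continuous_on_torus_proj)

lemma emeasure_haar_torus_UNIV: "emeasure haar_torus UNIV = 1"
proof -
  have "emeasure lborel (cbox 0 1 :: (real^'d) set) = 1"
    by (subst emeasure_lborel_cbox) (auto simp: Basis_vec_def inner_axis prod.neutral)
  then show ?thesis
    unfolding haar_torus_def
    by (subst emeasure_distr[OF torus_proj_measurable])
      (auto simp: space_restrict_space emeasure_restrict_space)
qed

lift_definition torus_map :: "int^'d^'d \<Rightarrow> 'd::finite torus \<Rightarrow> 'd torus"
  is "\<lambda>A x. map_matrix real_of_int A *v x"
proof -
  fix A :: "int^'d^'d" and x y :: "real^'d"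
  assume "lattice_eq x y"
  then have "(\<Sum>j\<in>UNIV. of_int (A $ i $ j) * (x $ j - y $ j)) \<in> \<int>" for i
    unfolding lattice_eq_def by (intro Ints_sum Ints_mult) auto
  then show "lattice_eq (map_matrix real_of_int A *v x) (map_matrix real_of_int A *v y)"
    by (simp add: lattice_eq_def matrix_vector_mult_def sum_subtractf algebra_simps)
qed

lemma torus_map_proj:
  "torus_map A (torus_proj x) = torus_proj (map_matrix real_of_int A *v x)"
  by transfer (rule lattice_eq_refl)

definition toral_endomorphism :: "int^'d^'d \<Rightarrow> bool" where
  "toral_endomorphism A \<longleftrightarrow> det A \<noteq> 0"

definition toral_automorphism :: "int^'d^'d \<Rightarrow> bool" where
  "toral_automorphism A \<longleftrightarrow> det A = 1 \<or> det A = -1"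

definition is_eigenvalue :: "int^'d^'d \<Rightarrow> complex \<Rightarrow> bool" where
  "is_eigenvalue A \<mu> \<longleftrightarrow> (\<exists>v. v \<noteq> 0 \<and> map_matrix of_int A *v v = \<mu> *s v)"

definition quasihyperbolic :: "int^'d^'d \<Rightarrow> bool" where
  "quasihyperbolic A \<longleftrightarrow> (\<forall>\<mu>. is_eigenvalue A \<mu> \<longrightarrow> \<not> (\<exists>n>0. \<mu> ^ n = 1))"

definition eigenspace :: "int^'d^'d \<Rightarrow> complex \<Rightarrow> (complex^'d) set" where
  "eigenspace A \<mu> = {v. (map_matrix of_int A - mat \<mu>) *v v = 0}"

text \<open>The power of \<open>A - \<mu>\<close> is an iterate of the linear map, since \<open>^\<close> on \<^typ>\<open>complex^'d^'d\<close>
  is componentwise.\<close>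

definition gen_eigenspace :: "int^'d^'d \<Rightarrow> complex \<Rightarrow> (complex^'d) set" where
  "gen_eigenspace A \<mu> =
     {v. (((*v) (map_matrix of_int A - mat \<mu>)) ^^ CARD('d)) v = 0}"

definition real_part_of :: "(complex^'d) set \<Rightarrow> (real^'d) set" where
  "real_part_of V = {x. (\<chi> i. complex_of_real (x $ i)) \<in> V}"

text \<open>\<^const>\<open>vec.span\<close> is the span over \<^typ>\<open>complex\<close>, whereas \<^const>\<open>span\<close> would be the real one.\<close>

definition contracted_space :: "int^'d^'d \<Rightarrow> (real^'d) set" where
  "contracted_space A =
     real_part_of (vec.span (\<Union>\<mu>\<in>{\<mu>. cmod \<mu> < 1}. gen_eigenspace A \<mu>))"

definition neutral_eigenspace :: "int^'d^'d \<Rightarrow> (real^'d) set" where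
  "neutral_eigenspace A =
     real_part_of (vec.span (\<Union>\<mu>\<in>{\<mu>. cmod \<mu> = 1}. eigenspace A \<mu>))"

definition equidistributed_points :: "('d::finite torus \<Rightarrow> 'd torus) \<Rightarrow> 'd torus set" where
  "equidistributed_points F =
     {x. \<forall>f :: 'd torus \<Rightarrow> complex. continuous_on UNIV f \<longrightarrow>
           (\<lambda>N. (\<Sum>n<N. f ((F ^^ n) x)) / of_nat N) \<longlonglongrightarrow> integral\<^sup>L haar_torus f}"

definition dense_points :: "('a::topological_space \<Rightarrow> 'a) \<Rightarrow> 'a set" where
  "dense_points F = {x. closure (range (\<lambda>n. (F ^^ n) x)) = UNIV}"

definition nondense_points :: "('a::topological_space \<Rightarrow> 'a) \<Rightarrow> 'a set" where
  "nondense_points F = - dense_points F"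

text \<open>The gauge \<open>diam(U)\<^sup>s\<close> with \<open>diam(\<emptyset>)\<^sup>s = 0\<close> and \<open>0\<^sup>0 = 1\<close>; note that \<open>0 powr 0 = 0\<close> in HOL.\<close>

definition diam_pow :: "real \<Rightarrow> 'a::metric_space set \<Rightarrow> ennreal" where
  "diam_pow s U =
     (if U = {} then 0 else if s = 0 then 1 else ennreal (diameter U powr s))"

text \<open>Covering sets are required to be bounded because \<^const>\<open>diameter\<close> is only meaningful then.\<close>

definition hausdorff_premeasure :: "real \<Rightarrow> real \<Rightarrow> 'a::metric_space set \<Rightarrow> ennreal" where
  "hausdorff_premeasure s \<delta> A =
     Inf {(\<Sum>i. diam_pow s (U i)) | U :: nat \<Rightarrow> 'a set.
            A \<subseteq> (\<Union>i. U i) \<and> (\<forall>i. bounded (U i) \<and> diameter (U i) \<le> \<delta>)}"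

definition hausdorff_measure :: "real \<Rightarrow> 'a::metric_space set \<Rightarrow> ennreal" where
  "hausdorff_measure s A = (SUP \<delta>\<in>{0<..}. hausdorff_premeasure s \<delta> A)"

definition hausdorff_dim :: "'a::metric_space set \<Rightarrow> ennreal" where
  "hausdorff_dim A = Inf {ennreal s | s. s \<ge> 0 \<and> hausdorff_measure s A = 0}"

end

theory Submission
  imports Defs "HOL-Library.Discrete_Functions"
    "HOL-Computational_Algebra.Fundamental_Theorem_Algebra"
begin

text \<open>
  Let \<open>W\<^sub>A\<close> be the space of vectors with bounded forward orbit under \<open>A\<close>; it contains the contracted
  space and the neutral eigenspace. Points all of whose nontrivial characters average to zero along
  the \<open>S\<close>-orbit have full Lebesgue measure (orthogonality along squares), are equidistributed
  (Stone--Weierstrass), and form a set invariant under translation by \<open>W\<^sub>S\<close> (van der Corput).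
  Since \<open>W\<^sub>S\<close> and \<open>W\<^sub>T\<close> span, \<open>W\<^sub>S\<close> is not contained in the proper subspace outside of which \<open>T\<close>-orbits
  grow geometrically, so by Baire a single \<open>w \<in> W\<^sub>S\<close> grows geometrically under every \<open>T\<^sub>k\<close>. On each
  segment \<open>x + t w\<close>, the parameters \<open>t\<close> for which all \<open>T\<^sub>k\<close>-orbits eventually avoid a neighbourhood of
  \<open>0\<close> form a set of dimension one with Hausdorff content bounded below uniformly in \<open>x\<close>; this follows
  by counting surviving cells in an \<open>R\<close>-adic tree in which the cells hit by a hypothetical cheap cover
  are deleted as well. Averaging over \<open>x\<close> turns this into the lower bound \<open>d\<close>.
\<close>

section \<open>Counting survivors in a tree\<close>

text \<open>The base points are only known to have full measure, so no measure is built on the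
  target set. Instead, a countable cover by balls of radii r_i with a small sum of
  r_i^(d-1+\<sigma>) is assumed and a point of the set outside it is produced. The base points whose
  segment meets a ball of radius r have measure of order r^(d-1), so integrating over them leaves a
  sum of r_i^\<sigma> on one segment. In a tree with R^\<sigma> \<le> R - 1 this sum costs at most
  half a child per survivor and the orbit conditions cost the other half; hence every \<sigma> < 1
  is admissible. The admissible size of the sum depends neither on the offsets of the orbits nor on
  the position of the intervals, so it can be fixed before the base point is found. That T is an
  automorphism gives |det T| = 1, which forces an eigenvalue outside the closed unit disc and makes
  the exceptional subspace proper; that subspace contains W_T because orbits growing geometrically
  are unbounded. If there is no T at all, W_S may be zero and offers no segment; then the bound
  comes from Haar measure alone.\<close>

fun survivors :: "nat \<Rightarrow> (nat \<Rightarrow> nat set) \<Rightarrow> nat \<Rightarrow> nat set" where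
  "survivors R K 0 = {0}"
| "survivors R K (Suc l) = {p. p div R \<in> survivors R K l \<and> p \<notin> K (Suc l)}"

lemma div_eq_interval:
  fixes R q :: nat
  assumes "R > 0"
  shows "{p. p div R = q} = {q * R..<q * R + R}"
proof (intro set_eqI iffI)
  fix p assume "p \<in> {p. p div R = q}"
  then show "p \<in> {q * R..<q * R + R}"
    using div_mult_mod_eq[of p R] mod_less_divisor[OF assms, of p] by auto
next
  fix p assume "p \<in> {q * R..<q * R + R}"
  then show "p \<in> {p. p div R = q}"
    by (auto intro!: div_nat_eqI simp: algebra_simps)
qed

lemma card_div_in:
  fixes R :: nat
  assumes "R > 0" "finite A"
  shows "finite {p. p div R \<in> A}" "card {p. p div R \<in> A} = R * card A"
proof -
  have eq: "{p. p div R \<in> A} = (\<Union>q\<in>A. {q * R..<q * R + R})"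
    unfolding div_eq_interval[OF assms(1), symmetric] by auto
  show "finite {p. p div R \<in> A}"
    unfolding eq using assms(2) by (rule finite_UN_I) (rule finite_atLeastLessThan)
  have "card (\<Union>q\<in>A. {q * R..<q * R + R}) = (\<Sum>q\<in>A. card {q * R..<q * R + R})"
    using assms(2)
  proof (intro card_UN_disjoint)
    show "\<forall>q\<in>A. \<forall>q'\<in>A. q \<noteq> q' \<longrightarrow> {q * R..<q * R + R} \<inter> {q' * R..<q' * R + R} = {}"
      unfolding div_eq_interval[OF assms(1), symmetric] by blast
  qed auto
  then show "card {p. p div R \<in> A} = R * card A"
    unfolding eq by simp
qed

lemma finite_survivors: "R > 0 \<Longrightarrow> finite (survivors R K l)"
proof (induction l)
  case (Suc l)
  then have "finite {p. p div R \<in> survivors R K l}"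
    by (intro card_div_in) auto
  then show ?case by (rule rev_finite_subset) auto
qed auto

text \<open>An index p at level l stands for the R-adic cell from p / R^l to (p + 1) / R^l, so
  \<open>p div R\<close> is its parent and \<open>p div R ^ h\<close> its ancestor h levels
  up.\<close>

lemma survivors_ancestor: "p \<in> survivors R K (m + h) \<Longrightarrow> p div R ^ h \<in> survivors R K m"
  by (induction h arbitrary: p) (auto simp: div_mult2_eq)

text \<open>The number of survivors is bounded below inductively: the cells killed by the \<open>k\<close>-th family
  at level \<open>l + 1\<close> are charged to their ancestors \<open>h k\<close> levels above, which by the induction
  hypothesis are few compared with the survivors at level \<open>l\<close>.\<close>

lemma card_survivors_Suc:
  fixes C :: "nat \<Rightarrow> real" and h :: "nat \<Rightarrow> nat"
  assumes R: "R \<ge> 3"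
    and K: "\<And>l. K l \<subseteq> (\<Union>k. B k l) \<union> G l"
    and B0: "\<And>k l. l < h k \<Longrightarrow> B k l = {}"
    and h: "\<And>k. k < h k"
    and Bfin: "\<And>k l q. finite {p\<in>B k l. p div R ^ h k = q}"
    and Bcard: "\<And>k l q. card {p\<in>B k l. p div R ^ h k = q} \<le> C k"
    and C: "\<And>k. C k \<le> real (R - 1) ^ (h k - 1) / 2 ^ (k + 2)"
    and Gfin: "\<And>l. finite (G l)"
    and Gcard: "\<And>l. card (G (Suc l)) \<le> real (R - 1) ^ l / 2"
  shows "real (R - 1) * card (survivors R K l) \<le> card (survivors R K (Suc l))"
proof (induction l rule: less_induct)
  case (less l)
  let ?A = "survivors R K"
  let ?f = "\<lambda>l. real (card (?A l))"
  let ?Q = "real (R - 1)"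
  have fin: "finite (?A l)" for l
    using R by (intro finite_survivors) auto
  \<comment> \<open>The induction hypothesis chained over j levels: the ancestors j levels up are
    fewer by a factor (R - 1)^j, which pays for the cells killed below them.\<close>
  have pow: "?Q ^ j * ?f (l - j) \<le> ?f l" if "j \<le> l" for j
    using that
  proof (induction j)
    case (Suc j)
    have "?Q * ?f (l - Suc j) \<le> ?f (Suc (l - Suc j))"
      using Suc.prems by (intro less) auto
    also have "Suc (l - Suc j) = l - j" using Suc.prems by auto
    finally have "?Q ^ j * (?Q * ?f (l - Suc j)) \<le> ?Q ^ j * ?f (l - j)"
      by (intro mult_left_mono) auto
    also have "\<dots> \<le> ?f l" using Suc by auto
    finally show ?case by (simp add: mult_ac)
  qed auto
  have fl: "?Q ^ l \<le> ?f l" using pow[of l] by simp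
  \<comment> \<open>The families that have a level to be charged to. There are finitely many because
    \<open>k < h k\<close>.\<close>
  define J where "J = {k. h k \<le> Suc l}"
  have J: "J \<subseteq> {..l}" unfolding J_def
  proof
    fix k assume "k \<in> {k. h k \<le> Suc l}"
    then show "k \<in> {..l}" using h[of k] by auto
  qed
  then have finJ: "finite J" by (rule finite_subset) auto
  define D where "D = {p. p div R \<in> ?A l}"
  have D: "finite D" "card D = R * card (?A l)"
    unfolding D_def using card_div_in[of R "?A l"] R fin by auto
  define E where "E k = {p\<in>D. p \<in> B k (Suc l)}" for k
  have sub: "D \<subseteq> ?A (Suc l) \<union> (\<Union>k\<in>J. E k) \<union> G (Suc l)"
  proof
    fix p assume p: "p \<in> D"
    show "p \<in> ?A (Suc l) \<union> (\<Union>k\<in>J. E k) \<union> G (Suc l)"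
    proof (cases "p \<in> K (Suc l)")
      case True
      then consider k where "p \<in> B k (Suc l)" | "p \<in> G (Suc l)" using K[of "Suc l"] by blast
      then show ?thesis
      proof cases
        case 1
        then have "k \<in> J" using B0[of "Suc l" k] unfolding J_def by (cases "h k \<le> Suc l") auto
        then show ?thesis using 1 p unfolding E_def by blast
      qed auto
    qed (use p D_def in auto)
  qed
  have finE: "finite (E k)" for k using D unfolding E_def by auto
  have E: "real (card (E k)) \<le> ?f l / 2 ^ (k + 2)" if k: "k \<in> J" for k
  proof -
    have hk: "1 \<le> h k" "h k \<le> Suc l" using k h[of k] unfolding J_def by auto
    let ?m = "Suc l - h k"
    have "E k \<subseteq> (\<Union>q\<in>?A ?m. {p\<in>B k (Suc l). p div R ^ h k = q})"
    proof
      fix p assume "p \<in> E k"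
      then have p: "p div R \<in> ?A l" "p \<in> B k (Suc l)" unfolding E_def D_def by auto
      \<comment> \<open>One of the h k levels is spent on passing from p to its parent.\<close>
      have "l = ?m + (h k - 1)" using hk by auto
      then have "(p div R) div R ^ (h k - 1) \<in> ?A ?m"
        using p survivors_ancestor by metis
      also have "(p div R) div R ^ (h k - 1) = p div R ^ h k"
        using hk by (metis Suc_diff_1 div_mult2_eq less_le_trans power_Suc zero_less_one)
      finally show "p \<in> (\<Union>q\<in>?A ?m. {p\<in>B k (Suc l). p div R ^ h k = q})"
        using p by auto
    qed
    then have "card (E k) \<le> card (\<Union>q\<in>?A ?m. {p\<in>B k (Suc l). p div R ^ h k = q})"
      using Bfin fin by (intro card_mono) auto
    also have "\<dots> \<le> (\<Sum>q\<in>?A ?m. card {p\<in>B k (Suc l). p div R ^ h k = q})"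
      using fin by (intro card_UN_le) auto
    finally have "real (card (E k)) \<le> (\<Sum>q\<in>?A ?m. real (card {p\<in>B k (Suc l). p div R ^ h k = q}))"
      by (simp only: of_nat_sum [symmetric] of_nat_le_iff)
    also have "\<dots> \<le> (\<Sum>q\<in>?A ?m. C k)"
      by (intro sum_mono Bcard)
    also have "\<dots> = C k * ?f ?m" by simp
    also have "\<dots> \<le> ?Q ^ (h k - 1) / 2 ^ (k + 2) * ?f ?m"
      by (intro mult_right_mono C) auto
    also have "\<dots> = (?Q ^ (h k - 1) * ?f (l - (h k - 1))) / 2 ^ (k + 2)"
      using hk by simp
    also have "\<dots> \<le> ?f l / 2 ^ (k + 2)"
      using pow[of "h k - 1"] hk by (intro divide_right_mono) auto
    finally show ?thesis .
  qed
  have "card D \<le> card (?A (Suc l) \<union> (\<Union>k\<in>J. E k) \<union> G (Suc l))"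
    using sub fin finE finJ Gfin by (intro card_mono) (auto simp del: survivors.simps)
  also have "\<dots> \<le> card (?A (Suc l)) + card (\<Union>k\<in>J. E k) + card (G (Suc l))"
    by (meson add_le_mono1 card_Un_le le_trans)
  also have "\<dots> \<le> card (?A (Suc l)) + (\<Sum>k\<in>J. card (E k)) + card (G (Suc l))"
    using card_UN_le[OF finJ, of E] by simp
  finally have "real (card D) \<le> ?f (Suc l) + (\<Sum>k\<in>J. real (card (E k))) + real (card (G (Suc l)))"
    by (simp only: of_nat_sum [symmetric] of_nat_add [symmetric] of_nat_le_iff)
  \<comment> \<open>The weights 1 / 2^(k+2) add up to at most one half; the other half is reserved
    for G.\<close>
  moreover have "(\<Sum>k\<in>J. real (card (E k))) \<le> ?f l / 2"
  proof -
    have "(\<Sum>k\<in>J. real (card (E k))) \<le> (\<Sum>k\<in>J. ?f l / 2 ^ (k + 2))"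
      by (intro sum_mono E)
    also have "\<dots> \<le> (\<Sum>k\<le>l. ?f l / 2 ^ (k + 2))"
      using J by (intro sum_mono2) auto
    also have "\<dots> = ?f l / 2 * (\<Sum>k\<le>l. (1/2) ^ Suc k)"
      by (simp add: sum_distrib_left power_divide field_simps)
    also have "(\<Sum>k\<le>l. (1/2::real) ^ Suc k) \<le> (\<Sum>k. (1/2) ^ Suc k)"
      using power_half_series by (intro sum_le_suminf) (auto simp: sums_iff)
    also have "(\<Sum>k. (1/2::real) ^ Suc k) = 1"
      using power_half_series by (simp add: sums_iff)
    finally show ?thesis by (simp add: mult_left_mono)
  qed
  moreover have "real (card (G (Suc l))) \<le> ?f l / 2"
    using Gcard[of l] fl by linarith
  ultimately have "real (card D) \<le> ?f (Suc l) + ?f l" by linarith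
  moreover have "real (card D) = (?Q + 1) * ?f l" using D R by (simp add: of_nat_diff)
  ultimately show ?case by (simp add: algebra_simps)
qed

text \<open>Lacunarity up to a constant: the norms need not increase at every step. Nonvanishing
  excludes the zero sequence, which satisfies the inequality trivially, and yields C > 0.\<close>

definition geometric_growth :: "(nat \<Rightarrow> 'a::real_normed_vector) \<Rightarrow> bool" where
  "geometric_growth a \<longleftrightarrow> (\<forall>n. a n \<noteq> 0) \<and>
     (\<exists>C r. 0 < r \<and> r < 1 \<and> (\<forall>i n. i \<le> n \<longrightarrow> norm (a i) \<le> C * r ^ (n - i) * norm (a n)))"

lemma geometric_growthI:
  assumes "\<And>n. a n \<noteq> 0" "0 < r" "r < 1"
    and "\<And>i n. i \<le> n \<Longrightarrow> norm (a i) \<le> C * r ^ (n - i) * norm (a n)"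
  shows "geometric_growth a"
  using assms unfolding geometric_growth_def by blast

lemma geometric_growthE:
  assumes "geometric_growth a"
  obtains r C where "0 < r" "r < 1" "C > 0" "\<forall>n. a n \<noteq> 0"
    and "\<forall>i n. i \<le> n \<longrightarrow> norm (a i) \<le> C * r ^ (n - i) * norm (a n)"
proof -
  obtain C r where *: "0 < r" "r < 1" "\<And>n. a n \<noteq> 0"
    "\<And>i n. i \<le> n \<Longrightarrow> norm (a i) \<le> C * r ^ (n - i) * norm (a n)"
    using assms unfolding geometric_growth_def by blast
  have "C > 0" using *(4)[of 0 0] *(3)[of 0] by (simp add: mult_le_cancel_right1)
  then show ?thesis using * that by blast
qed

text \<open>Over H steps with \<open>C * R * r ^ H < 1\<close> the norm grows by a factor larger
  than R, so all indices with norm in one window from M to R M lie among H consecutive ones,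
  whatever M is.\<close>

lemma geometric_growth_card:
  fixes a :: "nat \<Rightarrow> 'a::real_normed_vector" and R :: real
  assumes "geometric_growth a" "R > 0"
  obtains H :: nat where "\<And>M. finite {n. M \<le> norm (a n) \<and> norm (a n) < R * M}"
    and "\<And>M. card {n. M \<le> norm (a n) \<and> norm (a n) < R * M} \<le> H"
proof -
  obtain r C where r: "0 < r" "r < 1" and C0: "C > 0" and nz: "\<forall>n. a n \<noteq> 0"
    and C: "\<forall>i n. i \<le> n \<longrightarrow> norm (a i) \<le> C * r ^ (n - i) * norm (a n)"
    by (rule geometric_growthE[OF assms(1)])
  obtain H where "r ^ H < 1 / (C * R)"
    using real_arch_pow_inv[of "1 / (C * R)" r] r C0 assms(2) by auto
  then have H: "C * R * r ^ H < 1"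
    using C0 assms(2) by (simp add: field_simps)
  have gap: "n < m + H" if "M \<le> norm (a m)" "norm (a n) < R * M" "m \<le> n" for M m n
  proof (rule ccontr)
    assume "\<not> n < m + H"
    then have "r ^ (n - m) \<le> r ^ H" using r by (intro power_decreasing) auto
    have "0 < R * M" using that(2) norm_ge_zero[of "a n"] by linarith
    then have M: "M > 0" using assms(2) by (simp add: zero_less_mult_iff)
    have "M \<le> C * r ^ (n - m) * norm (a n)" using C that(1,3) by (meson order_trans)
    also have "\<dots> \<le> C * r ^ H * (R * M)"
      using \<open>r ^ (n - m) \<le> r ^ H\<close> that(2) C0 r by (intro mult_mono) auto
    also have "\<dots> = (C * R * r ^ H) * M" by (simp add: mult_ac)
    also have "\<dots> < 1 * M" using H M by (intro mult_strict_right_mono) auto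
    finally show False by simp
  qed
  have "finite {n. M \<le> norm (a n) \<and> norm (a n) < R * M} \<and>
        card {n. M \<le> norm (a n) \<and> norm (a n) < R * M} \<le> H" (is "finite ?N \<and> card _ \<le> _") for M
  proof (cases "?N = {}")
    case False
    then obtain n0 where "n0 \<in> ?N" by blast
    define m where "m = (LEAST n. n \<in> ?N)"
    have m: "m \<in> ?N" unfolding m_def by (rule LeastI) fact
    have "?N \<subseteq> {m..<m + H}"
    proof
      fix n assume n: "n \<in> ?N"
      then have "m \<le> n" unfolding m_def by (rule Least_le)
      then show "n \<in> {m..<m + H}" using gap[of M m n] m n by simp
    qed
    then show ?thesis
      using finite_subset[of ?N "{m..<m + H}"] card_mono[of "{m..<m + H}" ?N] by simp
  next
    case True
    show ?thesis unfolding True by simp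
  qed
  then show ?thesis using that by blast
qed

lemma card_int_near:
  fixes x :: real
  shows "finite {z::int. \<bar>x - of_int z\<bar> \<le> 2}" "card {z::int. \<bar>x - of_int z\<bar> \<le> 2} \<le> 5"
proof -
  have sub: "{z::int. \<bar>x - of_int z\<bar> \<le> 2} \<subseteq> {\<lceil>x - 2\<rceil>..\<lfloor>x + 2\<rfloor>}"
    by (auto simp only: mem_Collect_eq atLeastAtMost_iff ceiling_le_iff le_floor_iff abs_le_iff)
  then show "finite {z::int. \<bar>x - of_int z\<bar> \<le> 2}" by (rule finite_subset) auto
  have "card {z::int. \<bar>x - of_int z\<bar> \<le> 2} \<le> card {\<lceil>x - 2\<rceil>..\<lfloor>x + 2\<rfloor>}"
    using sub by (intro card_mono) auto
  also have "\<dots> \<le> 5" by (simp, linarith)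
  finally show "card {z::int. \<bar>x - of_int z\<bar> \<le> 2} \<le> 5" .
qed

lemma card_nat_near:
  fixes x :: real
  shows "finite {p::nat. \<bar>x - real p\<bar> \<le> 2}" "card {p::nat. \<bar>x - real p\<bar> \<le> 2} \<le> 5"
proof -
  have sub: "int ` {p::nat. \<bar>x - real p\<bar> \<le> 2} \<subseteq> {z::int. \<bar>x - of_int z\<bar> \<le> 2}" by auto
  then have "finite (int ` {p::nat. \<bar>x - real p\<bar> \<le> 2})"
    using card_int_near finite_subset by blast
  then show "finite {p::nat. \<bar>x - real p\<bar> \<le> 2}" by (simp add: finite_image_iff)
  have "card {p::nat. \<bar>x - real p\<bar> \<le> 2} = card (int ` {p::nat. \<bar>x - real p\<bar> \<le> 2})"
    by (intro card_image[symmetric]) auto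
  also have "\<dots> \<le> card {z::int. \<bar>x - of_int z\<bar> \<le> 2}"
    using card_int_near sub by (intro card_mono) auto
  finally show "card {p::nat. \<bar>x - real p\<bar> \<le> 2} \<le> 5" using card_int_near(2)[of x] by linarith
qed

section \<open>Avoiding sequences of geometric growth\<close>

text \<open>Cells are closed, hence overlap at their endpoints, so that finite unions of them are
  compact.\<close>

definition cell :: "nat \<Rightarrow> nat \<Rightarrow> nat \<Rightarrow> real set" where
  "cell R l p = {real p / real R ^ l .. (real p + 1) / real R ^ l}"

lemma cell_iff:
  assumes "R > 0"
  shows "t \<in> cell R l p \<longleftrightarrow> real p \<le> t * real R ^ l \<and> t * real R ^ l \<le> real p + 1"
  using assms unfolding cell_def by (auto simp: field_simps)

lemma cell_Suc_subset:
  assumes "R > 0"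
  shows "cell R (Suc l) p \<subseteq> cell R l (p div R)"
proof
  fix t assume "t \<in> cell R (Suc l) p"
  then have t: "real p \<le> (t * real R ^ l) * R" "(t * real R ^ l) * R \<le> real p + 1"
    using assms by (auto simp: cell_iff mult_ac)
  have "p div R * R \<le> p" "p + 1 \<le> (p div R + 1) * R"
    using div_mult_mod_eq[of p R] mod_less_divisor[OF assms, of p]
    unfolding add_mult_distrib by linarith+
  then have "real (p div R * R) \<le> real p" "real (p + 1) \<le> real ((p div R + 1) * R)"
    by (simp_all only: of_nat_le_iff)
  then have "real (p div R) * R \<le> (t * real R ^ l) * R" "(t * real R ^ l) * R \<le> (real (p div R) + 1) * R"
    using t unfolding of_nat_mult of_nat_add of_nat_1 by linarith+
  moreover have "real R > 0" using assms by simp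
  ultimately show "t \<in> cell R l (p div R)"
    unfolding cell_iff[OF assms] by simp
qed

lemma cell_add_subset: "R > 0 \<Longrightarrow> cell R (m + h) p \<subseteq> cell R m (p div R ^ h)"
proof (induction h arbitrary: p)
  case (Suc h)
  then have "cell R (Suc (m + h)) p \<subseteq> cell R m (p div R div R ^ h)"
    using cell_Suc_subset by blast
  then show ?case by (simp add: div_mult2_eq)
qed auto

text \<open>Compactness of the nested unions of survivor cells. No branch of the tree is followed:
  the cell around t is chosen afresh at each level, which suffices to avoid what was deleted
  there.\<close>

lemma survivors_limit:
  assumes R: "R > 0" and ne: "\<And>l. survivors R K l \<noteq> {}"
  obtains t where "t \<in> {0..1}"
    and "\<And>l. \<exists>p\<in>survivors R K l. t \<in> cell R l p"
proof -
  let ?X = "\<lambda>l. \<Union>p\<in>survivors R K l. cell R l p"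
  have "(\<Inter>l. ?X l) \<noteq> {}"
  proof (rule compact_nest)
    show "compact (?X l)" for l
      using finite_survivors[OF R] by (intro compact_UN) (auto simp: cell_def)
    show "?X l \<noteq> {}" for l
    proof -
      obtain p where p: "p \<in> survivors R K l" using ne[of l] by blast
      have "real p / real R ^ l \<in> cell R l p" unfolding cell_def using R by (auto intro: divide_right_mono)
      then show ?thesis using p by blast
    qed
    have "?X (Suc l) \<subseteq> ?X l" for l
    proof
      fix t assume "t \<in> ?X (Suc l)"
      then obtain p where "p \<in> survivors R K (Suc l)" "t \<in> cell R (Suc l) p" by blast
      then show "t \<in> ?X l" using cell_Suc_subset[OF R, of l p] by auto
    qed
    then show "?X n \<subseteq> ?X m" if "m \<le> n" for m n
      using that by (rule lift_Suc_antimono_le)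
  qed
  then obtain t where t: "\<And>l. t \<in> ?X l" by blast
  have "t \<in> {0..1}" using t[of 0] by (simp add: cell_def)
  then show ?thesis using that t by blast
qed

text \<open>Uniformity in \<open>b\<close> and in the intervals \<open>cball (c i m) (r i)\<close> is what allows the slicing argument
  below to be carried out with only a Chebyshev estimate.\<close>

lemma avoid_one_dim:
  fixes a :: "nat \<Rightarrow> nat \<Rightarrow> real" and R :: nat and \<sigma> M :: real
  assumes R: "R \<ge> 3" and \<sigma>: "\<sigma> > 0" "real R powr \<sigma> \<le> real (R - 1)"
    and a: "\<And>k. geometric_growth (a k)"
  obtains \<eta> where "\<eta> > 0"
    and "\<And>b c r (I::nat set) Z. \<lbrakk>finite (Z::'z set); real (card Z) \<le> M; \<And>i. i \<in> I \<Longrightarrow> 0 < r i;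
            \<And>F. finite F \<Longrightarrow> F \<subseteq> I \<Longrightarrow> (\<Sum>i\<in>F. r i powr \<sigma>) \<le> \<eta>\<rbrakk> \<Longrightarrow>
          \<exists>t\<in>{0..1}. (\<forall>i\<in>I. \<forall>m\<in>Z. \<bar>t - c (i::nat) m\<bar> > r i) \<and>
            (\<forall>k. \<exists>\<epsilon>>0. \<forall>n. 1 \<le> \<bar>a k n\<bar> \<longrightarrow> (\<forall>z::int. \<epsilon> \<le> \<bar>a k n * t + b k n - of_int z\<bar>))"
proof -
  have R0: "R > 0" "real R > 1" using R by auto
  let ?P = "\<lambda>k M. {n. M \<le> \<bar>a k n\<bar> \<and> \<bar>a k n\<bar> < real R * M}"
  have "\<exists>H::nat. \<forall>M. finite (?P k M) \<and> card (?P k M) \<le> H" for k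
  proof -
    obtain H where "\<And>M. finite (?P k M)" "\<And>M. card (?P k M) \<le> H"
      by (rule geometric_growth_card[OF a[of k], of "real R"]) (use R0 in \<open>auto simp: real_norm_def\<close>)
    then show ?thesis by blast
  qed
  then obtain H :: "nat \<Rightarrow> nat" where Hfin: "\<And>k M. finite (?P k M)" and H: "\<And>k M. card (?P k M) \<le> H k"
    by metis
  \<comment> \<open>At most H k indices n, five integers z for each n, and five cells p for each
    pair.\<close>
  define C where "C k = 25 * real (H k)" for k
  \<comment> \<open>C k does not depend on h, so the growth of the tree over h levels can be made to
    outweigh it.\<close>
  have "\<exists>h. k < h \<and> C k * 2 ^ (k + 2) \<le> real (R - 1) ^ (h - 1)" for k
  proof -
    obtain n where "C k * 2 ^ (k + 2) < real (R - 1) ^ n"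
      using real_arch_pow[of "real (R - 1)"] R by auto
    also have "\<dots> \<le> real (R - 1) ^ (n + k)" using R by (intro power_increasing) auto
    finally show ?thesis by (intro exI[of _ "n + k + 1"]) auto
  qed
  then obtain h where hk: "\<And>k. k < h k" and hC: "\<And>k. C k * 2 ^ (k + 2) \<le> real (R - 1) ^ (h k - 1)"
    by metis
  \<comment> \<open>At level l + 1 the radii exceed R^-(l+2), whence the exponent 2\<sigma> relative
    to (R^\<sigma>)^l. The 10 is five cells per centre times two for the half share, and M bounds
    the number of centres per radius.\<close>
  define \<eta> where "\<eta> = 1 / (real R powr (2 * \<sigma>) * 10 * max M 1)"
  have \<eta>0: "\<eta> > 0" using R0 by (auto simp: \<eta>_def)
  have \<eta>M: "\<eta> * real R powr (2 * \<sigma>) * 10 * M \<le> 1"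
  proof -
    have "\<eta> * real R powr (2 * \<sigma>) * 10 * max M 1 = 1" using R0 unfolding \<eta>_def by simp
    moreover have "\<eta> * real R powr (2 * \<sigma>) * 10 * M \<le> \<eta> * real R powr (2 * \<sigma>) * 10 * max M 1"
      using \<eta>0 by (intro mult_left_mono) auto
    ultimately show ?thesis by linarith
  qed
  \<comment> \<open>This forces every radius to be at most 1 / R, so that no interval has to be
    deleted at the root, where nothing can be killed.\<close>
  have \<eta>1: "\<eta> \<le> real R powr (- \<sigma>)"
  proof -
    have "\<eta> \<le> 1 / real R powr (2 * \<sigma>)" unfolding \<eta>_def using R0
      by (intro divide_left_mono) (auto intro!: mult_pos_pos simp: mult_le_cancel_left1)
    also have "\<dots> = real R powr (- (2 * \<sigma>))" by (simp add: powr_minus_divide)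
    also have "\<dots> \<le> real R powr (- \<sigma>)" using R0 \<sigma> by (intro powr_mono) auto
    finally show ?thesis .
  qed
  show ?thesis
  proof (rule that[OF \<eta>0])
    fix b :: "nat \<Rightarrow> nat \<Rightarrow> real" and c :: "nat \<Rightarrow> 'z \<Rightarrow> real" and r and I :: "nat set" and Z :: "'z set"
    assume Z: "finite Z" "real (card Z) \<le> M" and r0: "\<And>i. i \<in> I \<Longrightarrow> 0 < r i"
      and sum: "\<And>F. finite F \<Longrightarrow> F \<subseteq> I \<Longrightarrow> (\<Sum>i\<in>F. r i powr \<sigma>) \<le> \<eta>"
    let ?s = "\<lambda>l. 1 / real R ^ l"
    \<comment> \<open>If |a k n| lies between R^j and R^(j+1), the parameters t to be avoided form
      intervals of radius at most R^-(j + h k + 1), the cell length at level j + h k + 1, so each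
      costs boundedly many cells there.\<close>
    define \<epsilon> where "\<epsilon> k = 1 / real R ^ (h k + 1)" for k
    have \<epsilon>: "0 < \<epsilon> k" "\<epsilon> k \<le> 1" for k using R0 unfolding \<epsilon>_def by (auto simp: one_le_power[of "real R" "h k + 1", simplified])
    \<comment> \<open>Each interval is deleted at the level whose cell length matches its
      radius.\<close>
    define J where "J l = {i\<in>I. ?s (Suc l) < r i \<and> r i \<le> ?s l}" for l
    define G where "G l = (\<Union>i\<in>J l. \<Union>m\<in>Z. {p. \<bar>c i m * real R ^ l - real p\<bar> \<le> 2})" for l
    define N where "N k l = ?P k (real R ^ (l - h k - 1))" for k l
    define V where "V k l n z p \<longleftrightarrow> (\<exists>t\<in>cell R l p. \<bar>a k n * t + b k n - of_int z\<bar> \<le> \<epsilon> k)" for k l n p and z :: int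
    \<comment> \<open>Coefficients of size at least one first matter at level h k + 1. Below that
      the truncated exponent in N would assign indices to the wrong level.\<close>
    define B where "B k l = (if l \<le> h k then {} else {p. \<exists>n\<in>N k l. \<exists>z. V k l n z p})" for k l
    define K where "K l = (\<Union>k. B k l) \<union> G l" for l
    \<comment> \<open>Each member contributes more than R^(-\<sigma> (l + 1)) to a sum bounded by
      \<eta>.\<close>
    have J: "finite (J l) \<and> card (J l) \<le> \<eta> * real R powr (\<sigma> * (real l + 1))" for l
    proof -
      have bd: "real (card F) \<le> \<eta> * real R powr (\<sigma> * (real l + 1))" if F: "finite F" "F \<subseteq> J l" for F
      proof -
        have "real (card F) * real R powr (- \<sigma> * (real l + 1)) = (\<Sum>i\<in>F. (?s (Suc l)) powr \<sigma>)"
          using R0 by (simp add: powr_minus_divide powr_realpow[symmetric] powr_powr powr_divide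
              mult.commute add.commute del: power_Suc)
        also have "\<dots> \<le> (\<Sum>i\<in>F. r i powr \<sigma>)"
          using F \<sigma> R0 unfolding J_def by (intro sum_mono powr_mono2) auto
        also have "\<dots> \<le> \<eta>" using F unfolding J_def by (intro sum) auto
        finally have "real (card F) * real R powr (- \<sigma> * (real l + 1)) * real R powr (\<sigma> * (real l + 1))
            \<le> \<eta> * real R powr (\<sigma> * (real l + 1))" by (intro mult_right_mono) auto
        then show ?thesis using R0 by (simp add: mult.assoc powr_add[symmetric] flip: distrib_right)
      qed
      have "finite (J l)"
      proof (rule ccontr)
        let ?n = "nat \<lceil>\<eta> * real R powr (\<sigma> * (real l + 1))\<rceil> + 1"
        assume "infinite (J l)"
        then obtain F where "finite F" "card F = ?n" "F \<subseteq> J l"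
          using infinite_arbitrarily_large by blast
        then show False using bd[of F] real_nat_ceiling_ge[of "\<eta> * real R powr (\<sigma> * (real l + 1))"] by simp
      qed
      then show ?thesis using bd by blast
    qed
    have Gfin: "finite (G l)" for l
      unfolding G_def using J Z card_nat_near(1) by (intro finite_UN_I) auto
    have Gcard: "real (card (G (Suc l))) \<le> real (R - 1) ^ l / 2" for l
    proof -
      have "card (G (Suc l)) \<le> (\<Sum>i\<in>J (Suc l). card (\<Union>m\<in>Z. {p. \<bar>c i m * real R ^ Suc l - real p\<bar> \<le> 2}))"
        unfolding G_def using J by (intro card_UN_le) auto
      also have "\<dots> \<le> (\<Sum>i\<in>J (Suc l). \<Sum>m\<in>Z. card {p. \<bar>c i m * real R ^ Suc l - real p\<bar> \<le> 2})"
        using Z by (intro sum_mono card_UN_le) auto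
      also have "\<dots> \<le> (\<Sum>i\<in>J (Suc l). \<Sum>m\<in>Z. 5)"
        by (intro sum_mono card_nat_near)
      also have "\<dots> = 5 * card Z * card (J (Suc l))" by simp
      finally have "real (card (G (Suc l))) \<le> 5 * real (card Z) * real (card (J (Suc l)))"
        by (simp only: of_nat_le_iff of_nat_mult[symmetric] of_nat_numeral[symmetric, where 'a=real])
      also have "\<dots> \<le> 5 * M * (\<eta> * real R powr (\<sigma> * (real (Suc l) + 1)))"
        using J[of "Suc l"] Z by (intro mult_mono) auto
      also have "real R powr (\<sigma> * (real (Suc l) + 1)) = real R powr (2 * \<sigma>) * (real R powr \<sigma>) ^ l"
        using R0 by (simp add: powr_add[symmetric] powr_realpow[symmetric] powr_powr algebra_simps)
      also have "5 * M * (\<eta> * (real R powr (2 * \<sigma>) * (real R powr \<sigma>) ^ l)) =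
          (\<eta> * real R powr (2 * \<sigma>) * 10 * M) * ((real R powr \<sigma>) ^ l / 2)" by simp
      also have "\<dots> \<le> 1 * ((real R powr \<sigma>) ^ l / 2)"
        using \<eta>M by (intro mult_right_mono) auto
      also have "\<dots> \<le> real (R - 1) ^ l / 2"
        using \<sigma> by (auto intro!: power_mono)
      finally show ?thesis .
    qed
    \<comment> \<open>The ancestor q has length R^-(j+1), so a k n t varies by at most one on it
      when n is in the window. Only few integers can then be approached, and each confines t to few
      cells of level l.\<close>
    have Bq: "finite {p\<in>B k l. p div R ^ h k = q} \<and> real (card {p\<in>B k l. p div R ^ h k = q}) \<le> C k" for k l q
    proof (cases "l \<le> h k")
      case False
      define j where "j = l - h k - 1"
      have l: "l = Suc j + h k" using False unfolding j_def by auto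
      define t0 where "t0 = real q / real R ^ Suc j"
      define zs where "zs n = {z::int. \<bar>(a k n * t0 + b k n) - of_int z\<bar> \<le> 2}" for n
      define ps where "ps n z = {p::nat. \<bar>((of_int z - b k n) / a k n) * real R ^ l - real p\<bar> \<le> 2}"
        for n and z :: int
      have sub: "{p\<in>B k l. p div R ^ h k = q} \<subseteq> (\<Union>n\<in>N k l. \<Union>z\<in>zs n. ps n z)"
      proof
        fix p assume p: "p \<in> {p\<in>B k l. p div R ^ h k = q}"
        then obtain n z t where n: "n \<in> N k l" and t: "t \<in> cell R l p"
          and tz: "\<bar>a k n * t + b k n - of_int z\<bar> \<le> \<epsilon> k"
          using False unfolding B_def V_def by auto
        have an: "real R ^ j \<le> \<bar>a k n\<bar>" "\<bar>a k n\<bar> < real R ^ Suc j"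
          using n unfolding N_def j_def by auto
        have an0: "\<bar>a k n\<bar> > 0" using an R0 by (smt (verit) zero_less_power)
        have "t \<in> cell R (Suc j) q"
          using t p cell_add_subset[OF R0(1), of "Suc j" "h k" p] unfolding l by auto
        then have "\<bar>t - t0\<bar> \<le> ?s (Suc j)"
          unfolding cell_def t0_def by (auto simp: add_divide_distrib)
        then have "\<bar>a k n\<bar> * \<bar>t - t0\<bar> \<le> real R ^ Suc j * ?s (Suc j)"
          using an by (intro mult_mono) auto
        then have "\<bar>a k n * t - a k n * t0\<bar> \<le> 1"
          using R0 by (simp add: abs_mult[symmetric] right_diff_distrib)
        then have z: "z \<in> zs n" using tz \<epsilon>(2)[of k] unfolding zs_def by auto
        have "\<bar>(of_int z - b k n) / a k n - t\<bar> * \<bar>a k n\<bar> = \<bar>a k n * t + b k n - of_int z\<bar>"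
          using an0 by (simp add: abs_mult[symmetric] field_simps abs_minus_commute)
        also have "\<dots> \<le> \<epsilon> k" by fact
        finally have "\<bar>(of_int z - b k n) / a k n - t\<bar> \<le> \<epsilon> k / \<bar>a k n\<bar>"
          using an0 by (simp add: field_simps)
        also have "\<dots> \<le> \<epsilon> k / real R ^ j" using an R0 \<epsilon>(1)[of k] an0
          by (intro divide_left_mono) auto
        also have "\<dots> = ?s l" unfolding \<epsilon>_def l using R0 by (simp add: power_add field_simps)
        finally have "\<bar>(of_int z - b k n) / a k n - t\<bar> * real R ^ l \<le> ?s l * real R ^ l"
          by (intro mult_right_mono) auto
        also have "?s l * real R ^ l = 1" using R0 by simp
        finally have "\<bar>((of_int z - b k n) / a k n - t) * real R ^ l\<bar> \<le> 1" using R0 by (simp add: abs_mult)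
        moreover have "\<bar>t * real R ^ l - real p\<bar> \<le> 1"
          using t R0 by (auto simp: cell_iff)
        ultimately have "p \<in> ps n z" unfolding ps_def left_diff_distrib mem_Collect_eq by linarith
        then show "p \<in> (\<Union>n\<in>N k l. \<Union>z\<in>zs n. ps n z)" using n z by blast
      qed
      have Nf: "finite (N k l)" "card (N k l) \<le> H k" using Hfin H unfolding N_def by auto
      have zf: "finite (zs n)" "card (zs n) \<le> 5" for n unfolding zs_def using card_int_near by auto
      have pf: "finite (ps n z)" "card (ps n z) \<le> 5" for n z unfolding ps_def using card_nat_near by auto
      have fin: "finite (\<Union>n\<in>N k l. \<Union>z\<in>zs n. ps n z)" using Nf zf pf by auto
      have "card {p\<in>B k l. p div R ^ h k = q} \<le> card (\<Union>n\<in>N k l. \<Union>z\<in>zs n. ps n z)"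
        using sub fin by (intro card_mono)
      also have "\<dots> \<le> (\<Sum>n\<in>N k l. \<Sum>z\<in>zs n. card (ps n z))"
        using Nf zf by (intro order_trans[OF card_UN_le] sum_mono card_UN_le) auto
      also have "\<dots> \<le> (\<Sum>n\<in>N k l. \<Sum>z\<in>zs n. 5)" by (intro sum_mono pf)
      also have "\<dots> \<le> (\<Sum>n\<in>N k l. 25)" using zf by (intro sum_mono) auto
      also have "\<dots> \<le> 25 * H k" using Nf by simp
      finally have "real (card {p\<in>B k l. p div R ^ h k = q}) \<le> C k"
        unfolding C_def by simp
      then show ?thesis using sub fin finite_subset by blast
    qed (auto simp: B_def C_def)
    have step: "real (R - 1) * card (survivors R K l) \<le> card (survivors R K (Suc l))" for l
    proof (rule card_survivors_Suc[OF R _ _ hk _ _ _ Gfin Gcard])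
      show "K l \<subseteq> (\<Union>k. B k l) \<union> G l" for l unfolding K_def by auto
      show "B k l = {}" if "l < h k" for k l using that unfolding B_def by auto
      show "C k \<le> real (R - 1) ^ (h k - 1) / 2 ^ (k + 2)" for k
        using hC[of k] by (simp add: field_simps)
    qed (use Bq in auto)
    have ne: "survivors R K l \<noteq> {}" for l
    proof -
      have "0 < card (survivors R K l)"
      proof (induction l)
        case (Suc l)
        have "0 < real (R - 1) * card (survivors R K l)" using Suc R by simp
        then show ?case using step[of l] by linarith
      qed simp
      then show ?thesis by auto
    qed
    obtain t where t01: "t \<in> {0..1}" and t: "\<And>l. \<exists>p\<in>survivors R K l. t \<in> cell R l p"
      using survivors_limit[of R K] R0 ne by metis
    have tK: "\<exists>p. p \<notin> K l \<and> t \<in> cell R l p" if "l > 0" for l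
      using t[of l] that by (cases l) auto
    show "\<exists>t\<in>{0..1}. (\<forall>i\<in>I. \<forall>m\<in>Z. \<bar>t - c i m\<bar> > r i) \<and>
            (\<forall>k. \<exists>\<epsilon>>0. \<forall>n. 1 \<le> \<bar>a k n\<bar> \<longrightarrow> (\<forall>z::int. \<epsilon> \<le> \<bar>a k n * t + b k n - of_int z\<bar>))"
    proof (intro bexI[OF _ t01] conjI ballI allI)
      fix i m assume i: "i \<in> I" and m: "m \<in> Z"
      have "r i powr \<sigma> \<le> \<eta>" using sum[of "{i}"] i by simp
      then have "r i powr \<sigma> \<le> (1 / R) powr \<sigma>" using \<eta>1 R0 by (simp add: powr_minus_divide powr_divide)
      then have ri: "r i \<le> 1 / R" using r0[OF i] \<sigma> R0 using powr_less_mono2[of \<sigma> "1 / R" "r i"] by (cases "r i \<le> 1 / R") auto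
      show "r i < \<bar>t - c i m\<bar>"
      proof (rule ccontr)
        assume "\<not> r i < \<bar>t - c i m\<bar>"
        then have tr: "\<bar>t - c i m\<bar> \<le> r i" by simp
        obtain n where n: "?s n < r i" using real_arch_pow_inv[of "r i" "1 / R"] r0[OF i] R0
          by (auto simp: power_divide)
        define l where "l = (LEAST n. ?s (Suc n) < r i)"
        have "?s (Suc n) \<le> ?s n" using R0 by (intro divide_left_mono) (auto simp: mult_le_cancel_right1)
        then have "?s (Suc n) < r i" using n by linarith
        then have l1: "?s (Suc l) < r i" unfolding l_def by (rule LeastI)
        have "l \<noteq> 0"
        proof
          assume "l = 0"
          then show False using l1 ri by simp
        qed
        have "\<not> ?s (Suc (l - 1)) < r i"
          using not_less_Least[of "l - 1" "\<lambda>n. ?s (Suc n) < r i"] \<open>l \<noteq> 0\<close> unfolding l_def by auto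
        then have l2: "r i \<le> ?s l" using \<open>l \<noteq> 0\<close> by simp
        have iJ: "i \<in> J l" unfolding J_def using l1 l2 i by simp
        obtain p where p: "p \<notin> K l" "t \<in> cell R l p" using tK \<open>l \<noteq> 0\<close> by blast
        have "\<bar>t - c i m\<bar> * real R ^ l \<le> ?s l * real R ^ l"
          using tr l2 by (intro mult_right_mono) auto
        then have "\<bar>t * real R ^ l - c i m * real R ^ l\<bar> \<le> 1"
          using R0 by (simp add: abs_mult left_diff_distrib[symmetric])
        moreover have "\<bar>t * real R ^ l - real p\<bar> \<le> 1"
          using p R0 by (auto simp: cell_iff)
        ultimately have "p \<in> G l" using iJ m unfolding G_def by fastforce
        then show False using p unfolding K_def by blast
      qed
    next
      fix k
      show "\<exists>\<epsilon>>0. \<forall>n. 1 \<le> \<bar>a k n\<bar> \<longrightarrow> (\<forall>z::int. \<epsilon> \<le> \<bar>a k n * t + b k n - of_int z\<bar>)"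
      proof (intro exI[of _ "\<epsilon> k"] conjI \<epsilon> allI impI)
        fix n and z :: int
        assume n: "1 \<le> \<bar>a k n\<bar>"
        show "\<epsilon> k \<le> \<bar>a k n * t + b k n - of_int z\<bar>"
        proof (rule ccontr)
          assume less: "\<not> \<epsilon> k \<le> \<bar>a k n * t + b k n - of_int z\<bar>"
          obtain n' where n': "\<bar>a k n\<bar> < real R ^ n'" using real_arch_pow[of "real R"] R0 by auto
          define j where "j = (LEAST m. \<bar>a k n\<bar> < real R ^ Suc m)"
          have "real R ^ n' \<le> real R ^ Suc n'" using R0 by (intro power_increasing) auto
          then have "\<bar>a k n\<bar> < real R ^ Suc n'" using n' by linarith
          then have j1: "\<bar>a k n\<bar> < real R ^ Suc j" unfolding j_def by (rule LeastI)
          have j2: "real R ^ j \<le> \<bar>a k n\<bar>"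
          proof (cases "j = 0")
            case False
            then show ?thesis
              using not_less_Least[of "j - 1" "\<lambda>m. \<bar>a k n\<bar> < real R ^ Suc m"] unfolding j_def by auto
          next
            case True
            then show ?thesis using n by simp
          qed
          define l where "l = j + h k + 1"
          have nN: "n \<in> N k l" unfolding N_def l_def mem_Collect_eq using j1 j2 by simp
          obtain p where p: "p \<notin> K l" "t \<in> cell R l p" using tK[of l] unfolding l_def by auto
          have "V k l n z p" unfolding V_def using p less by (intro bexI[of _ t]) auto
          then have "p \<in> B k l" unfolding B_def using nN unfolding l_def by auto
          then show False using p unfolding K_def by blast
        qed
      qed
    qed
  qed
qed

section \<open>Growth of orbits of matrices\<close>

abbreviation orbit :: "'a::comm_ring_1^'n^'n \<Rightarrow> 'a^'n \<Rightarrow> nat \<Rightarrow> 'a^'n" where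
  "orbit A x n \<equiv> ((*v) A ^^ n) x"

definition cvec :: "real^'n \<Rightarrow> complex^'n" where
  "cvec x = (\<chi> i. of_real (x $ i))"

lemma norm_cvec [simp]: "norm (cvec x) = norm x"
  by (simp add: cvec_def norm_vec_def)

lemma cvec_0 [simp]: "cvec 0 = 0" and cvec_eq_0 [simp]: "cvec x = 0 \<longleftrightarrow> x = 0"
  and cvec_add: "cvec (x + y) = cvec x + cvec y" and cvec_diff: "cvec (x - y) = cvec x - cvec y"
  and cvec_scaleR: "cvec (c *\<^sub>R x) = c *\<^sub>R cvec x"
  by (simp_all add: cvec_def vec_eq_iff scaleR_conv_of_real[where 'a = complex])

lemma cvec_matrix_mult: "map_matrix of_int A *v cvec x = cvec (map_matrix of_int A *v x)"
  by (simp add: cvec_def vec_eq_iff matrix_vector_mult_def)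

lemma cvec_orbit: "orbit (map_matrix of_int A) (cvec x) n = cvec (orbit (map_matrix of_int A) x n)"
  by (induction n) (simp_all add: cvec_matrix_mult)

lemma norm_vector_scalar: "norm (c *s x :: complex^'n) = cmod c * norm x"
  by (simp add: norm_vec_def norm_mult L2_set_right_distrib)

lemma mat_mult_vector: "mat c *v x = c *s (x :: 'a::comm_ring_1^'n)"
  by (simp add: vec_eq_iff matrix_vector_mult_def mat_def if_distrib if_distribR sum.delta' cong: if_cong)

lemma orbit_add: "orbit A (x + y) n = orbit A x n + orbit A y n"
  by (induction n) (simp_all add: matrix_vector_right_distrib)

lemma orbit_0 [simp]: "orbit A 0 n = 0"
  by (induction n) simp_all

lemma orbit_diff: "orbit A (x - y) n = orbit A x n - orbit A y n"
  by (induction n) (simp_all add: matrix_vector_mult_diff_distrib)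

lemma vec_scale_matrix: "A *v (c *s x) = c *s (A *v x :: 'a::comm_ring_1^'n)"
  by (simp add: vec_eq_iff matrix_vector_mult_def sum_distrib_left mult_ac)

lemma orbit_scale: "orbit A (c *s x) n = c *s orbit A x n"
  by (induction n) (simp_all add: vec_scale_matrix)

text \<open>A commutes with A - c; with z the orbit of (A - c) x this is the recurrence x_(n+1) = c
  x_n + z_n on which the growth estimates rest.\<close>

lemma orbit_shift:
  "orbit A ((A - mat c) *v x) n = orbit A x (Suc n) - c *s orbit A x n"
  by (simp add: matrix_vector_mult_diff_rdistrib mat_mult_vector orbit_diff orbit_scale
      del: funpow.simps(2)) (simp add: funpow_swap1)

lemma norm_matrix_vector_bound:
  fixes A :: "complex^'n^'n"
  obtains K where "K > 0" "\<forall>x. norm (A *v x) \<le> K * norm x"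
proof -
  obtain K where "K > 0" "\<forall>x. norm (A *v x) \<le> norm x * K"
    using bounded_linear.pos_bounded[OF matrix_vector_mul_bounded_linear[of A]] by blast
  then show ?thesis using that[of K] by (simp add: mult.commute)
qed

text \<open>The constant is uniform in n because the n-th vector on the left is A - c applied to the
  n-th vector on the right.\<close>

lemma norm_orbit_shift_bound:
  fixes A :: "complex^'n^'n"
  obtains K where "K > 0" "\<forall>x n. norm (orbit A ((A - mat c) *v x) n) \<le> K * norm (orbit A x n)"
proof -
  obtain K where K: "K > 0" "\<forall>x. norm (A *v x) \<le> K * norm x"
    by (rule norm_matrix_vector_bound)
  have "norm (orbit A ((A - mat c) *v x) n) \<le> (K + cmod c) * norm (orbit A x n)" for x n
    unfolding orbit_shift
    using norm_triangle_ineq4[of "A *v orbit A x n" "c *s orbit A x n"] spec[OF K(2), of "orbit A x n"]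
    by (simp add: norm_vector_scalar algebra_simps)
  then show ?thesis using K(1) by (intro that[of "K + cmod c"]) (auto intro: add_pos_nonneg)
qed

text \<open>Boundedness and geometric growth of an orbit can both be read off the orbit of
  \<open>(A - c) x\<close>, since \<open>A\<^sup>n x\<close> solves a first-order recurrence driven by the latter.\<close>

lemma bounded_orbit_shift:
  fixes A :: "complex^'n^'n"
  assumes "cmod c < 1" "bounded (range (orbit A ((A - mat c) *v x)))"
  shows "bounded (range (orbit A x))"
proof -
  obtain B where B: "\<And>n. norm (orbit A ((A - mat c) *v x) n) \<le> B"
    using assms(2) unfolding bounded_iff by auto
  \<comment> \<open>B / (1 - |c|) is the fixed point of D = B + |c| D; a larger D is preserved by
    the recurrence.\<close>
  define D where "D = max (norm x) (B / (1 - cmod c))"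
  have D: "B + cmod c * D \<le> D"
  proof -
    have "B / (1 - cmod c) \<le> D" unfolding D_def by simp
    then show ?thesis using assms(1) by (simp add: field_simps)
  qed
  have "norm (orbit A x n) \<le> D" for n
  proof (induction n)
    case (Suc n)
    have "orbit A x (Suc n) = orbit A ((A - mat c) *v x) n + c *s orbit A x n"
      unfolding orbit_shift by simp
    also have "norm \<dots> \<le> B + cmod c * norm (orbit A x n)"
      using norm_triangle_ineq[of "orbit A ((A - mat c) *v x) n" "c *s orbit A x n"] B[of n]
      unfolding norm_vector_scalar by linarith
    also have "\<dots> \<le> B + cmod c * D" using Suc by (simp add: mult_left_mono)
    finally show ?case using D by linarith
  qed (simp add: D_def)
  then show ?thesis unfolding bounded_iff by auto
qed

text \<open>For |c| \<le> 1 the recurrence only adds up the z_i, and geometric growth makes their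
  sum comparable to the last one. As z_n is conversely bounded by a multiple of x_n, both orbits
  have the same size at each time.\<close>

lemma geometric_growth_slow:
  fixes A :: "complex^'n^'n"
  assumes c: "cmod c \<le> 1" and G: "geometric_growth (orbit A ((A - mat c) *v x))"
  shows "geometric_growth (orbit A x)"
proof -
  let ?z = "orbit A ((A - mat c) *v x)"
  obtain r C where r: "0 < r" "r < 1" and C0: "C > 0" and nz: "\<forall>n. ?z n \<noteq> 0"
    and C': "\<forall>i n. i \<le> n \<longrightarrow> norm (?z i) \<le> C * r ^ (n - i) * norm (?z n)"
    by (rule geometric_growthE[OF G])
  have C: "norm (?z i) \<le> C * r ^ (n - i) * norm (?z n)" if "i \<le> n" for i n
    using C' that by blast
  obtain K where K0: "K > 0" and K': "\<forall>x n. norm (orbit A ((A - mat c) *v x) n) \<le> K * norm (orbit A x n)"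
    by (rule norm_orbit_shift_bound[of A c])
  have K: "norm (?z n) \<le> K * norm (orbit A x n)" for n using K' by blast
  have xn: "orbit A x n \<noteq> 0" for n using K[of n] nz by auto
  have step: "norm (orbit A x (Suc n)) \<le> norm (orbit A x n) + norm (?z n)" for n
  proof -
    have "orbit A x (Suc n) = c *s orbit A x n + ?z n"
      unfolding orbit_shift by simp
    then have "norm (orbit A x (Suc n)) \<le> cmod c * norm (orbit A x n) + norm (?z n)"
      using norm_triangle_ineq[of "c *s orbit A x n" "?z n"] by (simp add: norm_vector_scalar)
    then show ?thesis using c mult_right_mono[OF c norm_ge_zero, of "orbit A x n"] by linarith
  qed
  have sum: "norm (orbit A x n) \<le> norm x + (\<Sum>i<n. norm (?z i))" for n
  proof (induction n)
    case (Suc n)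
    then show ?case using step[of n] by (simp del: funpow.simps(2))
  qed simp
  \<comment> \<open>The first summand bounds the initial vector by z_n, the second is the geometric
    series for the sum of the z_i.\<close>
  define E where "E = C * norm x / norm (?z 0) + C / (1 - r)"
  have up: "norm (orbit A x n) \<le> E * norm (?z n)" for n
  proof -
    have "(\<Sum>i<n. norm (?z i)) \<le> (\<Sum>i<n. C * r ^ (n - i) * norm (?z n))"
      by (intro sum_mono C) auto
    also have "\<dots> = C * norm (?z n) * (\<Sum>i<n. r ^ (n - i))"
      by (subst sum_distrib_left) (simp only: mult_ac)
    also have "\<dots> \<le> C * norm (?z n) * (1 / (1 - r))"
    proof (rule mult_left_mono)
      have "(\<Sum>i<n. r ^ (n - i)) \<le> (\<Sum>i<n. r ^ (n - Suc i))"
        using r by (intro sum_mono power_decreasing) auto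
      also have "\<dots> = (\<Sum>i<n. r ^ i)"
        by (rule sum.nat_diff_reindex)
      also have "\<dots> \<le> (\<Sum>i. r ^ i)"
        using r by (intro sum_le_suminf) auto
      also have "\<dots> = 1 / (1 - r)" using r by (intro suminf_geometric) auto
      finally show "(\<Sum>i<n. r ^ (n - i)) \<le> 1 / (1 - r)" .
    qed (use C0 in auto)
    finally have s: "(\<Sum>i<n. norm (?z i)) \<le> C / (1 - r) * norm (?z n)"
      by (simp add: mult_ac)
    have "norm (?z 0) \<le> C * r ^ n * norm (?z n)" using C[of 0 n] by simp
    also have "\<dots> \<le> C * 1 * norm (?z n)"
      using C0 r by (intro mult_right_mono mult_left_mono power_le_one) auto
    finally have "norm x * norm (?z 0) \<le> norm x * (C * norm (?z n))"
      by (intro mult_left_mono) auto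
    then have "norm x \<le> C * norm x / norm (?z 0) * norm (?z n)"
      using spec[OF nz, of 0] by (simp add: pos_le_divide_eq mult_ac)
    then show ?thesis using sum[of n] s unfolding E_def by (simp add: distrib_right)
  qed
  have E0: "E \<ge> 0" using C0 r unfolding E_def by auto
  have "norm (orbit A x i) \<le> (E * C * K) * r ^ (n - i) * norm (orbit A x n)" if "i \<le> n" for i n
  proof -
    have "norm (orbit A x i) \<le> E * norm (?z i)" by (rule up)
    also have "\<dots> \<le> E * (C * r ^ (n - i) * norm (?z n))"
      by (intro mult_left_mono C that E0)
    also have "\<dots> \<le> E * (C * r ^ (n - i) * (K * norm (orbit A x n)))"
      using E0 C0 r by (intro mult_left_mono K) auto
    finally show ?thesis by (simp add: mult_ac)
  qed
  then show ?thesis using xn r by (intro geometric_growthI)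
qed

text \<open>Here the recurrence itself expands and is run backwards: |c| |x_n| \<le> |x_(n+1)| +
  |z_n|. A rate s strictly between max (1 / |c|) r and 1 leaves room to absorb z. The case (A - c) x
  = 0 is that of an eigenvector.\<close>

lemma geometric_growth_fast:
  fixes A :: "complex^'n^'n"
  assumes c: "cmod c > 1" and x: "x \<noteq> 0"
    and G: "(A - mat c) *v x = 0 \<or> geometric_growth (orbit A ((A - mat c) *v x))"
  shows "geometric_growth (orbit A x)"
proof -
  let ?z = "orbit A ((A - mat c) *v x)" and ?L = "cmod c"
  obtain K where K0: "K > 0" and K': "\<forall>x n. norm (orbit A ((A - mat c) *v x) n) \<le> K * norm (orbit A x n)"
    by (rule norm_orbit_shift_bound[of A c])
  have K: "norm (?z n) \<le> K * norm (orbit A x n)" for n using K' by blast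
  have "\<exists>C r. 0 < r \<and> r < 1 \<and> C \<ge> 0 \<and> (\<forall>i n. i \<le> n \<longrightarrow> norm (?z i) \<le> C * r ^ (n - i) * norm (?z n))"
    using G
  proof
    assume "(A - mat c) *v x = 0"
    then show ?thesis by (intro exI[of _ 0] exI[of _ "1/2"]) auto
  next
    assume "geometric_growth ?z"
    then show ?thesis by (rule geometric_growthE) (metis less_imp_le)
  qed
  then obtain C r where r: "0 < r" "r < 1" and C0: "C \<ge> 0"
    and C: "\<And>i n. i \<le> n \<Longrightarrow> norm (?z i) \<le> C * r ^ (n - i) * norm (?z n)" by blast
  have lower: "?L * norm (orbit A x n) \<le> norm (orbit A x (Suc n)) + norm (?z n)" for n
  proof -
    have "c *s orbit A x n = orbit A x (Suc n) - ?z n"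
      unfolding orbit_shift by simp
    then have "norm (c *s orbit A x n) \<le> norm (orbit A x (Suc n)) + norm (?z n)"
      by (simp only: norm_triangle_ineq4)
    then show ?thesis by (simp only: norm_vector_scalar)
  qed
  have L1: "1 / ?L < 1" using c by (subst divide_less_eq_1) linarith
  obtain s where s: "max (1 / ?L) r < s" "s < 1"
    using dense[of "max (1 / ?L) r" 1] L1 r unfolding max_less_iff_conj by blast
  have s1: "1 / ?L < s" "r < s" using s by auto
  have "?L > 0" using c by linarith
  then have Ls: "?L * s > 1" using s1 by (simp add: pos_divide_less_eq mult.commute)
  have s0: "s > 0" "r \<le> s" using s1 r by auto
  \<comment> \<open>Solves D / s + C K \<le> D |c|, which closes the backward induction; D \<ge> 1
    starts it.\<close>
  define D where "D = max 1 (C * K / (?L * (1 - 1 / (?L * s))))"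
  have pos: "?L * (1 - 1 / (?L * s)) > 0"
  proof (rule mult_pos_pos)
    show "1 - 1 / (?L * s) > 0" using Ls by simp
  qed fact
  have "C * K / (?L * (1 - 1 / (?L * s))) \<le> D" unfolding D_def by simp
  then have "C * K \<le> D * (?L * (1 - 1 / (?L * s)))"
    using pos by (simp add: pos_divide_le_eq)
  also have "\<dots> = D * ?L - D / s"
  proof -
    have "?L \<noteq> 0" "s \<noteq> 0" using c s0 by linarith+
    then have "?L * (1 - 1 / (?L * s)) = ?L - 1 / s" by (simp add: field_simps)
    then show ?thesis by (simp add: right_diff_distrib)
  qed
  finally have D: "D / s + C * K \<le> D * ?L" by simp
  have main: "norm (orbit A x (n - j)) \<le> D * s ^ j * norm (orbit A x n)" if "j \<le> n" for j n
    using that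
  proof (induction j)
    case 0
    have "1 * norm (orbit A x n) \<le> D * norm (orbit A x n)"
      by (intro mult_right_mono) (auto simp: D_def)
    then show ?case by simp
  next
    case (Suc j)
    let ?i = "n - Suc j"
    have i: "Suc ?i = n - j" "n - ?i = Suc j" using Suc.prems by auto
    have "norm (?z ?i) \<le> C * r ^ Suc j * norm (?z n)"
      using C[of ?i n] i by simp
    also have "\<dots> \<le> C * r ^ Suc j * (K * norm (orbit A x n))"
      using C0 r by (intro mult_left_mono K) auto
    also have "\<dots> \<le> C * s ^ Suc j * (K * norm (orbit A x n))"
      using s0 r C0 K0 by (intro mult_right_mono mult_left_mono power_mono) auto
    finally have "?L * norm (orbit A x ?i) \<le> D * s ^ j * norm (orbit A x n) + C * s ^ Suc j * (K * norm (orbit A x n))"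
      using lower[of ?i] Suc unfolding i by linarith
    also have "\<dots> = (D / s + C * K) * (s ^ Suc j * norm (orbit A x n))"
      using s0 by (simp add: field_simps)
    also have "\<dots> \<le> D * ?L * (s ^ Suc j * norm (orbit A x n))"
      using D s0 by (intro mult_right_mono) auto
    finally have "?L * norm (orbit A x ?i) \<le> ?L * (D * s ^ Suc j * norm (orbit A x n))"
      by (simp only: mult_ac)
    then show ?case using c by (simp only: mult_le_cancel_left_pos)
  qed
  have main': "norm (orbit A x i) \<le> D * s ^ (n - i) * norm (orbit A x n)" if "i \<le> n" for i n
    using main[of "n - i" n] that by simp
  have "orbit A x n \<noteq> 0" for n using main'[of 0 n] x by auto
  then show ?thesis using s0 s(2) main' by (intro geometric_growthI)
qed

section \<open>Polynomials in a matrix\<close>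

definition mpoly :: "'a::comm_ring_1 poly \<Rightarrow> 'a^'n^'n \<Rightarrow> 'a^'n^'n" where
  "mpoly p A = fold_coeffs (\<lambda>a X. mat a + A ** X) p 0"

lemma mpoly_0 [simp]: "mpoly 0 A = 0"
  by (simp add: mpoly_def)

lemma mpoly_pCons [simp]: "mpoly (pCons a p) A = mat a + A ** mpoly p A"
  by (cases "p = 0 \<and> a = 0") (auto simp: mpoly_def)

lemma mat_add: "mat (a + b) = mat a + (mat b :: 'a::comm_ring_1^'n^'n)"
  by (simp add: mat_def vec_eq_iff)

lemma mat_mult_left: "mat c ** A = (\<chi> i j. (c::'a::comm_ring_1) * A $ i $ j)"
  and mat_mult_right: "A ** mat c = (\<chi> i j. (c::'a::comm_ring_1) * A $ i $ j)"
  by (simp_all add: vec_eq_iff matrix_matrix_mult_def mat_def if_distrib if_distribR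
      sum.delta sum.delta' mult.commute cong: if_cong)

lemma mat_commute: "mat c ** A = A ** (mat c :: 'a::comm_ring_1^'n^'n)"
  by (simp add: mat_mult_left mat_mult_right)

lemma mpoly_add: "mpoly (p + q) A = mpoly p A + mpoly q A"
  by (induction p q rule: poly_induct2) (simp_all add: mat_add matrix_add_ldistrib)

lemma mpoly_smult: "mpoly (smult c p) A = mat c ** mpoly p A"
proof (induction p)
  case (pCons a p)
  have "mat c ** (A ** mpoly p A) = A ** (mat c ** mpoly p A)"
    by (subst (1 2) matrix_mul_assoc) (simp only: mat_commute)
  moreover have "mat (c * a) = mat c ** (mat a :: 'a^'n^'n)"
    unfolding mat_mult_left by (simp add: mat_def vec_eq_iff)
  ultimately show ?case using pCons by (simp add: matrix_add_ldistrib)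
qed simp

lemma matrix_add_rdistrib: "(A + B) ** C = A ** C + B ** (C :: 'a::comm_ring_1^'n^'n)"
  by (simp add: vec_eq_iff matrix_matrix_mult_def sum.distrib distrib_right)

lemma mpoly_mult: "mpoly (p * q) A = mpoly p A ** mpoly q A"
  by (induction p) (simp_all add: mpoly_add mpoly_smult matrix_add_rdistrib matrix_mul_assoc)

lemma mpoly_1 [simp]: "mpoly 1 A = mat 1"
  by (simp add: one_pCons)

lemma mpoly_linear [simp]: "mpoly [:-c, 1:] A = A - mat c"
proof -
  have "mat (-c) = - (mat c :: 'a^'n^'n)" by (simp add: mat_def vec_eq_iff)
  then show ?thesis by simp
qed

lemma mpoly_monom_vector: "mpoly (monom 1 n) A *v x = orbit A x n"
  by (induction n) (simp_all add: monom_Suc monom_0 matrix_vector_mul_assoc[symmetric])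

lemma mpoly_sum: "mpoly (\<Sum>i\<in>F. f i) A = (\<Sum>i\<in>F. mpoly (f i) A)"
  by (induction F rule: infinite_finite_induct) (simp_all add: mpoly_add)

text \<open>More powers of A than the real dimension of the matrix space are linearly dependent.
  Dependence concerns the set of powers, so the case of two equal powers is treated
  separately.\<close>

lemma annihilating_polynomial:
  fixes A :: "complex^'n^'n"
  obtains p where "p \<noteq> 0" "mpoly p A = 0"
proof -
  let ?m = "\<lambda>i. mpoly (monom 1 i) A"
  define F where "F = {..DIM(complex^'n^'n)}"
  show ?thesis
  proof (cases "inj_on ?m F")
    case False
    then obtain i j where ij: "i \<noteq> j" "?m i = ?m j" unfolding inj_on_def by blast
    have "monom (1::complex) i - monom 1 j \<noteq> 0"
      using ij(1) by (auto dest: arg_cong[where f = degree] simp: degree_monom_eq)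
    moreover have "mpoly (monom 1 i + - monom 1 j) A = 0"
      unfolding mpoly_add using ij(2) mpoly_smult[of "-1" "monom 1 j" A]
      by (simp add: mat_mult_left vec_eq_iff)
    ultimately show ?thesis using that[of "monom 1 i - monom 1 j"] by simp
  next
    case True
    have "dependent (?m ` F)"
    proof (rule dependent_biggerset)
      have "card (?m ` F) = Suc (DIM(complex^'n^'n))"
        using card_image[OF True] unfolding F_def by simp
      then show "card (?m ` F) > DIM(complex^'n^'n)" by simp
    qed
    then obtain u where u: "\<exists>v\<in>?m ` F. u v \<noteq> 0" "(\<Sum>v\<in>?m ` F. u v *\<^sub>R v) = 0"
      using dependent_finite[of "?m ` F"] unfolding F_def by auto
    define p :: "complex poly" where "p = (\<Sum>i\<in>F. smult (of_real (u (?m i))) (monom 1 i))"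
    obtain i where i: "i \<in> F" "u (?m i) \<noteq> 0" using u(1) by blast
    have "coeff p i = (\<Sum>j\<in>F. if i = j then of_real (u (?m j)) else 0)"
      unfolding p_def by (auto simp: coeff_sum intro!: sum.cong)
    also have "\<dots> = of_real (u (?m i))" using i(1) unfolding F_def by simp
    finally have "p \<noteq> 0" using i(2) by auto
    moreover have "mpoly p A = (\<Sum>i\<in>F. u (?m i) *\<^sub>R ?m i)"
      unfolding p_def mpoly_sum mpoly_smult
      by (intro sum.cong) (auto simp: mat_mult_left vec_eq_iff scaleR_conv_of_real[where 'a = complex])
    moreover have "\<dots> = 0" using u(2) sum.reindex[OF True, of "\<lambda>v. u v *\<^sub>R v"] by simp
    ultimately show ?thesis using that by simp
  qed
qed

lemma annihilating_multiset:
  fixes A :: "complex^'n^'n"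
  obtains L where "mpoly (\<Prod>l\<in>#L. [:-l, 1:]) A = 0"
proof -
  obtain p where p: "p \<noteq> 0" "mpoly p A = 0" by (rule annihilating_polynomial)
  let ?P = "\<Prod>l\<in>#proots p. [:-l, 1:]"
  have "mat (lead_coeff p) ** mpoly ?P A = 0"
    using p(2) by (subst (asm) complex_poly_decompose_multiset[symmetric]) (simp add: mpoly_smult)
  then have "mpoly ?P A = 0" using p(1) by (simp add: mat_mult_left vec_eq_iff)
  then show ?thesis by (rule that)
qed

text \<open>One factor is removed at a time: A - l either kills x or sends it to a nonzero vector
  annihilated by the remaining factors.\<close>

lemma geometric_growth_fast_mset:
  fixes A :: "complex^'n^'n"
  assumes "\<forall>l\<in>#L. cmod l > 1" "x \<noteq> 0" "mpoly (\<Prod>l\<in>#L. [:-l, 1:]) A *v x = 0"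
  shows "geometric_growth (orbit A x)"
  using assms
proof (induction L arbitrary: x)
  case (add l L)
  have "mpoly ((\<Prod>l\<in>#L. [:-l, 1:]) * [:-l, 1:]) A *v x = 0"
    using add.prems(3) by (simp add: mult.commute)
  then have "mpoly (\<Prod>l\<in>#L. [:-l, 1:]) A *v ((A - mat l) *v x) = 0"
    unfolding mpoly_mult mpoly_linear by (simp add: matrix_vector_mul_assoc)
  then have "(A - mat l) *v x = 0 \<or> geometric_growth (orbit A ((A - mat l) *v x))"
    using add by auto
  then show ?case using add.prems by (intro geometric_growth_fast) auto
qed auto

lemma geometric_growth_slow_mset:
  fixes A :: "complex^'n^'n"
  assumes "\<forall>l\<in>#L. cmod l \<le> 1" "geometric_growth (orbit A (mpoly (\<Prod>l\<in>#L. [:-l, 1:]) A *v x))"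
  shows "geometric_growth (orbit A x)"
  using assms
proof (induction L arbitrary: x)
  case (add l L)
  have "mpoly (\<Prod>l\<in>#add_mset l L. [:-l, 1:]) A = mpoly ((\<Prod>l\<in>#L. [:-l, 1:]) * [:-l, 1:]) A"
    by (simp add: mult.commute)
  then have "geometric_growth (orbit A (mpoly (\<Prod>l\<in>#L. [:-l, 1:]) A *v ((A - mat l) *v x)))"
    using add.prems(2) unfolding mpoly_mult mpoly_linear by (simp add: matrix_vector_mul_assoc)
  then have "geometric_growth (orbit A ((A - mat l) *v x))" using add by auto
  then show ?case using add.prems by (intro geometric_growth_slow) auto
qed simp

text \<open>Splitting an annihilating polynomial into its factors with roots inside and outside the closed
  unit disc, \<open>S\<close> and \<open>F\<close>, a vector outside the kernel of \<open>S(A)\<close> grows geometrically because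
  \<open>F(A)\<close> annihilates its image under \<open>S(A)\<close>.\<close>

lemma geometric_growth_outside_slow_space:
  fixes A :: "complex^'n^'n"
  obtains L where "\<forall>l\<in>#L. cmod l \<le> 1"
    "\<forall>x. mpoly (\<Prod>l\<in>#L. [:-l, 1:]) A *v x \<noteq> 0 \<longrightarrow> geometric_growth (orbit A x)"
proof -
  obtain L where L: "mpoly (\<Prod>l\<in>#L. [:-l, 1:]) A = 0" by (rule annihilating_multiset)
  let ?p = "\<lambda>L. \<Prod>l\<in>#L. [:-l, 1:]"
  define S F where "S = filter_mset (\<lambda>l. cmod l \<le> 1) L" and "F = filter_mset (\<lambda>l. \<not> cmod l \<le> 1) L"
  have "L = S + F" unfolding S_def F_def by (rule multiset_partition)
  then have "?p L = ?p F * ?p S" by (simp add: mult.commute)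
  then have FS: "mpoly (?p F) A *v (mpoly (?p S) A *v x) = 0" for x
    using L by (simp add: mpoly_mult matrix_vector_mul_assoc)
  have SF: "\<forall>l\<in>#S. cmod l \<le> 1" "\<forall>l\<in>#F. cmod l > 1"
    unfolding S_def F_def by auto
  have "geometric_growth (orbit A x)" if "mpoly (?p S) A *v x \<noteq> 0" for x
    by (rule geometric_growth_slow_mset[OF SF(1) geometric_growth_fast_mset[OF SF(2) that FS]])
  then show ?thesis using SF that by blast
qed

section \<open>Automorphisms have expanding directions\<close>

abbreviation cmat :: "int^'n^'n \<Rightarrow> complex^'n^'n" where "cmat \<equiv> map_matrix of_int"
abbreviation rmat :: "int^'n^'n \<Rightarrow> real^'n^'n" where "rmat \<equiv> map_matrix of_int"

lemma mpoly_eigenvector: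
  assumes "A *v v = c *s v"
  shows "mpoly p A *v v = poly p c *s v"
proof (induction p)
  case (pCons a p)
  then show ?case using assms
    by (simp add: matrix_vector_mult_add_rdistrib mat_mult_vector matrix_vector_mul_assoc[symmetric]
        vec_scale_matrix vec.scale_left_distrib mult.commute)
qed simp

text \<open>When the factors are applied to v one after another, the last nonzero vector is an
  eigenvector for the factor that kills it.\<close>

lemma eigenvalue_of_prod:
  fixes A :: "complex^'n^'n"
  assumes "v \<noteq> 0" "mpoly (\<Prod>l\<in>#L. [:-l, 1:]) A *v v = 0"
  shows "\<exists>l w. l \<in># L \<and> w \<noteq> 0 \<and> A *v w = l *s w"
  using assms
proof (induction L arbitrary: v)
  case (add l L)
  show ?case
  proof (cases "(A - mat l) *v v = 0")
    case True
    then have "A *v v = l *s v" by (simp add: matrix_vector_mult_diff_rdistrib mat_mult_vector)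
    then show ?thesis using add.prems(1) by (intro exI[of _ l] exI[of _ v]) simp
  next
    case False
    have "mpoly ((\<Prod>l\<in>#L. [:-l, 1:]) * [:-l, 1:]) A *v v = 0"
      using add.prems(2) by (simp add: mult.commute)
    then have "mpoly (\<Prod>l\<in>#L. [:-l, 1:]) A *v ((A - mat l) *v v) = 0"
      unfolding mpoly_mult mpoly_linear by (simp add: matrix_vector_mul_assoc)
    then obtain l' w where "l' \<in># L" "w \<noteq> 0" "A *v w = l' *s w"
      using add.IH[OF False] by blast
    then show ?thesis by (intro exI[of _ l'] exI[of _ w]) simp
  qed
qed auto

lemma eigenvalue_of_poly:
  fixes A :: "complex^'n^'n"
  assumes "v \<noteq> 0" "p \<noteq> 0" "mpoly p A *v v = 0"
  obtains l w where "poly p l = 0" "w \<noteq> 0" "A *v w = l *s w"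
proof -
  have "mpoly (smult (lead_coeff p) (\<Prod>l\<in>#proots p. [:-l, 1:])) A *v v = 0"
    using assms(3) by (simp only: complex_poly_decompose_multiset)
  then have "lead_coeff p *s (mpoly (\<Prod>l\<in>#proots p. [:-l, 1:]) A *v v) = 0"
    by (simp add: mpoly_smult matrix_vector_mul_assoc[symmetric] mat_mult_vector)
  then have "mpoly (\<Prod>l\<in>#proots p. [:-l, 1:]) A *v v = 0"
    using assms(2) by simp
  then obtain l w where "l \<in># proots p" "w \<noteq> 0" "A *v w = l *s w"
    using eigenvalue_of_prod[OF assms(1)] by blast
  then show ?thesis using that[of l w] assms(2) by simp
qed

lemma monom_minus_1_nonzero: "n > 0 \<Longrightarrow> monom (1::complex) n - 1 \<noteq> 0"
  by (auto dest: arg_cong[where f = degree] simp: degree_monom_eq)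

lemma mpoly_monom_minus_1: "mpoly (monom 1 n - 1) A *v x = orbit A x n - x"
proof -
  have "monom 1 n = (monom 1 n - 1) + (1 :: 'a poly)" by simp
  then have "orbit A x n = mpoly (monom 1 n - 1) A *v x + x"
    using mpoly_monom_vector[of n A x] mpoly_add[of "monom 1 n - 1" 1 A]
    by (simp add: matrix_vector_mult_add_rdistrib)
  then show ?thesis by simp
qed

text \<open>A vector fixed by S^n is annihilated by X^n - 1, so if nonzero it produces an eigenvalue
  that is a root of unity.\<close>

lemma quasihyperbolic_no_periodic:
  assumes "quasihyperbolic S" "n > 0" "orbit (cmat S) v n = v"
  shows "v = 0"
proof (rule ccontr)
  assume "v \<noteq> 0"
  moreover have "mpoly (monom 1 n - 1) (cmat S) *v v = 0"
    using assms(3) by (simp add: mpoly_monom_minus_1)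
  ultimately obtain l w where lw: "poly (monom 1 n - 1) l = 0" "w \<noteq> 0" "cmat S *v w = l *s w"
    using eigenvalue_of_poly[OF _ monom_minus_1_nonzero[OF assms(2)]] by blast
  then have "l ^ n = 1" by (simp add: poly_monom)
  moreover have "is_eigenvalue S l" unfolding is_eigenvalue_def using lw by blast
  ultimately show False using assms(1,2) unfolding quasihyperbolic_def by blast
qed

section \<open>Determinants and the characteristic polynomial\<close>

lemma det_zero_kernel:
  fixes A :: "complex^'n^'n"
  assumes "det A = 0"
  obtains v where "v \<noteq> 0" "A *v v = 0"
  using assms matrix_left_invertible_ker[of A] invertible_det_nz[of A] invertible_left_inverse[of A]
  by blast

text \<open>The Leibniz formula commutes with ring homomorphisms. The instances are the embeddings
  of the integers into real and complex numbers and the evaluation of polynomials.\<close>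

lemma det_hom:
  assumes "\<And>a b. h (a + b) = h a + h b" "\<And>a b. h (a * b) = h a * h b" "h 1 = 1" "h 0 = 0"
    "\<And>i::int. h (of_int i) = of_int i"
  shows "det (map_matrix h A) = (h (det (A :: 'a::comm_ring_1^'n^'n)) :: 'b::comm_ring_1)"
proof -
  have s: "h (sum f I) = (\<Sum>i\<in>I. h (f i))" for f :: "('n \<Rightarrow> 'n) \<Rightarrow> 'a" and I
    by (induction I rule: infinite_finite_induct) (simp_all add: assms)
  have p: "h (prod f I) = (\<Prod>i\<in>I. h (f i))" for f :: "'n \<Rightarrow> 'a" and I
    by (induction I rule: infinite_finite_induct) (simp_all add: assms)
  show ?thesis unfolding det_def by (simp add: s p assms)
qed

lemma det_cmat: "det (cmat B) = of_int (det B)"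
  by (rule det_hom) auto

text \<open>This is det (A - X) rather than the monic det (X - A); the sign disappears since only
  moduli are used.\<close>

definition charpoly :: "complex^'n^'n \<Rightarrow> complex poly" where
  "charpoly A = det (\<chi> i j. [:A $ i $ j, if i = j then -1 else 0:])"

lemma poly_charpoly:
  fixes A :: "complex^'n^'n"
  shows "poly (charpoly A) z = det (A - mat z)"
proof -
  let ?M = "(\<chi> i j. [:A $ i $ j, if i = j then -1 else 0:]) :: complex poly^'n^'n"
  have "det (map_matrix (\<lambda>p. poly p z) ?M) = poly (det ?M) z"
    by (rule det_hom) auto
  moreover have "map_matrix (\<lambda>p. poly p z) ?M = A - mat z"
    by (simp add: vec_eq_iff mat_def)
  ultimately show ?thesis unfolding charpoly_def by simp
qed

text \<open>The coefficient is read off at \<open>card I\<close> even if the degree is smaller, so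
  that all permutations in the Leibniz formula are treated alike.\<close>

lemma degree_coeff_prod_linear:
  fixes f :: "'i \<Rightarrow> 'a::comm_ring_1 poly"
  assumes "finite I" "\<And>i. i \<in> I \<Longrightarrow> degree (f i) \<le> 1"
  shows "degree (\<Prod>i\<in>I. f i) \<le> card I \<and> coeff (\<Prod>i\<in>I. f i) (card I) = (\<Prod>i\<in>I. coeff (f i) 1)"
  using assms
proof (induction I)
  case (insert i I)
  let ?P = "\<Prod>i\<in>I. f i"
  have IH: "degree ?P \<le> card I" "coeff ?P (card I) = (\<Prod>i\<in>I. coeff (f i) 1)"
    using insert by auto
  have fi: "degree (f i) \<le> 1" using insert.prems by simp
  have deg: "degree (f i * ?P) \<le> Suc (card I)"
    using degree_mult_le[of "f i" ?P] IH(1) fi by linarith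
  have "f i = [:coeff (f i) 0, coeff (f i) 1:]"
    using fi by (intro poly_eqI) (auto simp: coeff_pCons coeff_eq_0 split: nat.split)
  then have "f i * ?P = smult (coeff (f i) 0) ?P + pCons 0 (smult (coeff (f i) 1) ?P)"
    by (metis add_0_right mult_pCons_left mult_zero_left pCons_0_0)
  then have "coeff (f i * ?P) (Suc (card I)) = coeff (f i) 0 * coeff ?P (Suc (card I)) + coeff (f i) 1 * coeff ?P (card I)"
    by simp
  also have "coeff ?P (Suc (card I)) = 0" using IH(1) by (intro coeff_eq_0) auto
  finally show ?case using insert.hyps IH deg by simp
qed auto

lemma degree_charpoly: "degree (charpoly (A :: complex^'n^'n)) = CARD('n)"
  and cmod_lead_coeff_charpoly: "cmod (lead_coeff (charpoly A)) = 1"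
proof -
  let ?M = "(\<chi> i j. [:A $ i $ j, if i = j then -1 else 0:]) :: complex poly^'n^'n"
  have d: "degree (?M $ i $ j) \<le> 1" for i j by simp
  have P: "degree (\<Prod>i\<in>UNIV. ?M $ i $ p i) \<le> CARD('n)"
    "coeff (\<Prod>i\<in>UNIV. ?M $ i $ p i) (CARD('n)) = (\<Prod>i\<in>UNIV. coeff (?M $ i $ p i) 1)" for p
    using degree_coeff_prod_linear[of UNIV "\<lambda>i. ?M $ i $ p i"] d by auto
  have sgn: "(of_int (sign p) :: complex poly) = [:of_int (sign p):]" for p :: "'n \<Rightarrow> 'n"
    by (simp add: of_int_poly)
  have le: "degree (charpoly A) \<le> CARD('n)"
    unfolding charpoly_def det_def
  proof (rule degree_sum_le)
    fix p assume "p \<in> {p. p permutes (UNIV::'n set)}"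
    show "degree (of_int (sign p) * (\<Prod>i\<in>UNIV. ?M $ i $ p i)) \<le> CARD('n)"
      unfolding sgn using P(1)[of p] by (simp add: degree_smult_le order_trans)
  qed auto
  have "coeff (charpoly A) (CARD('n)) =
      (\<Sum>p\<in>{p. p permutes UNIV}. of_int (sign p) * (\<Prod>i\<in>UNIV. coeff (?M $ i $ p i) 1))"
    unfolding charpoly_def det_def coeff_sum sgn using P(2) by simp
  also have "\<dots> = det (mat (-1) :: complex^'n^'n)"
    unfolding det_def by (intro sum.cong refl arg_cong2[where f = "(*)"] prod.cong) (auto simp: mat_def)
  also have "\<dots> = (\<Prod>i\<in>(UNIV::'n set). -1)"
    by (subst det_diagonal) (auto simp: mat_def)
  finally have c: "coeff (charpoly A) (CARD('n)) = (-1) ^ CARD('n)" by simp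
  then have "coeff (charpoly A) (CARD('n)) \<noteq> 0" by simp
  then show deg: "degree (charpoly A) = CARD('n)"
    using le le_degree by (metis le_antisym)
  show "cmod (lead_coeff (charpoly A)) = 1" unfolding deg c by (simp add: norm_power)
qed

lemma cmod_poly_roots:
  "cmod (poly p z) = cmod (lead_coeff p) * (\<Prod>l\<in>#proots p. cmod (z - l))"
proof -
  have m: "cmod (poly (\<Prod>l\<in>#L. [:-l, 1:]) z) = (\<Prod>l\<in>#L. cmod (z - l))" for L
  proof (induction L)
    case (add l L)
    have "poly (\<Prod>l\<in>#add_mset l L. [:-l, 1:]) z = (z - l) * poly (\<Prod>l\<in>#L. [:-l, 1:]) z"
      by (simp add: algebra_simps)
    then show ?case using add by (simp add: norm_mult del: poly_prod_mset)
  qed simp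
  have "poly p z = lead_coeff p * poly (\<Prod>l\<in>#proots p. [:-l, 1:]) z"
    by (subst (1) complex_poly_decompose_multiset[symmetric]) simp
  then show ?thesis by (simp add: norm_mult m)
qed

lemma det_mpoly_prod: "det (mpoly (\<Prod>l\<in>#L. [:-l, 1:]) A) = (\<Prod>l\<in>#L. poly (charpoly A) l)"
proof (induction L)
  case (add l L)
  have "mpoly (\<Prod>l\<in>#add_mset l L. [:-l, 1:]) A = (A - mat l) ** mpoly (\<Prod>l\<in>#L. [:-l, 1:]) A"
    by (simp only: image_mset_add_mset prod_mset.add_mset mpoly_mult mpoly_linear)
  then show ?case using add by (simp add: det_mul poly_charpoly)
qed simp

text \<open>Both sides equal the product of |l - m| over the roots l of p and m of the
  characteristic polynomial, the modulus of their resultant. Exchanging the two products takes the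
  place of triangularising A.\<close>

lemma cmod_det_mpoly:
  fixes A :: "complex^'n^'n"
  assumes "lead_coeff p = 1"
  shows "cmod (det (mpoly p A)) = (\<Prod>m\<in>#proots (charpoly A). cmod (poly p m))"
proof -
  let ?R = "proots (charpoly A)"
  have p: "p = (\<Prod>l\<in>#proots p. [:-l, 1:])"
    using complex_poly_decompose_multiset[of p] assms by simp
  have c: "cmod (prod_mset (image_mset f L)) = (\<Prod>l\<in>#L. cmod (f l))" for f :: "complex \<Rightarrow> complex" and L
    by (induction L) (simp_all add: norm_mult)
  have "cmod (det (mpoly p A)) = (\<Prod>l\<in>#proots p. cmod (poly (charpoly A) l))"
    by (subst p) (simp only: det_mpoly_prod c)
  also have "\<dots> = (\<Prod>l\<in>#proots p. \<Prod>m\<in>#?R. cmod (l - m))"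
    by (simp add: cmod_poly_roots[of "charpoly A"] cmod_lead_coeff_charpoly)
  also have "\<dots> = (\<Prod>m\<in>#?R. \<Prod>l\<in>#proots p. cmod (l - m))"
    by (rule prod_mset.swap)
  also have "\<dots> = (\<Prod>m\<in>#?R. cmod (poly p m))"
    by (simp add: cmod_poly_roots[of p] assms norm_minus_commute)
  finally show ?thesis .
qed

text \<open>Dirichlet's simultaneous approximation applied to the arguments, measured in full
  turns.\<close>

lemma simultaneous_return:
  fixes U :: "complex set"
  assumes "finite U" "\<And>u. u \<in> U \<Longrightarrow> cmod u = 1"
  obtains n :: nat where "n > 0" "\<And>u. u \<in> U \<Longrightarrow> cmod (u ^ n - 1) < 1"
proof -
  obtain f where f: "U = f ` {..<card U}"
    using ex_bij_betw_nat_finite[OF assms(1)] by (metis atLeast0LessThan bij_betw_imp_surj_on)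
  define \<theta> where "\<theta> i = Arg (f i) / (2 * pi)" for i
  \<comment> \<open>Seven is enough because 2 pi / 7 < 1.\<close>
  obtain q p where q: "0 < q" and p: "\<And>i. i < card U \<Longrightarrow> \<bar>of_int q * \<theta> i - of_int (p i)\<bar> < 1 / real 7"
    by (rule Dirichlet_approx_simult[of 7 "card U" \<theta>]) auto
  show ?thesis
  proof (rule that[of "nat q"])
    fix u assume "u \<in> U"
    then obtain i where i: "i < card U" "u = f i" using f by blast
    let ?x = "real_of_int q * \<theta> i - of_int (p i)"
    have "u = cis (2 * pi * \<theta> i)"
      using assms(2)[OF \<open>u \<in> U\<close>] i cis_Arg[of u] unfolding \<theta>_def
      by (cases "u = 0") (auto simp: sgn_eq)
    then have "u ^ nat q = cis (real (nat q) * (2 * pi * \<theta> i))" by (simp only: Complex.DeMoivre)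
    also have "real (nat q) * (2 * pi * \<theta> i) = 2 * pi * ?x + 2 * pi * of_int (p i)"
      using q by (simp add: algebra_simps)
    also have "cis \<dots> = cis (2 * pi * ?x)"
      by (simp add: cis_mult[symmetric] cis_multiple_2pi)
    finally have "cmod (u ^ nat q - 1) = 2 * \<bar>sin (2 * pi * ?x / 2)\<bar>"
      using dist_exp_i_1[of "2 * pi * ?x"] by (simp add: cis_conv_exp)
    also have "\<dots> \<le> 2 * \<bar>2 * pi * ?x / 2\<bar>"
      using abs_sin_x_le_abs_x by (intro mult_left_mono) auto
    also have "\<dots> = 2 * pi * \<bar>?x\<bar>" by (simp add: abs_mult)
    also have "\<dots> < 2 * pi * (1 / 7)" using p[OF i(1)] by (intro mult_strict_left_mono) auto
    also have "\<dots> < 1" using pi_less_4 pi_approx by simp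
    finally show "cmod (u ^ nat q - 1) < 1" .
  qed (use q in auto)
qed

text \<open>If all eigenvalues of \<open>T\<close> lay in the closed unit disc, they would have modulus one since
  \<open>\<bar>det T\<bar> = 1\<close>; for a simultaneous return time \<open>n\<close> of the eigenvalues to \<open>1\<close> the integer
  \<open>det (T\<^sup>n - 1)\<close> then has absolute value less than one and hence vanishes.\<close>

lemma no_slow_annihilator:
  fixes T :: "int^'n^'n"
  assumes T: "toral_automorphism T" "quasihyperbolic T"
    and L: "\<forall>l\<in>#L. cmod l \<le> 1" "mpoly (\<Prod>l\<in>#L. [:-l, 1:]) (cmat T) = 0"
  shows False
proof -
  let ?A = "cmat T" and ?R = "proots (charpoly (cmat T))"
  have nz: "charpoly ?A \<noteq> 0" using cmod_lead_coeff_charpoly[of ?A] by auto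
  \<comment> \<open>An eigenvalue is a root of every annihilating polynomial, hence a member of
    L.\<close>
  have le1: "cmod m \<le> 1" if "m \<in># ?R" for m
  proof -
    have "det (?A - mat m) = 0" using that nz by (simp add: poly_charpoly[symmetric])
    then obtain v where v: "v \<noteq> 0" "(?A - mat m) *v v = 0" by (rule det_zero_kernel)
    then have "?A *v v = m *s v" by (simp add: matrix_vector_mult_diff_rdistrib mat_mult_vector)
    then have "poly (\<Prod>l\<in>#L. [:-l, 1:]) m *s v = 0"
      using mpoly_eigenvector L(2) by (metis matrix_vector_mult_0)
    then have "poly (\<Prod>l\<in>#L. [:-l, 1:]) m = 0" using v by simp
    then have "m \<in># L" by (induction L) auto
    then show ?thesis using L(1) by blast
  qed
  have "1 = cmod (det ?A)" using T(1) unfolding det_cmat toral_automorphism_def by auto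
  also have "\<dots> = cmod (poly (charpoly ?A) 0)" by (simp add: poly_charpoly)
  also have "\<dots> = (\<Prod>m\<in>#?R. cmod m)"
    by (simp add: cmod_poly_roots cmod_lead_coeff_charpoly)
  finally have prod1: "(\<Prod>m\<in>#?R. cmod m) = 1" by simp
  \<comment> \<open>Stated with a product of at least one, since that hypothesis is inherited when a
    factor of modulus at most one is removed.\<close>
  have pr: "(\<forall>m\<in>#M. cmod m = 1) \<and> prod_mset (image_mset cmod M) = 1"
    if "\<forall>m\<in>#M. cmod m \<le> 1" "prod_mset (image_mset cmod M) \<ge> 1" for M
    using that
  proof (induction M)
    case (add m M)
    let ?p = "prod_mset (image_mset cmod M)"
    have p0: "?p \<ge> 0" by (induction M) auto
    have m: "cmod m \<le> 1" "1 \<le> cmod m * ?p" using add.prems by auto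
    have "cmod m * ?p \<le> 1 * ?p" using m(1) p0 by (intro mult_right_mono)
    then have "1 \<le> ?p" using m by simp
    then have IH: "(\<forall>m\<in>#M. cmod m = 1)" "?p = 1" using add by auto
    then show ?case using m by auto
  qed auto
  have one: "cmod m = 1" if "m \<in># ?R" for m
    using pr[of ?R] le1 prod1 that by auto
  obtain n where n: "n > 0" "\<And>u. u \<in> set_mset ?R \<Longrightarrow> cmod (u ^ n - 1) < 1"
    using simultaneous_return[of "set_mset ?R"] one by auto
  let ?p = "monom 1 n - 1 :: complex poly"
  have lead: "lead_coeff ?p = 1"
  proof -
    have "degree ?p = n" using n(1) degree_add_eq_left[of "-1" "monom (1::complex) n"] by (simp add: degree_monom_eq)
    then show ?thesis using n(1) by simp
  qed
  have "cmod (det (mpoly ?p ?A)) = (\<Prod>m\<in>#?R. cmod (m ^ n - 1))"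
    using cmod_det_mpoly[OF lead, of ?A] by (simp add: poly_monom)
  also have "\<dots> < 1"
  proof -
    have *: "M \<noteq> {#} \<Longrightarrow> \<forall>m\<in>#M. cmod (m ^ n - 1) < 1 \<Longrightarrow> (\<Prod>m\<in>#M. cmod (m ^ n - 1)) < 1" for M :: "complex multiset"
    proof (induction M)
      case (add m M)
      let ?q = "\<Prod>m\<in>#M. cmod (m ^ n - 1)"
      have q0: "?q \<ge> 0" by (induction M) auto
      have "?q \<le> 1" using add by (cases "M = {#}") auto
      then have "cmod (m ^ n - 1) * ?q \<le> cmod (m ^ n - 1) * 1" by (intro mult_left_mono) auto
      also have "\<dots> < 1" using add.prems by simp
      finally show ?case by simp
    qed auto
    \<comment> \<open>The strict bound on the product requires at least one factor.\<close>
    have "size ?R = CARD('n)" by (simp add: size_proots_complex degree_charpoly)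
    then have "?R \<noteq> {#}" by auto
    then show ?thesis using n(2) by (intro *) auto
  qed
  finally have lt: "cmod (det (mpoly ?p ?A)) < 1" .
  have mono: "mpoly (monom 1 k) ?A = cmat (mpoly (monom 1 k) T)" for k
  proof (induction k)
    case 0
    then show ?case by (simp add: monom_0 vec_eq_iff mat_def)
  next
    case (Suc k)
    then show ?case by (simp add: monom_Suc vec_eq_iff matrix_matrix_mult_def)
  qed
  have pA: "mpoly ?p ?A = cmat (mpoly (monom 1 n) T - mat 1)"
  proof -
    have "mpoly (monom 1 n) ?A = mpoly ?p ?A + mat 1"
      using mpoly_add[of ?p 1 ?A] by simp
    then have "mpoly ?p ?A = mpoly (monom 1 n) ?A - mat 1" by simp
    then show ?thesis unfolding mono by (simp add: vec_eq_iff mat_def)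
  qed
  have "\<bar>real_of_int (det (mpoly (monom 1 n) T - mat 1))\<bar> < 1"
    using lt unfolding pA det_cmat norm_of_int .
  then have "det (mpoly (monom 1 n) T - mat 1) = 0" by linarith
  then have "det (mpoly ?p ?A) = 0"
    unfolding pA det_cmat by simp
  then obtain v where "v \<noteq> 0" "mpoly ?p ?A *v v = 0" by (rule det_zero_kernel)
  then show False
    using quasihyperbolic_no_periodic[OF T(2) n(1), of v] by (simp add: mpoly_monom_minus_1)
qed

text \<open>B consists of the real vectors killed by the product of the slow factors. Were it
  everything, real and imaginary parts would show that this product annihilates T, against
  \<open>no_slow_annihilator\<close>.\<close>

lemma geometric_growth_outside_subspace:
  fixes T :: "int^'n^'n"
  assumes T: "toral_automorphism T" "quasihyperbolic T"
  obtains B where "subspace B" "B \<noteq> UNIV" "\<forall>w. w \<notin> B \<longrightarrow> geometric_growth (orbit (rmat T) w)"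
proof -
  obtain L where L: "\<forall>l\<in>#L. cmod l \<le> 1"
    and G: "\<forall>x. mpoly (\<Prod>l\<in>#L. [:-l, 1:]) (cmat T) *v x \<noteq> 0 \<longrightarrow> geometric_growth (orbit (cmat T) x)"
    by (rule geometric_growth_outside_slow_space)
  define M where "M = mpoly (\<Prod>l\<in>#L. [:-l, 1:]) (cmat T)"
  define B where "B = {w. M *v cvec w = 0}"
  have lin: "linear (\<lambda>x. M *v x)" by (rule matrix_vector_mul_linear)
  have "subspace B"
    unfolding B_def using linear_cmul[OF lin]
    by (intro subspaceI) (simp_all add: cvec_add cvec_scaleR matrix_vector_right_distrib)
  moreover have "B \<noteq> UNIV"
  proof
    assume B: "B = UNIV"
    have "M *v x = 0" for x
    proof -
      have x: "x = cvec (\<chi> i. Re (x $ i)) + \<i> *s cvec (\<chi> i. Im (x $ i))"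
        by (simp add: cvec_def vec_eq_iff complex_eq)
      have "M *v cvec w = 0" for w using B unfolding B_def by blast
      then show ?thesis
        by (subst x) (simp add: matrix_vector_right_distrib vec_scale_matrix)
    qed
    then have "M = 0" by (simp add: matrix_eq)
    then show False using no_slow_annihilator[OF T L] unfolding M_def by blast
  qed
  moreover have "geometric_growth (orbit (rmat T) w)" if "w \<notin> B" for w
  proof -
    have "geometric_growth (orbit (cmat T) (cvec w))"
      using that G unfolding B_def M_def by blast
    then obtain r C where r: "0 < r" "r < 1" "C > 0" and nz: "\<forall>n. orbit (cmat T) (cvec w) n \<noteq> 0"
      and C: "\<forall>i n. i \<le> n \<longrightarrow> norm (orbit (cmat T) (cvec w) i) \<le> C * r ^ (n - i) * norm (orbit (cmat T) (cvec w) n)"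
      by (rule geometric_growthE)
    show ?thesis
      using r nz C unfolding cvec_orbit norm_cvec cvec_eq_0 by (intro geometric_growthI[of _ r C]) blast+
  qed
  ultimately show ?thesis using that by blast
qed

section \<open>Vectors with bounded orbit\<close>

definition bounded_orbits :: "int^'n^'n \<Rightarrow> (real^'n) set" where
  "bounded_orbits A = {x. bounded (range (orbit (rmat A) x))}"

lemma bounded_range_add:
  fixes f g :: "nat \<Rightarrow> 'a::real_normed_vector"
  assumes "bounded (range f)" "bounded (range g)"
  shows "bounded (range (\<lambda>n. f n + g n))"
proof -
  obtain a b where "\<forall>n. norm (f n) \<le> a" "\<forall>n. norm (g n) \<le> b"
    using assms unfolding bounded_iff by auto
  then have "norm (f n + g n) \<le> a + b" for n
    using norm_triangle_ineq[of "f n" "g n"] by (smt (verit))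
  then show ?thesis unfolding bounded_iff by auto
qed

lemma orbit_scaleR: "orbit (A :: real^'n^'n) (c *\<^sub>R x) n = c *\<^sub>R orbit A x n"
  by (induction n) (simp_all add: matrix_vector_mult_scaleR)

lemma subspace_bounded_orbits: "subspace (bounded_orbits A)"
proof (rule subspaceI)
  show "0 \<in> bounded_orbits A" unfolding bounded_orbits_def by simp
next
  fix x y assume "x \<in> bounded_orbits A" "y \<in> bounded_orbits A"
  then show "x + y \<in> bounded_orbits A"
    unfolding bounded_orbits_def mem_Collect_eq orbit_add[abs_def] by (rule bounded_range_add)
next
  fix c x assume "x \<in> bounded_orbits A"
  then have "bounded ((\<lambda>y. c *\<^sub>R y) ` range (orbit (rmat A) x))"
    unfolding bounded_orbits_def by (auto intro: bounded_scaling)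
  then show "c *\<^sub>R x \<in> bounded_orbits A"
    unfolding bounded_orbits_def mem_Collect_eq orbit_scaleR[abs_def] by (simp add: image_image)
qed

lemma bounded_orbits_complex:
  assumes "\<And>v. v \<in> V \<Longrightarrow> bounded (range (orbit (cmat A) v))"
  shows "real_part_of (vec.span V) \<subseteq> bounded_orbits A"
proof -
  let ?B = "{v. bounded (range (orbit (cmat A) v))}"
  have "vec.subspace ?B"
  proof (rule vec.subspaceI)
    fix x y assume "x \<in> ?B" "y \<in> ?B"
    then show "x + y \<in> ?B"
      unfolding mem_Collect_eq orbit_add[abs_def] by (rule bounded_range_add)
  next
    fix c x assume "x \<in> ?B"
    then obtain b where "\<forall>n. norm (orbit (cmat A) x n) \<le> b" unfolding bounded_iff by auto
    then have "\<forall>n. norm (orbit (cmat A) (c *s x) n) \<le> cmod c * b"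
      unfolding orbit_scale norm_vector_scalar by (auto intro: mult_left_mono)
    then show "c *s x \<in> ?B" unfolding bounded_iff by auto
  qed simp
  then have span: "vec.span V \<subseteq> ?B" using assms by (intro vec.span_minimal) auto
  show ?thesis
  proof
    fix x assume "x \<in> real_part_of (vec.span V)"
    then have "cvec x \<in> vec.span V" unfolding real_part_of_def cvec_def by simp
    then have "bounded (range (orbit (cmat A) (cvec x)))" using span by blast
    then show "x \<in> bounded_orbits A"
      unfolding bounded_orbits_def bounded_iff by (simp add: cvec_orbit)
  qed
qed

text \<open>Boundedness passes from (A - \<mu>) v to v since |\<mu>| < 1, so the factors of the
  iterate are undone one by one.\<close>

lemma contracted_space_bounded: "contracted_space A \<subseteq> bounded_orbits A"
  unfolding contracted_space_def
proof (rule bounded_orbits_complex)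
  fix v assume "v \<in> (\<Union>\<mu>\<in>{\<mu>. cmod \<mu> < 1}. gen_eigenspace A \<mu>)"
  then obtain \<mu> where \<mu>: "cmod \<mu> < 1" "(((*v) (cmat A - mat \<mu>)) ^^ CARD('a)) v = 0"
    unfolding gen_eigenspace_def by blast
  have "bounded (range (orbit (cmat A) v))" if "(((*v) (cmat A - mat \<mu>)) ^^ m) v = 0" for m v
    using that
  proof (induction m arbitrary: v)
    case (Suc m)
    then have "bounded (range (orbit (cmat A) ((cmat A - mat \<mu>) *v v)))"
      by (simp only: funpow_Suc_right o_apply)
    then show ?case by (rule bounded_orbit_shift[OF \<mu>(1)])
  qed simp
  then show "bounded (range (orbit (cmat A) v))" using \<mu>(2) by blast
qed

text \<open>On a genuine eigenvector A^n is multiplication by \<mu>^n, of modulus one; on a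
  nontrivial Jordan block orbits would grow polynomially.\<close>

lemma neutral_eigenspace_bounded: "neutral_eigenspace A \<subseteq> bounded_orbits A"
  unfolding neutral_eigenspace_def
proof (rule bounded_orbits_complex)
  fix v assume "v \<in> (\<Union>\<mu>\<in>{\<mu>. cmod \<mu> = 1}. eigenspace A \<mu>)"
  then obtain \<mu> where \<mu>: "cmod \<mu> = 1" "(cmat A - mat \<mu>) *v v = 0"
    unfolding eigenspace_def by blast
  then have Av: "cmat A *v v = \<mu> *s v" by (simp add: matrix_vector_mult_diff_rdistrib mat_mult_vector)
  have "norm (orbit (cmat A) v n) = norm v" for n
  proof -
    have "orbit (cmat A) v n = \<mu> ^ n *s v"
      by (induction n) (simp_all add: vec_scale_matrix Av mult.commute)
    then show ?thesis by (simp add: norm_vector_scalar norm_power \<mu>(1))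
  qed
  then show "bounded (range (orbit (cmat A) v))" unfolding bounded_iff by auto
qed

section \<open>Unbounded orbits and a common growth direction\<close>

lemma geometric_growth_power_lower:
  assumes "geometric_growth a"
  obtains r c where "0 < r" "r < 1" "c > 0" "\<forall>n. c \<le> r ^ n * norm (a n)"
proof -
  obtain r C where r: "0 < r" "r < 1" "C > 0" and nz: "\<forall>n. a n \<noteq> 0"
    and C: "\<forall>i n. i \<le> n \<longrightarrow> norm (a i) \<le> C * r ^ (n - i) * norm (a n)"
    by (rule geometric_growthE[OF assms])
  have "norm (a 0) / C \<le> r ^ n * norm (a n)" for n
    using spec[OF spec[OF C, of 0], of n] r by (simp add: field_simps)
  then show ?thesis using r nz by (intro that[of r "norm (a 0) / C"]) auto
qed

lemma geometric_growth_at_top: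
  assumes "geometric_growth a"
  shows "filterlim (\<lambda>n. norm (a n)) at_top sequentially"
proof -
  obtain r c where r: "0 < r" "r < 1" "c > 0" and c: "\<forall>n. c \<le> r ^ n * norm (a n)"
    by (rule geometric_growth_power_lower[OF assms])
  have "eventually (\<lambda>n. Z \<le> norm (a n)) sequentially" for Z
  proof -
    obtain N where "Z / c < (1 / r) ^ N" using real_arch_pow[of "1 / r"] r by auto
    then have N: "Z < c * (1 / r) ^ N" using r(3) by (simp add: pos_divide_less_eq mult.commute)
    have "Z \<le> norm (a n)" if "n \<ge> N" for n
    proof -
      have "c * (1 / r) ^ N \<le> c * (1 / r) ^ n"
        using r that by (intro mult_left_mono power_increasing) auto
      also have "\<dots> \<le> norm (a n)"
        using spec[OF c, of n] r by (simp add: power_divide field_simps)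
      finally show ?thesis using N by linarith
    qed
    then show ?thesis unfolding eventually_sequentially by blast
  qed
  then show ?thesis unfolding filterlim_at_top by blast
qed

lemma geometric_growth_unbounded:
  assumes "geometric_growth a"
  shows "\<not> bounded (range a)"
proof
  assume "bounded (range a)"
  then obtain B where B: "\<forall>n. norm (a n) \<le> B" unfolding bounded_iff by auto
  have "eventually (\<lambda>n. norm (a n) > B) sequentially"
    using geometric_growth_at_top[OF assms] by (simp add: filterlim_at_top_dense)
  then obtain n where "norm (a n) > B" by (meson eventually_sequentially order_refl)
  then show False using B by (meson not_less)
qed

text \<open>Within the closed set W each B k has a relatively open complement, and a dense one:
  adding a small multiple of a vector of W outside B k leaves B k. Baire's theorem does the
  rest.\<close>

lemma subspace_not_covered_countable:
  fixes W :: "'a::euclidean_space set"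
  assumes W: "subspace W" and K: "countable K"
    and B: "\<And>k. k \<in> K \<Longrightarrow> subspace (B k)" "\<And>k. k \<in> K \<Longrightarrow> \<not> W \<subseteq> B k"
  obtains w where "w \<in> W" "\<forall>k\<in>K. w \<notin> B k"
proof -
  have "W \<subseteq> closure (\<Inter>((\<lambda>k. W - B k) ` K))"
  proof (rule Baire)
    show "closed W" using W by (rule closed_subspace)
    show "countable ((\<lambda>k. W - B k) ` K)" using K by simp
    fix U assume "U \<in> (\<lambda>k. W - B k) ` K"
    then obtain k where k: "k \<in> K" "U = W - B k" by blast
    have "closed (B k)" using B(1)[OF k(1)] by (rule closed_subspace)
    then have "openin (top_of_set W) (W \<inter> - B k)" by (intro openin_open_Int) auto
    moreover have "W \<subseteq> closure (W - B k)"
    proof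
      fix x assume x: "x \<in> W"
      obtain v where v: "v \<in> W" "v \<notin> B k" using B(2)[OF k(1)] by blast
      show "x \<in> closure (W - B k)"
      proof (cases "x \<in> B k")
        case True
        have "x + (1 / real (Suc n)) *\<^sub>R v \<in> W - B k" for n
        proof
          show "x + (1 / real (Suc n)) *\<^sub>R v \<in> W"
            using x v W by (intro subspace_add subspace_scale)
          show "x + (1 / real (Suc n)) *\<^sub>R v \<notin> B k"
          proof
            assume "x + (1 / real (Suc n)) *\<^sub>R v \<in> B k"
            then have "(x + (1 / real (Suc n)) *\<^sub>R v) - x \<in> B k"
              using True B(1)[OF k(1)] by (intro subspace_diff)
            then have "(1 / real (Suc n)) *\<^sub>R v \<in> B k" by (simp only: add_diff_cancel_left')
            then have "real (Suc n) *\<^sub>R ((1 / real (Suc n)) *\<^sub>R v) \<in> B k"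
              by (rule subspace_scale[OF B(1)[OF k(1)]])
            moreover have "real (Suc n) *\<^sub>R ((1 / real (Suc n)) *\<^sub>R v) = v"
              unfolding scaleR_scaleR by (simp del: of_nat_Suc)
            ultimately show False using v by (simp only:)
          qed
        qed
        moreover have "(\<lambda>n. x + (1 / real (Suc n)) *\<^sub>R v) \<longlonglongrightarrow> x + 0 *\<^sub>R v"
          using LIMSEQ_inverse_real_of_nat by (intro tendsto_intros) (simp add: divide_inverse)
        ultimately show ?thesis unfolding closure_sequential scaleR_zero_left add_0_right
          by (intro exI[of _ "\<lambda>n. x + (1 / real (Suc n)) *\<^sub>R v"]) blast
      next
        case False
        then show ?thesis using x closure_subset[of "W - B k"] by blast
      qed
    qed
    ultimately show "openin (top_of_set W) U \<and> W \<subseteq> closure U" unfolding k(2) Diff_eq by blast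
  qed
  moreover have "0 \<in> W" using W by (rule subspace_0)
  ultimately have ne: "\<Inter>((\<lambda>k. W - B k) ` K) \<noteq> {}" by (metis closure_empty empty_iff subsetD)
  show ?thesis
  proof (cases "K = {}")
    case True
    then show ?thesis using that \<open>0 \<in> W\<close> by blast
  next
    case False
    then show ?thesis using ne that by blast
  qed
qed

lemma exists_common_growth_direction:
  fixes S :: "int^'n^'n" and T :: "'k \<Rightarrow> int^'n^'n"
  assumes "countable K"
    and T: "\<And>k. k \<in> K \<Longrightarrow> toral_automorphism (T k)" "\<And>k. k \<in> K \<Longrightarrow> quasihyperbolic (T k)"
    and span: "\<And>k. k \<in> K \<Longrightarrow> (contracted_space S + neutral_eigenspace S)
             + (contracted_space (T k) + neutral_eigenspace (T k)) = UNIV"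
  obtains w where "w \<in> bounded_orbits S" "\<forall>k\<in>K. geometric_growth (orbit (rmat (T k)) w)"
proof -
  have "\<forall>k\<in>K. \<exists>B. subspace B \<and> B \<noteq> UNIV \<and> (\<forall>w. w \<notin> B \<longrightarrow> geometric_growth (orbit (rmat (T k)) w))"
    using geometric_growth_outside_subspace[OF T] by blast
  from bchoice[OF this] obtain B where *: "\<forall>k\<in>K. subspace (B k) \<and> B k \<noteq> UNIV \<and>
      (\<forall>w. w \<notin> B k \<longrightarrow> geometric_growth (orbit (rmat (T k)) w))" by blast
  have B: "subspace (B k)" "B k \<noteq> UNIV" if "k \<in> K" for k using * that by blast+
  have G: "geometric_growth (orbit (rmat (T k)) w)" if "k \<in> K" "w \<notin> B k" for k w using * that by blast
  have nsub: "\<not> bounded_orbits S \<subseteq> B k" if k: "k \<in> K" for k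
  proof
    assume sub: "bounded_orbits S \<subseteq> B k"
    have sub': "bounded_orbits (T k) \<subseteq> B k"
    proof
      fix x assume "x \<in> bounded_orbits (T k)"
      then have "\<not> geometric_growth (orbit (rmat (T k)) x)"
        unfolding bounded_orbits_def using geometric_growth_unbounded by blast
      then show "x \<in> B k" using G[OF k] by blast
    qed
    have "x \<in> B k" for x
    proof -
      have "x \<in> (contracted_space S + neutral_eigenspace S)
             + (contracted_space (T k) + neutral_eigenspace (T k))" using span[OF k] by simp
      then obtain a b c d where "x = (a + b) + (c + d)" and
        "a \<in> contracted_space S" "b \<in> neutral_eigenspace S"
        "c \<in> contracted_space (T k)" "d \<in> neutral_eigenspace (T k)"
        by (elim set_plus_elim) blast
      then have "a \<in> B k" "b \<in> B k" "c \<in> B k" "d \<in> B k"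
        using contracted_space_bounded[of S] neutral_eigenspace_bounded[of S]
          contracted_space_bounded[of "T k"] neutral_eigenspace_bounded[of "T k"] sub sub' by blast+
      then show ?thesis
        unfolding \<open>x = (a + b) + (c + d)\<close> using B(1)[OF k] by (intro subspace_add)
    qed
    then show False using B(2)[OF k] by blast
  qed
  obtain w where w: "w \<in> bounded_orbits S" "\<forall>k\<in>K. w \<notin> B k"
    by (rule subspace_not_covered_countable[OF subspace_bounded_orbits assms(1) B(1) nsub])
  have "\<forall>k\<in>K. geometric_growth (orbit (rmat (T k)) w)"
    using w(2) by (intro ballI G) auto
  then show ?thesis by (rule that[OF w(1)])
qed

text \<open>Uniform boundedness in finite dimension: p is a linear projection onto the space of
  bounded orbits, and the orbits of the finitely many images p b control all others.\<close>

lemma power_bound: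
  fixes S :: "int^'n^'n"
  obtains C where "C > 0" "\<forall>v\<in>bounded_orbits S. \<forall>n. norm (orbit (rmat S) v n) \<le> C * norm v"
proof -
  let ?W = "bounded_orbits S"
  obtain p where p: "p ` UNIV \<subseteq> ?W" "linear p" "\<forall>v\<in>?W. p v = v"
    using linear_exists_left_inverse_on[of id ?W] subspace_bounded_orbits linear_id
    by (auto simp: module_hom_id)
  have "\<exists>M. \<forall>n. norm (orbit (rmat S) (p b) n) \<le> M" for b
  proof -
    have "p b \<in> ?W" using p(1) by blast
    then show ?thesis unfolding bounded_orbits_def bounded_iff by auto
  qed
  then obtain M where "\<forall>b n. norm (orbit (rmat S) (p b) n) \<le> M b" by metis
  then have M: "norm (orbit (rmat S) (p b) n) \<le> M b" for b n by blast
  define C where "C = (\<Sum>b\<in>Basis. M b) + 1"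
  have M0: "M b \<ge> 0" for b by (rule order_trans[OF norm_ge_zero M[of 0 b]])
  have "norm (orbit (rmat S) v n) \<le> C * norm v" if "v \<in> ?W" for v n
  proof -
    have lin: "linear (\<lambda>x. orbit (rmat S) (p x) n)"
      using p(2) by (intro linearI) (simp_all add: linear_add linear_cmul orbit_add orbit_scaleR)
    have "orbit (rmat S) v n = orbit (rmat S) (p (\<Sum>b\<in>Basis. (v \<bullet> b) *\<^sub>R b)) n"
      using p(3) that by (simp add: euclidean_representation)
    also have "\<dots> = (\<Sum>b\<in>Basis. (v \<bullet> b) *\<^sub>R orbit (rmat S) (p b) n)"
      by (simp only: linear_sum[OF lin] linear_cmul[OF lin])
    also have "norm \<dots> \<le> (\<Sum>b\<in>Basis. norm v * M b)"
    proof (rule sum_norm_le)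
      fix b :: "real^'n" assume "b \<in> Basis"
      then show "norm ((v \<bullet> b) *\<^sub>R orbit (rmat S) (p b) n) \<le> norm v * M b"
        using Basis_le_norm[of b v] M[of n b] by (auto intro: mult_mono)
    qed
    also have "\<dots> \<le> C * norm v" unfolding C_def
      by (simp add: sum_distrib_right[symmetric] distrib_right mult.commute[of "norm v"])
    finally show ?thesis .
  qed
  moreover have "C > 0" unfolding C_def using M0 by (simp add: add_nonneg_pos sum_nonneg)
  ultimately show ?thesis using that by blast
qed

section \<open>Characters and van der Corput's inequality\<close>

definition kdot :: "int^'n \<Rightarrow> real^'n \<Rightarrow> real" where
  "kdot k x = (\<Sum>i\<in>UNIV. of_int (k $ i) * x $ i)"

lemma kdot_add: "kdot k (x + y) = kdot k x + kdot k y"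
  and kdot_diff: "kdot k (x - y) = kdot k x - kdot k y"
  and kdot_diff_left: "kdot (k - l) x = kdot k x - kdot l x"
  and kdot_add_left: "kdot (k + l) x = kdot k x + kdot l x"
  and kdot_scaleR: "kdot k (c *\<^sub>R x) = c * kdot k x"
  and kdot_0 [simp]: "kdot 0 x = 0"
  and kdot_axis: "kdot k (axis i 1) = of_int (k $ i)"
  by (simp_all add: kdot_def algebra_simps sum.distrib sum_subtractf sum_distrib_left axis_def
      if_distrib if_distribR cong: if_cong)

lemma kdot_inner: "kdot k x = (\<chi> i. of_int (k $ i)) \<bullet> x"
  by (simp add: kdot_def inner_vec_def)

lemma continuous_on_kdot [continuous_intros]: "continuous_on A (kdot k)"
  unfolding kdot_inner[abs_def] by (intro continuous_intros)

lemma kdot_bound: "\<bar>kdot k x\<bar> \<le> norm (\<chi> i. real_of_int (k $ i)) * norm x"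
  unfolding kdot_inner by (rule Cauchy_Schwarz_ineq2)

lemma kdot_transpose: "kdot k (rmat A *v x) = kdot (transpose A *v k) x"
  unfolding kdot_def matrix_vector_mult_def
  by (simp add: sum_distrib_left sum_distrib_right transpose_def mult_ac)
    (rule sum.swap)

text \<open>Moves the dynamics from the point to the character, which then runs through an orbit of
  the transpose.\<close>

lemma kdot_orbit: "kdot k (orbit (rmat A) x n) = kdot (orbit (transpose A) k n) x"
proof (induction n arbitrary: k)
  case (Suc n)
  have "kdot k (orbit (rmat A) x (Suc n)) = kdot (transpose A *v k) (orbit (rmat A) x n)"
    by (simp add: kdot_transpose del: transpose_matrix_vector)
  also have "\<dots> = kdot (orbit (transpose A) (transpose A *v k) n) x" by (rule Suc)
  finally show ?case by (simp only: funpow_Suc_right o_apply)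
qed simp

lemma orbit_orbit: "orbit A (orbit A x m) n = orbit A x (n + m)"
  by (simp add: funpow_add)

lemma surj_endomorphism:
  fixes S :: "int^'n^'n"
  assumes "toral_endomorphism S"
  shows "surj (\<lambda>x. rmat S *v x)"
proof -
  have "det (rmat S) = of_int (det S)" by (rule det_hom) auto
  then have "invertible (rmat S)"
    using assms unfolding toral_endomorphism_def by (simp add: invertible_det_nz)
  then have "\<exists>B. rmat S ** B = mat 1" unfolding invertible_def by blast
  then show ?thesis using matrix_right_invertible_surjective[of "rmat S"] by blast
qed

text \<open>If two members of the dual orbit coincide, k vanishes on the range of S^m (S^p - 1) with
  p > 0. Both factors are surjective, the first because det S is nonzero, the second because no
  nonzero vector is fixed by S^p. Hence k = 0.\<close>

lemma orbit_characters_inj: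
  fixes S :: "int^'n^'n"
  assumes S: "toral_endomorphism S" "quasihyperbolic S" and k: "k \<noteq> 0" and mn: "m \<noteq> n"
  shows "orbit (transpose S) k m \<noteq> orbit (transpose S) k n"
proof -
  have aux: False if mn: "m < n" and eq: "orbit (transpose S) k m = orbit (transpose S) k n" for m n
  proof -
    define p where "p = n - m"
    have p: "p > 0" "n = m + p" using mn unfolding p_def by auto
    define f where "f x = orbit (rmat S) x p - x" for x
    have lin: "linear f"
      unfolding f_def by (intro linearI) (simp_all add: orbit_add orbit_scaleR scaleR_diff_right)
    have "inj f"
    proof (rule linear_injective_0[OF lin, THEN iffD2], intro allI impI)
      fix x assume "f x = 0"
      then have "orbit (rmat S) x p = x" unfolding f_def by simp
      then have "orbit (cmat S) (cvec x) p = cvec x" by (simp add: cvec_orbit)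
      then have "cvec x = 0" by (rule quasihyperbolic_no_periodic[OF S(2) p(1)])
      then show "x = 0" by simp
    qed
    then have surj: "surj f" using lin by (simp add: linear_injective_imp_surjective)
    have surjS: "surj (\<lambda>x. orbit (rmat S) x j)" for j
    proof (induction j)
      case (Suc j)
      then have "surj ((\<lambda>x. rmat S *v x) \<circ> (\<lambda>x. orbit (rmat S) x j))"
        using surj_endomorphism[OF S(1)] by (intro comp_surj)
      then show ?case by (simp add: comp_def)
    qed (simp add: surj_def)
    have "kdot k (orbit (rmat S) (f x) m) = 0" for x
    proof -
      have "orbit (rmat S) (f x) m = orbit (rmat S) x n - orbit (rmat S) x m"
        unfolding f_def orbit_diff orbit_orbit p(2) ..
      then show ?thesis by (simp add: kdot_diff kdot_orbit eq)
    qed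
    note z = this
    have "kdot k (axis i 1) = 0" for i
    proof -
      obtain y where y: "axis i 1 = orbit (rmat S) y m" using surjS[of m] by (auto elim: surjE)
      obtain x where x: "y = f x" using surj by (auto elim: surjE)
      show ?thesis unfolding y x by (rule z)
    qed
    then have "k = 0" by (simp add: kdot_axis vec_eq_iff)
    then show False using k by simp
  qed
  show ?thesis using aux[of m n] aux[of n m] mn by (metis linorder_neqE_nat)
qed

text \<open>Averaging over H shifted copies and Cauchy-Schwarz: the H diagonal terms contribute a
  share 1 / H, the others \<epsilon>. The shifts h may depend on \<epsilon> and H because
  correlations will only be controlled along selected return times.\<close>

lemma van_der_corput:
  fixes c :: "nat \<Rightarrow> complex"
  assumes c: "\<And>n. cmod (c n) \<le> 1"
    and corr: "\<And>\<epsilon> H::nat. \<epsilon> > 0 \<Longrightarrow> \<exists>h. \<forall>i<H. \<forall>j<H. i \<noteq> j \<longrightarrow>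
      (\<forall>\<^sub>F N in sequentially. cmod (\<Sum>n<N. c (n + h i) * cnj (c (n + h j))) \<le> \<epsilon> * real N)"
  shows "(\<lambda>N. (\<Sum>n<N. c n) / of_nat N) \<longlonglongrightarrow> 0"
proof (rule LIMSEQ_I)
  fix \<epsilon> :: real assume \<epsilon>: "\<epsilon> > 0"
  \<comment> \<open>Diagonal and off-diagonal terms together give 2 \<delta>, which is the square of
    \<epsilon> / 2.\<close>
  define \<delta> where "\<delta> = \<epsilon>\<^sup>2 / 8"
  have \<delta>: "\<delta> > 0" using \<epsilon> unfolding \<delta>_def by simp
  obtain H :: nat where H: "H > 0" "1 / real H < \<delta>"
    using \<delta> by (metis divide_inverse mult_1 ex_inverse_of_nat_less)
  obtain h where h: "\<forall>i<H. \<forall>j<H. i \<noteq> j \<longrightarrow>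
      (\<forall>\<^sub>F N in sequentially. cmod (\<Sum>n<N. c (n + h i) * cnj (c (n + h j))) \<le> \<delta> * real N)"
    using corr[OF \<delta>, of H] by (elim exE) (rule that)
  define m where "m = Max (h ` {..<H})"
  have m: "h i \<le> m" if "i < H" for i using that unfolding m_def by (intro Max_ge) auto
  have shift: "cmod ((\<Sum>n<N. c (n + p)) - (\<Sum>n<N. c n)) \<le> 2 * real p" for N p
  proof -
    have split: "(\<Sum>n<p. c n) + (\<Sum>n<N. c (n + p)) = (\<Sum>n<N + p. c n)" for N p
      by (induction N) (simp_all add: add_ac)
    have "(\<Sum>n<N. c (n + p)) + (\<Sum>n<p. c n) = (\<Sum>n<N. c n) + (\<Sum>n<p. c (n + N))"
      using split[of p N] split[of N p] by (simp add: add.commute)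
    then have "(\<Sum>n<N. c (n + p)) - (\<Sum>n<N. c n) = (\<Sum>n<p. c (n + N)) - (\<Sum>n<p. c n)"
      by (simp add: algebra_simps)
    also have "cmod \<dots> \<le> cmod (\<Sum>n<p. c (n + N)) + cmod (\<Sum>n<p. c n)" by (rule norm_triangle_ineq4)
    also have "\<dots> \<le> real p + real p"
      using sum_norm_bound[of "{..<p}" "\<lambda>n. c (n + N)" 1] sum_norm_bound[of "{..<p}" c 1] c
      by (intro add_mono) auto
    finally show ?thesis by simp
  qed
  have "\<forall>\<^sub>F N in sequentially. \<forall>i\<in>{..<H}. \<forall>j\<in>{..<H}. i \<noteq> j \<longrightarrow>
      cmod (\<Sum>n<N. c (n + h i) * cnj (c (n + h j))) \<le> \<delta> * real N"
    using h by (intro eventually_ball_finite ballI) (auto intro: always_eventually)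
  moreover have "\<forall>\<^sub>F N in sequentially. real N > 4 * real m / \<epsilon>"
    using filterlim_real_sequentially by (simp add: filterlim_at_top_dense)
  ultimately have "\<forall>\<^sub>F N in sequentially. norm ((\<Sum>n<N. c n) / of_nat N - 0) < \<epsilon>"
  proof eventually_elim
    case (elim N)
    define b where "b n = (\<Sum>i<H. c (n + h i))" for n
    have "(\<Sum>n<N. (cmod (b n))\<^sup>2) = cmod (\<Sum>n<N. of_real ((cmod (b n))\<^sup>2))"
      by (simp only: of_real_sum[symmetric] norm_of_real) (simp add: sum_nonneg)
    also have "(\<Sum>n<N. complex_of_real ((cmod (b n))\<^sup>2)) =
        (\<Sum>n<N. \<Sum>i<H. \<Sum>j<H. c (n + h i) * cnj (c (n + h j)))"
      by (simp add: complex_norm_square b_def sum_product del: of_real_power)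
    also have "\<dots> = (\<Sum>i<H. \<Sum>j<H. \<Sum>n<N. c (n + h i) * cnj (c (n + h j)))"
      by (subst sum.swap) (intro sum.cong refl sum.swap)
    also have "cmod \<dots> \<le> (\<Sum>i<H. \<Sum>j<H. if i = j then real N else \<delta> * real N)"
    proof (intro sum_norm_le)
      fix i j assume ij: "i \<in> {..<H}" "j \<in> {..<H}"
      show "cmod (\<Sum>n<N. c (n + h i) * cnj (c (n + h j))) \<le> (if i = j then real N else \<delta> * real N)"
      proof (cases "i = j")
        case True
        have "cmod (c n * cnj (c n)) \<le> 1" for n
          using c[of n] by (simp add: norm_mult mult_le_one)
        then show ?thesis
          using True sum_norm_bound[of "{..<N}" "\<lambda>n. c (n + h j) * cnj (c (n + h j))" 1] by simp
      qed (use elim ij in auto)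
    qed
    also have "\<dots> \<le> (\<Sum>i<H. \<Sum>j<H. (if j = i then real N else 0) + \<delta> * real N)"
      using \<delta> by (intro sum_mono) auto
    also have "\<dots> = real H * real N + real H * real H * \<delta> * real N"
      by (simp add: sum.distrib distrib_left)
    also have "\<dots> \<le> (real H)\<^sup>2 * (2 * \<delta> * real N)"
    proof -
      have "1 \<le> real H * \<delta>" using H by (simp add: field_simps)
      then have "real H * real N * 1 \<le> real H * real N * (real H * \<delta>)" by (intro mult_left_mono) auto
      then show ?thesis by (simp add: power2_eq_square algebra_simps)
    qed
    finally have sq: "(\<Sum>n<N. (cmod (b n))\<^sup>2) \<le> (real H)\<^sup>2 * (2 * \<delta> * real N)" .
    have "(\<Sum>n<N. cmod (b n))\<^sup>2 \<le> (\<Sum>n<N. (cmod (b n))\<^sup>2) * real N"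
      using sum_squared_le_sum_of_squares[of "\<lambda>n. cmod (b n)" "{..<N}"] by simp
    also have "\<dots> \<le> (real H)\<^sup>2 * (2 * \<delta> * real N) * real N"
      using sq by (intro mult_right_mono) auto
    also have "\<dots> = (real H * real N * (\<epsilon> / 2))\<^sup>2"
      unfolding \<delta>_def by (simp add: power2_eq_square)
    finally have sb: "(\<Sum>n<N. cmod (b n)) \<le> real H * real N * (\<epsilon> / 2)"
      by (rule power2_le_imp_le) (use \<epsilon> in auto)
    have "real H * cmod (\<Sum>n<N. c n) = cmod (\<Sum>i<H. \<Sum>n<N. c n)" by (simp add: norm_mult)
    also have "(\<Sum>i<H. \<Sum>n<N. c n) = (\<Sum>n<N. b n) - (\<Sum>i<H. (\<Sum>n<N. c (n + h i)) - (\<Sum>n<N. c n))"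
      unfolding b_def sum_subtractf by (subst sum.swap) simp
    also have "cmod \<dots> \<le> cmod (\<Sum>n<N. b n) + cmod (\<Sum>i<H. (\<Sum>n<N. c (n + h i)) - (\<Sum>n<N. c n))"
      by (rule norm_triangle_ineq4)
    also have "\<dots> \<le> real H * real N * (\<epsilon> / 2) + real H * (2 * real m)"
    proof (rule add_mono)
      show "cmod (\<Sum>n<N. b n) \<le> real H * real N * (\<epsilon> / 2)"
        using sb norm_sum[of b "{..<N}"] by linarith
      have "cmod ((\<Sum>n<N. c (n + h i)) - (\<Sum>n<N. c n)) \<le> 2 * real m" if "i < H" for i
        using shift[where N = N and p = "h i"] m[OF that] by linarith
      then show "cmod (\<Sum>i<H. (\<Sum>n<N. c (n + h i)) - (\<Sum>n<N. c n)) \<le> real H * (2 * real m)"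
        using sum_norm_bound[of "{..<H}" "\<lambda>i. (\<Sum>n<N. c (n + h i)) - (\<Sum>n<N. c n)" "2 * real m"] by simp
    qed
    also have "\<dots> = real H * (real N * (\<epsilon> / 2) + 2 * real m)" by (simp add: algebra_simps)
    finally have "cmod (\<Sum>n<N. c n) \<le> real N * (\<epsilon> / 2) + 2 * real m"
      using H(1) by (simp only: mult_le_cancel_left_pos of_nat_0_less_iff)
    moreover have "4 * real m < real N * \<epsilon>" using elim(2) \<epsilon> by (simp add: field_simps)
    ultimately have "cmod (\<Sum>n<N. c n) < real N * \<epsilon>" by simp
    moreover have "real N > 0" using elim(2) \<epsilon> by (smt (verit) divide_nonneg_pos of_nat_0_le_iff)
    ultimately show ?case by (simp add: norm_divide divide_less_eq mult.commute)
  qed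
  then show "\<exists>no. \<forall>n\<ge>no. norm ((\<Sum>n<n. c n) / of_nat n - 0) < \<epsilon>"
    unfolding eventually_sequentially by blast
qed

definition weyl_points :: "int^'n^'n \<Rightarrow> (real^'n) set" where
  "weyl_points S = {x. \<forall>k. k \<noteq> 0 \<longrightarrow>
     (\<lambda>N. (\<Sum>n<N. cis (2 * pi * kdot k (orbit (rmat S) x n))) / of_nat N) \<longlonglongrightarrow> 0}"

text \<open>The perturbation by \<open>u\<close> may rotate for ever, but along return times \<open>h\<close> of its orbit the
  correlations of the perturbed sequence are close to those of the original one.\<close>

lemma weyl_points_add_bounded:
  fixes S :: "int^'n^'n"
  assumes S: "toral_endomorphism S" "quasihyperbolic S"
    and x: "x \<in> weyl_points S" and u: "u \<in> bounded_orbits S"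
  shows "x + u \<in> weyl_points S"
  unfolding weyl_points_def
proof (intro CollectI allI impI)
  fix k :: "int^'n" assume k: "k \<noteq> 0"
  let ?O = "orbit (rmat S)" and ?T = "orbit (transpose S) k"
  let ?e = "\<lambda>t. cis (2 * pi * t)"
  define c where "c n = ?e (kdot k (?O (x + u) n))" for n
  obtain C where C: "C > 0" "\<forall>v\<in>bounded_orbits S. \<forall>n. norm (?O v n) \<le> C * norm v"
    by (rule power_bound)
  have inv: "?O u h \<in> bounded_orbits S" for h
  proof -
    have "range (?O (?O u h)) \<subseteq> range (?O u)" unfolding orbit_orbit by blast
    then show ?thesis using u bounded_subset unfolding bounded_orbits_def by blast
  qed
  define K where "K = norm (\<chi> i. real_of_int (k $ i)) + 1"
  have K: "K > 0" "\<bar>kdot k y\<bar> \<le> K * norm y" for y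
  proof -
    show "K > 0" unfolding K_def by (simp add: add_nonneg_pos)
    have "norm (\<chi> i. real_of_int (k $ i)) * norm y \<le> K * norm y"
      unfolding K_def by (intro mult_right_mono) auto
    then show "\<bar>kdot k y\<bar> \<le> K * norm y" using kdot_bound[of k y] by linarith
  qed
  have "(\<lambda>N. (\<Sum>n<N. c n) / of_nat N) \<longlonglongrightarrow> 0"
  proof (rule van_der_corput)
    show "cmod (c n) \<le> 1" for n unfolding c_def by simp
    fix \<epsilon> :: real and H :: nat assume \<epsilon>: "\<epsilon> > 0"
    \<comment> \<open>Makes 2 pi K C \<epsilon>' equal to \<epsilon> / 2, the allowed error in each
      correlation term.\<close>
    define \<epsilon>' where "\<epsilon>' = \<epsilon> / (2 * (2 * pi * K * C))"
    have \<epsilon>': "\<epsilon>' > 0" unfolding \<epsilon>'_def using \<epsilon> K(1) C(1) by simp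
    \<comment> \<open>The bounded orbit of u has a convergent subsequence; its tail supplies
      arbitrarily many times at which the orbit of u is nearly the same.\<close>
    obtain l r where r: "strict_mono r" "(?O u \<circ> r) \<longlonglongrightarrow> l"
      using bounded_imp_convergent_subsequence[of "?O u"] u unfolding bounded_orbits_def by blast
    then have "Cauchy (?O u \<circ> r)" by (intro LIMSEQ_imp_Cauchy)
    then obtain M where M: "\<forall>m\<ge>M. \<forall>n\<ge>M. dist ((?O u \<circ> r) m) ((?O u \<circ> r) n) < \<epsilon>'"
      using \<epsilon>' unfolding Cauchy_def by blast
    define h where "h i = r (M + i)" for i
    have hinj: "h i \<noteq> h j" if "i \<noteq> j" for i j
      using that strict_mono_eq[OF r(1)] unfolding h_def by simp
    have near: "norm (?O u (h i) - ?O u (h j)) \<le> \<epsilon>'" for i j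
    proof -
      have "dist ((?O u \<circ> r) (M + i)) ((?O u \<circ> r) (M + j)) < \<epsilon>'" using M by simp
      then show ?thesis unfolding h_def o_apply dist_norm by simp
    qed
    show "\<exists>h. \<forall>i<H. \<forall>j<H. i \<noteq> j \<longrightarrow>
      (\<forall>\<^sub>F N in sequentially. cmod (\<Sum>n<N. c (n + h i) * cnj (c (n + h j))) \<le> \<epsilon> * real N)"
    proof (intro exI[of _ h] allI impI)
      fix i j :: nat assume ij: "i \<noteq> j"
      \<comment> \<open>The part of the correlation due to x is again a character sum along the
        orbit of x. Its frequency k' is nonzero, so its averages vanish by the choice of x.\<close>
      define k' where "k' = ?T (h i) - ?T (h j)"
      have "k' \<noteq> 0" using orbit_characters_inj[OF S k hinj[OF ij]] unfolding k'_def by simp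
      then have lim: "(\<lambda>N. (\<Sum>n<N. ?e (kdot k' (?O x n))) / of_nat N) \<longlonglongrightarrow> 0"
        using x unfolding weyl_points_def by blast
      \<comment> \<open>The part due to u: the difference at two return times is small and has
        bounded orbit, so \<open>power_bound\<close> keeps it small for all n.\<close>
      define f where "f n = kdot k (?O (?O u (h i) - ?O u (h j)) n)" for n
      have prod: "c (n + h i) * cnj (c (n + h j)) = ?e (kdot k' (?O x n)) * ?e (f n)" for n
      proof -
        have "kdot k' (?O x n) = kdot k (?O x (n + h i)) - kdot k (?O x (n + h j))"
          by (simp only: k'_def kdot_orbit orbit_diff orbit_orbit kdot_diff_left)
        moreover have "f n = kdot k (?O u (n + h i)) - kdot k (?O u (n + h j))"
          by (simp only: f_def orbit_diff kdot_diff orbit_orbit)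
        ultimately have "2 * pi * (kdot k (?O (x + u) (n + h i)) - kdot k (?O (x + u) (n + h j))) =
            2 * pi * (kdot k' (?O x n) + f n)"
          unfolding orbit_add kdot_add by simp
        then have "2 * pi * kdot k (?O (x + u) (n + h i)) + - (2 * pi * kdot k (?O (x + u) (n + h j))) =
            2 * pi * kdot k' (?O x n) + 2 * pi * f n"
          by (simp only: right_diff_distrib distrib_left diff_conv_add_uminus)
        then show ?thesis unfolding c_def cis_cnj cis_mult by (rule arg_cong)
      qed
      have fb: "cmod (?e (f n) - 1) \<le> \<epsilon> / 2" for n
      proof -
        have "cmod (?e (f n) - 1) \<le> \<bar>2 * pi * f n\<bar>"
          using dist_exp_i_1[of "2 * pi * f n"] abs_sin_x_le_abs_x[of "2 * pi * f n / 2"]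
          by (simp add: cis_conv_exp)
        also have "\<dots> = 2 * pi * \<bar>f n\<bar>" by (simp add: abs_mult)
        also have "\<dots> \<le> 2 * pi * (K * (C * \<epsilon>'))"
        proof -
          have "norm (?O (?O u (h i) - ?O u (h j)) n) \<le> C * norm (?O u (h i) - ?O u (h j))"
            using C(2) subspace_diff[OF subspace_bounded_orbits inv inv] by blast
          also have "\<dots> \<le> C * \<epsilon>'" using near C(1) by (intro mult_left_mono) auto
          finally have "K * norm (?O (?O u (h i) - ?O u (h j)) n) \<le> K * (C * \<epsilon>')"
            using K(1) by (intro mult_left_mono) auto
          then have "\<bar>f n\<bar> \<le> K * (C * \<epsilon>')"
            using K(2)[of "?O (?O u (h i) - ?O u (h j)) n"] unfolding f_def by linarith
          then show ?thesis by (intro mult_left_mono) auto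
        qed
        also have "\<dots> = \<epsilon> / 2"
          unfolding \<epsilon>'_def using K(1) C(1) by (simp add: field_simps)
        finally show ?thesis .
      qed
      have "\<forall>\<^sub>F N in sequentially. norm ((\<Sum>n<N. ?e (kdot k' (?O x n))) / of_nat N) < \<epsilon> / 2"
        using tendstoD[OF lim, of "\<epsilon> / 2"] \<epsilon> unfolding dist_norm by simp
      then show "\<forall>\<^sub>F N in sequentially. cmod (\<Sum>n<N. c (n + h i) * cnj (c (n + h j))) \<le> \<epsilon> * real N"
        using eventually_gt_at_top[of "0::nat"]
      proof eventually_elim
        case (elim N)
        define a where "a n = ?e (kdot k' (?O x n))" for n
        define b where "b n = ?e (f n) - 1" for n
        have "(\<Sum>n<N. c (n + h i) * cnj (c (n + h j))) = (\<Sum>n<N. a n + a n * b n)"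
          unfolding prod by (intro sum.cong refl) (simp add: a_def b_def right_diff_distrib)
        then have "cmod (\<Sum>n<N. c (n + h i) * cnj (c (n + h j))) \<le> cmod (\<Sum>n<N. a n) + cmod (\<Sum>n<N. a n * b n)"
          by (simp only: sum.distrib norm_triangle_ineq)
        moreover have "cmod (\<Sum>n<N. a n) \<le> \<epsilon> / 2 * real N"
          using elim unfolding a_def by (simp add: norm_divide divide_less_eq)
        moreover have "cmod (\<Sum>n<N. a n * b n) \<le> real N * (\<epsilon> / 2)"
        proof -
          have "cmod (a n * b n) \<le> \<epsilon> / 2" for n
            using fb[of n] unfolding a_def b_def by (simp add: norm_mult)
          then show ?thesis using sum_norm_bound[of "{..<N}" "\<lambda>n. a n * b n" "\<epsilon> / 2"] by simp
        qed
        ultimately show ?case by (simp add: mult.commute)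
      qed
    qed
  qed
  then show "(\<lambda>N. (\<Sum>n<N. ?e (kdot k (?O (x + u) n))) / of_nat N) \<longlonglongrightarrow> 0"
    unfolding c_def .
qed

section \<open>Almost every point\<close>

abbreviation cube_measure :: "(real^'n) measure" where
  "cube_measure \<equiv> restrict_space lborel (cbox 0 1)"

lemma emeasure_cube_measure: "emeasure cube_measure (space cube_measure) = 1"
proof -
  have "emeasure lborel (cbox 0 1 :: (real^'n) set) = 1"
    by (subst emeasure_lborel_cbox) (auto simp: Basis_vec_def inner_axis prod.neutral)
  then show ?thesis by (simp add: space_restrict_space emeasure_restrict_space)
qed

interpretation cube: finite_measure "cube_measure :: (real^'n) measure"
  by (rule finite_measureI) (subst emeasure_cube_measure, simp)

lemma measure_cube_measure: "measure cube_measure (space cube_measure) = 1"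
  unfolding measure_def emeasure_cube_measure by simp

lemma measurable_cube_continuous:
  "continuous_on UNIV f \<Longrightarrow> f \<in> borel_measurable cube_measure"
  by (intro measurable_restrict_space1) (simp add: borel_measurable_continuous_onI)

lemma lborel_integral_translate:
  fixes g :: "'a::euclidean_space \<Rightarrow> 'b::{banach, second_countable_topology}"
  assumes "g \<in> borel_measurable borel"
  shows "(\<integral>x. g (a + x) \<partial>lborel) = (\<integral>x. g x \<partial>lborel)"
proof -
  have "(\<integral>x. g x \<partial>lborel) = (\<integral>x. g x \<partial>distr lborel borel ((+) a))"
    by (simp only: lborel_distr_plus)
  also have "\<dots> = (\<integral>x. g (a + x) \<partial>lborel)" using assms by (intro integral_distr) auto
  finally show ?thesis ..
qed

text \<open>Translating the cube by half a period in a coordinate \<open>i\<close> with \<open>k\<^sub>i \<noteq> 0\<close> leaves the integral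
  unchanged by periodicity and flips its sign.\<close>

lemma integral_character_eq_0:
  fixes k :: "int^'n"
  assumes k: "k \<noteq> 0"
  shows "(\<integral>x. cis (2 * pi * kdot k x) \<partial>cube_measure) = 0"
proof -
  obtain i where i: "k $ i \<noteq> 0" using k by (auto simp: vec_eq_iff)
  define e :: "real^'n" where "e = axis i 1"
  have ei: "(y + t *\<^sub>R e) $ j = (if j = i then y $ j + t else y $ j)" for y t j
    unfolding e_def by (simp add: axis_def)
  \<comment> \<open>Half the period of the character along coordinate i.\<close>
  define c where "c = 1 / (2 * \<bar>real_of_int (k $ i)\<bar>)"
  have "1 \<le> \<bar>real_of_int (k $ i)\<bar>" using i by linarith
  then have c: "0 < c" "c < 1" "\<bar>real_of_int (k $ i)\<bar> * c = 1 / 2" unfolding c_def by (auto simp: field_simps)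
  define f where "f x = cis (2 * pi * kdot k x)" for x
  have fm: "f \<in> borel_measurable borel"
    unfolding f_def by (intro borel_measurable_continuous_onI continuous_intros)
  have f1: "f (y + (-1) *\<^sub>R e) = f y" for y
  proof -
    have "cis (2 * pi * (- 1 * real_of_int (k $ i))) = 1"
      using cis_multiple_2pi[of "- real_of_int (k $ i)"] by simp
    then show ?thesis
      unfolding f_def kdot_add kdot_scaleR e_def kdot_axis
      by (simp only: distrib_left cis_mult[symmetric] mult_1_right)
  qed
  have fc: "f (y + (-c) *\<^sub>R e) = - f y" for y
  proof -
    have "c * real_of_int (k $ i) = 1 / 2 \<or> c * real_of_int (k $ i) = - 1 / 2"
      using c(3) by (auto simp: abs_if mult.commute split: if_splits)
    moreover have "2 * pi * (- c * real_of_int (k $ i)) = - (2 * (c * real_of_int (k $ i))) * pi" by simp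
    ultimately have "2 * pi * (- c * real_of_int (k $ i)) = - pi \<or> 2 * pi * (- c * real_of_int (k $ i)) = pi"
      by (elim disjE) (simp_all only:, simp_all)
    moreover have "cis (- pi) = -1" by (simp add: complex_eq_iff)
    ultimately have "cis (2 * pi * (- c * real_of_int (k $ i))) = -1"
      by (elim disjE) (simp_all only: cis_pi)
    then show ?thesis
      unfolding f_def kdot_add kdot_scaleR e_def kdot_axis
      by (simp only: distrib_left cis_mult[symmetric] mult_minus_right mult_1_right)
  qed
  \<comment> \<open>The cube, half open in coordinate i, so that translates fit together exactly;
    the missing face is a null set.\<close>
  define P where "P = cbox 0 1 \<inter> {x::real^'n. x $ i < 1}"
  define A where "A = P \<inter> {x. x $ i < c}"
  have meas: "P \<in> sets borel" "A \<in> sets borel"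
    unfolding A_def P_def by (intro sets.Int borel_open open_halfspace_component_lt_cart borel_closed closed_cbox)+
  define I where "I X = (\<integral>x. indicator X x *\<^sub>R f x \<partial>lborel)" for X
  have int: "integrable lborel (\<lambda>x. indicator X x *\<^sub>R f x)" if "X \<in> sets borel" "X \<subseteq> cbox (-2) 2" for X
  proof (rule Bochner_Integration.integrable_bound)
    show "integrable lborel (indicator (cbox (-2) 2 :: (real^'n) set) :: _ \<Rightarrow> real)"
      by (intro integrable_real_indicator) (auto simp: emeasure_lborel_cbox_eq)
    show "(\<lambda>x. indicator X x *\<^sub>R f x) \<in> borel_measurable lborel" using that(1) fm by simp
    show "AE x in lborel. norm (indicator X x *\<^sub>R f x) \<le> norm (indicator (cbox (-2) 2) x :: real)"
      using that(2) by (intro AE_I2) (auto simp: indicator_def f_def)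
  qed
  have P2: "P \<subseteq> cbox (-2) 2" "A \<subseteq> cbox (-2) 2"
  proof -
    have "x \<in> cbox (-2) 2" if "x \<in> cbox 0 1" for x :: "real^'n"
    proof -
      have "\<forall>j. 0 \<le> x $ j \<and> x $ j \<le> 1" using that by (simp add: mem_box_cart)
      then have "\<forall>j. -2 \<le> x $ j \<and> x $ j \<le> 2" by (smt (verit))
      then show ?thesis by (simp add: mem_box_cart)
    qed
    then show "P \<subseteq> cbox (-2) 2" "A \<subseteq> cbox (-2) 2" unfolding A_def P_def by blast+
  qed
  have shiftA: "(\<lambda>x. indicator A (x + (-1) *\<^sub>R e) *\<^sub>R f x) = (\<lambda>x. indicator A ((-1) *\<^sub>R e + x) *\<^sub>R f ((-1) *\<^sub>R e + x))"
    using f1 by (simp only: add.commute)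
  have IA: "(\<integral>x. indicator A (x + (-1) *\<^sub>R e) *\<^sub>R f x \<partial>lborel) = I A"
    unfolding shiftA I_def using meas fm by (intro lborel_integral_translate) simp
  have intA: "integrable lborel (\<lambda>x. indicator A (x + (-1) *\<^sub>R e) *\<^sub>R f x)"
  proof -
    have *: "indicator A (x + (-1) *\<^sub>R e) = (indicator ((\<lambda>x. x + (-1) *\<^sub>R e) -` A) x :: real)" for x
      by (simp add: indicator_def)
    have "(\<lambda>x. x + (-1) *\<^sub>R e) \<in> borel_measurable borel" by simp
    from measurable_sets[OF this meas(2)] have "(\<lambda>x. x + (-1) *\<^sub>R e) -` A \<in> sets borel" by simp
    moreover have "(\<lambda>x. x + (-1) *\<^sub>R e) -` A \<subseteq> cbox (-2) 2"
    proof
      fix x assume "x \<in> (\<lambda>x. x + (-1) *\<^sub>R e) -` A"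
      then have "\<forall>j. 0 \<le> (x + (-1) *\<^sub>R e) $ j \<and> (x + (-1) *\<^sub>R e) $ j \<le> 1"
        unfolding A_def P_def by (auto simp: mem_box_cart)
      then have "\<forall>j. -2 \<le> x $ j \<and> x $ j \<le> 2" unfolding ei by (smt (verit))
      then show "x \<in> cbox (-2) 2" by (simp add: mem_box_cart)
    qed
    ultimately show ?thesis unfolding * by (rule int)
  qed
  \<comment> \<open>Translating P by c along coordinate i removes the slab A at one end and adds its
    translate by a full unit at the other.\<close>
  have ind: "indicator P (x + (-c) *\<^sub>R e) = (indicator P x - indicator A x + indicator A (x + (-1) *\<^sub>R e) :: real)" for x
  proof -
    define off where "off \<longleftrightarrow> (\<forall>j. j \<noteq> i \<longrightarrow> 0 \<le> x $ j \<and> x $ j \<le> 1)"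
    have "y + t *\<^sub>R e \<in> P \<longleftrightarrow> (\<forall>j. j \<noteq> i \<longrightarrow> 0 \<le> y $ j \<and> y $ j \<le> 1) \<and> 0 \<le> y $ i + t \<and> y $ i + t < 1" for y t
      unfolding P_def Int_iff mem_Collect_eq mem_box_cart ei by (auto split: if_splits)
    then have P: "x + t *\<^sub>R e \<in> P \<longleftrightarrow> off \<and> 0 \<le> x $ i + t \<and> x $ i + t < 1" for t
      unfolding off_def by blast
    have A: "x + t *\<^sub>R e \<in> A \<longleftrightarrow> off \<and> 0 \<le> x $ i + t \<and> x $ i + t < 1 \<and> x $ i + t < c" for t
      unfolding A_def Int_iff P mem_Collect_eq ei by simp
    show ?thesis
      using P[of 0] A[of 0] P[of "-c"] A[of "-1"] c unfolding indicator_def by auto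
  qed
  have "I P = (\<integral>x. indicator P ((-c) *\<^sub>R e + x) *\<^sub>R f ((-c) *\<^sub>R e + x) \<partial>lborel)"
    unfolding I_def using meas fm by (intro lborel_integral_translate[symmetric]) simp
  also have "\<dots> = (\<integral>x. - (indicator P x *\<^sub>R f x - indicator A x *\<^sub>R f x + indicator A (x + (-1) *\<^sub>R e) *\<^sub>R f x) \<partial>lborel)"
    unfolding add.commute[of "(-c) *\<^sub>R e"] ind fc
    by (intro Bochner_Integration.integral_cong refl) (simp add: algebra_simps)
  also have "\<dots> = - ((\<integral>x. indicator P x *\<^sub>R f x \<partial>lborel) - (\<integral>x. indicator A x *\<^sub>R f x \<partial>lborel)
      + (\<integral>x. indicator A (x + (-1) *\<^sub>R e) *\<^sub>R f x \<partial>lborel))"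
    using int[OF meas(1) P2(1)] int[OF meas(2) P2(2)] intA
    by (simp only: Bochner_Integration.integral_minus Bochner_Integration.integral_add
        Bochner_Integration.integral_diff Bochner_Integration.integrable_diff)
  also have "\<dots> = - I P" unfolding IA I_def[symmetric] by simp
  finally have "I P = 0" by simp
  have "(\<integral>x. f x \<partial>cube_measure) = (\<integral>x. indicator (cbox 0 1) x *\<^sub>R f x \<partial>lborel)"
    by (intro integral_restrict_space) simp
  also have "\<dots> = I P"
    unfolding I_def
  proof (rule integral_cong_AE)
    have "negligible {x::real^'n. x $ i = 1}"
    proof -
      have "axis i (1::real) \<in> Basis" by (auto simp: Basis_vec_def)
      from negligible_standard_hyperplane[OF this, of 1] show ?thesis by (simp add: inner_axis)
    qed
    then have "{x::real^'n. x $ i = 1} \<in> null_sets lborel"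
      unfolding negligible_iff_null_sets
      by (subst (asm) null_sets_completion_iff) (auto intro!: borel_closed closed_Collect_eq continuous_intros)
    then have "AE x in lborel. x \<notin> {x::real^'n. x $ i = 1}" by (rule AE_not_in)
    then show "AE x in lborel. indicator (cbox 0 1) x *\<^sub>R f x = indicator P x *\<^sub>R f x"
    proof eventually_elim
      case (elim x)
      have "x $ i \<le> 1" if "x \<in> cbox 0 1" using that by (simp add: mem_box_cart)
      then have "x \<in> cbox 0 1 \<longleftrightarrow> x \<in> P" using elim unfolding P_def by fastforce
      then show ?case by (simp add: indicator_def)
    qed
  qed (use meas fm in auto)
  finally show ?thesis using \<open>I P = 0\<close> unfolding f_def by simp
qed

lemma continuous_on_cis [continuous_intros]: "continuous_on A f \<Longrightarrow> continuous_on A (\<lambda>x. cis (f x))"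
  unfolding cis_conv_exp by (intro continuous_intros)

lemma integrable_cube_bounded:
  fixes f :: "real^'n \<Rightarrow> 'b::{banach, second_countable_topology}"
  assumes "continuous_on UNIV f" "\<And>x. norm (f x) \<le> B"
  shows "integrable cube_measure f"
  using assms by (intro cube.integrable_const_bound[where B = B] measurable_cube_continuous) auto

lemma integral_norm_square_characters:
  fixes kn :: "nat \<Rightarrow> int^'n"
  assumes "inj kn"
  shows "(\<integral>x. (cmod (\<Sum>n<N. cis (2 * pi * kdot (kn n) x)))\<^sup>2 \<partial>cube_measure) = real N"
proof -
  let ?a = "\<lambda>n x. cis (2 * pi * kdot (kn n) x)"
  have int: "integrable cube_measure (\<lambda>x. cis (2 * pi * kdot (kn m - kn n) x))" for m n
    by (rule integrable_cube_bounded[where B = 1]) (intro continuous_intros, simp)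
  have "complex_of_real (\<integral>x. (cmod (\<Sum>n<N. ?a n x))\<^sup>2 \<partial>cube_measure) =
      (\<integral>x. complex_of_real ((cmod (\<Sum>n<N. ?a n x))\<^sup>2) \<partial>cube_measure)"
    by (rule integral_complex_of_real[symmetric])
  also have "\<dots> = (\<integral>x. (\<Sum>m<N. \<Sum>n<N. cis (2 * pi * kdot (kn m - kn n) x)) \<partial>cube_measure)"
    by (intro Bochner_Integration.integral_cong refl)
      (simp add: complex_norm_square sum_product cis_mult cis_cnj kdot_diff_left right_diff_distrib del: of_real_power)
  also have "\<dots> = (\<Sum>m<N. \<Sum>n<N. (\<integral>x. cis (2 * pi * kdot (kn m - kn n) x) \<partial>cube_measure))"
    by (simp only: Bochner_Integration.integral_sum Bochner_Integration.integrable_sum int)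
  also have "\<dots> = (\<Sum>m<N. \<Sum>n<N. if m = n then 1 else 0)"
  proof (intro sum.cong refl)
    fix m n
    show "(\<integral>x. cis (2 * pi * kdot (kn m - kn n) x) \<partial>cube_measure) = (if m = n then 1 else 0)"
    proof (cases "m = n")
      case True
      have "(\<integral>x. 1 \<partial>(cube_measure :: (real^'n) measure)) = (1::complex)"
        unfolding lebesgue_integral_const measure_cube_measure by simp
      then show ?thesis using True by simp
    next
      case False
      then have "kn m - kn n \<noteq> 0" using injD[OF assms, of m n] by auto
      then show ?thesis using False integral_character_eq_0[of "kn m - kn n"] by simp
    qed
  qed
  also have "\<dots> = complex_of_real (real N)" by simp
  finally show ?thesis by (rule of_real_eq_iff[THEN iffD1])
qed

text \<open>Between consecutive squares only about 2 sqrt N terms of modulus at most one are added,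
  which is negligible against N.\<close>

lemma averages_from_squares:
  fixes c :: "nat \<Rightarrow> complex"
  assumes c: "\<And>n. cmod (c n) \<le> 1"
    and sq: "(\<lambda>j. cmod (\<Sum>n<(Suc j)\<^sup>2. c n) / real ((Suc j)\<^sup>2)) \<longlonglongrightarrow> 0"
  shows "(\<lambda>N. (\<Sum>n<N. c n) / of_nat N) \<longlonglongrightarrow> 0"
proof (rule LIMSEQ_I)
  fix \<epsilon> :: real assume \<epsilon>: "\<epsilon> > 0"
  have "\<forall>\<^sub>F j in sequentially. cmod (\<Sum>n<(Suc j)\<^sup>2. c n) / real ((Suc j)\<^sup>2) < \<epsilon> / 2"
    using order_tendstoD(2)[OF sq, of "\<epsilon> / 2"] \<epsilon> by simp
  moreover have "\<forall>\<^sub>F j in sequentially. real j > 4 / \<epsilon>"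
    using filterlim_real_sequentially by (simp add: filterlim_at_top_dense)
  ultimately have "\<forall>\<^sub>F j in sequentially. cmod (\<Sum>n<(Suc j)\<^sup>2. c n) / real ((Suc j)\<^sup>2) < \<epsilon> / 2 \<and> real j > 4 / \<epsilon>"
    by (rule eventually_conj)
  then obtain J where J: "\<forall>j\<ge>J. cmod (\<Sum>n<(Suc j)\<^sup>2. c n) / real ((Suc j)\<^sup>2) < \<epsilon> / 2 \<and> real j > 4 / \<epsilon>"
    unfolding eventually_sequentially by blast
  have "norm ((\<Sum>n<N. c n) / of_nat N - 0) < \<epsilon>" if N: "N \<ge> (Suc J)\<^sup>2" for N
  proof -
    \<comment> \<open>The squares are indexed by \<open>Suc j\<close>, which avoids division by
      zero.\<close>
    define j where "j = floor_sqrt N - 1"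
    have "Suc J \<le> floor_sqrt N" using monoD[OF mono_floor_sqrt N] by simp
    then have j: "Suc j = floor_sqrt N" "j \<ge> J" unfolding j_def by auto
    have jN: "(Suc j)\<^sup>2 \<le> N" "N < (Suc (Suc j))\<^sup>2"
      unfolding j(1) by (simp_all add: Suc_floor_sqrt_power2_gt)
    have "(\<Sum>n<N. c n) = (\<Sum>n<(Suc j)\<^sup>2. c n) + (\<Sum>n\<in>{(Suc j)\<^sup>2..<N}. c n)"
      using sum.atLeastLessThan_concat[of 0 "(Suc j)\<^sup>2" N c] jN by (simp add: atLeast0LessThan)
    then have "cmod (\<Sum>n<N. c n) \<le> cmod (\<Sum>n<(Suc j)\<^sup>2. c n) + cmod (\<Sum>n\<in>{(Suc j)\<^sup>2..<N}. c n)"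
      by (simp only: norm_triangle_ineq)
    also have "cmod (\<Sum>n\<in>{(Suc j)\<^sup>2..<N}. c n) \<le> real (card {(Suc j)\<^sup>2..<N}) * 1"
      by (rule sum_norm_bound) (rule c)
    also have "real (card {(Suc j)\<^sup>2..<N}) * 1 \<le> 2 * real (Suc j)"
    proof -
      have "N - (Suc j)\<^sup>2 \<le> 2 * Suc j" using jN by (simp add: power2_eq_square)
      then have "real (N - (Suc j)\<^sup>2) \<le> real (2 * Suc j)" by (simp only: of_nat_le_iff)
      then show ?thesis by (simp only: card_atLeastLessThan of_nat_mult of_nat_numeral mult_1_right)
    qed
    finally have S: "cmod (\<Sum>n<N. c n) \<le> cmod (\<Sum>n<(Suc j)\<^sup>2. c n) + 2 * real (Suc j)" by simp
    have sq: "cmod (\<Sum>n<(Suc j)\<^sup>2. c n) < \<epsilon> / 2 * real ((Suc j)\<^sup>2)"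
      using J j(2) by (simp add: divide_less_eq del: of_nat_power)
    have "4 / \<epsilon> < real (Suc j)" using J j(2) by (smt (verit) of_nat_Suc)
    then have "4 < \<epsilon> * real (Suc j)" using \<epsilon> by (simp add: divide_less_eq mult.commute)
    then have "4 * real (Suc j) \<le> \<epsilon> * real (Suc j) * real (Suc j)" by (intro mult_right_mono) auto
    then have "2 * real (Suc j) \<le> \<epsilon> / 2 * real ((Suc j)\<^sup>2)" by (simp add: power2_eq_square algebra_simps)
    then have "cmod (\<Sum>n<N. c n) < \<epsilon> * real ((Suc j)\<^sup>2)" using S sq by (simp add: algebra_simps)
    also have "\<dots> \<le> \<epsilon> * real N" using jN(1) \<epsilon> by (intro mult_left_mono) (simp_all only: of_nat_le_iff)
    finally have "cmod (\<Sum>n<N. c n) < \<epsilon> * real N" .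
    moreover have "real N > 0" using jN(1) by (cases N) auto
    ultimately show ?thesis by (simp add: norm_divide divide_less_eq)
  qed
  then show "\<exists>no. \<forall>n\<ge>no. norm ((\<Sum>n<n. c n) / of_nat n - 0) < \<epsilon>" by blast
qed

text \<open>The mean of N distinct characters has second moment exactly 1 / N. Along squares these
  are summable, so almost everywhere the squared moduli form a convergent series and tend to
  zero.\<close>

lemma AE_character_averages:
  fixes kn :: "nat \<Rightarrow> int^'n"
  assumes "inj kn"
  shows "AE x in cube_measure. (\<lambda>N. (\<Sum>n<N. cis (2 * pi * kdot (kn n) x)) / of_nat N) \<longlonglongrightarrow> 0"
proof -
  define A where "A N x = cmod (\<Sum>n<N. cis (2 * pi * kdot (kn n) x))" for N x
  define g where "g j x = (A ((Suc j)\<^sup>2) x / real ((Suc j)\<^sup>2))\<^sup>2" for j x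
  have contA: "continuous_on UNIV (A N)" for N
    unfolding A_def by (intro continuous_intros)
  have contg: "continuous_on UNIV (g j)" for j
    unfolding g_def by (intro continuous_intros contA) auto
  have gm: "(\<lambda>x. ennreal (g j x)) \<in> borel_measurable cube_measure" for j
    by (intro measurable_compose[OF measurable_cube_continuous[OF contg]]) simp
  have gint: "(\<integral>\<^sup>+x. ennreal (g j x) \<partial>cube_measure) = ennreal (1 / real ((Suc j)\<^sup>2))" for j
  proof -
    let ?N = "(Suc j)\<^sup>2"
    have Ab: "A ?N x \<le> real ?N" for x
      using sum_norm_bound[of "{..<?N}" "\<lambda>n. cis (2 * pi * kdot (kn n) x)" 1] unfolding A_def by simp
    have "norm (g j x) \<le> 1" for x
    proof -
      have "A ?N x / real ?N \<le> 1" using Ab[of x] by (simp add: divide_le_eq del: of_nat_power)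
      moreover have "0 \<le> A ?N x / real ?N" unfolding A_def by simp
      ultimately show ?thesis unfolding g_def by (simp add: power_le_one del: of_nat_power)
    qed
    then have "integrable cube_measure (g j)" by (rule integrable_cube_bounded[OF contg])
    then have "(\<integral>\<^sup>+x. ennreal (g j x) \<partial>cube_measure) = ennreal (\<integral>x. g j x \<partial>cube_measure)"
      by (rule nn_integral_eq_integral) (simp add: g_def)
    also have "(\<integral>x. g j x \<partial>cube_measure) = (\<integral>x. (A ?N x)\<^sup>2 \<partial>cube_measure) / (real ?N)\<^sup>2"
      unfolding g_def power_divide by simp
    also have "(\<integral>x. (A ?N x)\<^sup>2 \<partial>cube_measure) = real ?N"
      unfolding A_def by (rule integral_norm_square_characters[OF assms])
    also have "real ?N / (real ?N)\<^sup>2 = 1 / real ?N" by (simp add: power2_eq_square del: of_nat_power)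
    finally show ?thesis .
  qed
  have "(\<integral>\<^sup>+x. (\<Sum>j. ennreal (g j x)) \<partial>cube_measure) = (\<Sum>j. ennreal (1 / real ((Suc j)\<^sup>2)))"
    using gm by (subst nn_integral_suminf) (auto simp: gint)
  also have "\<dots> \<noteq> top"
  proof -
    have "summable (\<lambda>j. 1 / real ((Suc j)\<^sup>2))"
      using inverse_squares_sums by (simp add: sums_iff add.commute)
    then show ?thesis by (intro ennreal_suminf_neq_top) auto
  qed
  finally have "AE x in cube_measure. (\<Sum>j. ennreal (g j x)) \<noteq> \<infinity>"
    using gm by (intro nn_integral_noteq_infinite) auto
  then show ?thesis
  proof eventually_elim
    case (elim x)
    have "summable (\<lambda>j. g j x)"
      using elim by (intro summable_suminf_not_top) (auto simp: g_def)
    then have "(\<lambda>j. g j x) \<longlonglongrightarrow> 0" by (rule summable_LIMSEQ_zero)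
    then have "(\<lambda>j. sqrt (g j x)) \<longlonglongrightarrow> sqrt 0" by (rule tendsto_real_sqrt)
    moreover have "sqrt (g j x) = A ((Suc j)\<^sup>2) x / real ((Suc j)\<^sup>2)" for j
      unfolding g_def A_def by (subst real_sqrt_abs) (simp del: of_nat_power)
    ultimately have "(\<lambda>j. A ((Suc j)\<^sup>2) x / real ((Suc j)\<^sup>2)) \<longlonglongrightarrow> 0" by simp
    then show ?case unfolding A_def by (intro averages_from_squares) auto
  qed
qed

text \<open>The frequencies k are countable, and for each nonzero k the dual orbit is injective, so
  the characters along it are orthogonal.\<close>

lemma AE_weyl_points:
  fixes S :: "int^'n^'n"
  assumes S: "toral_endomorphism S" "quasihyperbolic S"
  shows "AE x in cube_measure. x \<in> weyl_points S"
proof -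
  have "AE x in cube_measure. k \<noteq> 0 \<longrightarrow>
      (\<lambda>N. (\<Sum>n<N. cis (2 * pi * kdot k (orbit (rmat S) x n))) / of_nat N) \<longlonglongrightarrow> 0" for k :: "int^'n"
  proof (cases "k = 0")
    case False
    have "inj (orbit (transpose S) k)"
      using orbit_characters_inj[OF S False] by (intro injI) blast
    from AE_character_averages[OF this] show ?thesis
      unfolding kdot_orbit by eventually_elim (rule impI)
  qed simp
  then show ?thesis unfolding weyl_points_def mem_Collect_eq AE_all_countable by blast
qed

section \<open>Equidistribution\<close>

lemma kdot_lattice_eq: "lattice_eq x y \<Longrightarrow> kdot k x - kdot k y \<in> \<int>"
  unfolding lattice_eq_def kdot_def sum_subtractf[symmetric] right_diff_distrib[symmetric]
  by (intro Ints_sum Ints_mult) auto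

text \<open>The phase \<alpha> covers sine and cosine at once, so products of two such functions are
  sums of two and a real algebra for the Stone-Weierstrass theorem results.\<close>

lift_definition tcos :: "int^'n \<Rightarrow> real \<Rightarrow> 'n::finite torus \<Rightarrow> real"
  is "\<lambda>k \<alpha> x. cos (2 * pi * kdot k x + \<alpha>)"
proof -
  fix k :: "int^'n" and \<alpha> and x y :: "real^'n"
  assume "lattice_eq x y"
  then obtain m :: int where "kdot k x - kdot k y = of_int m"
    using kdot_lattice_eq Ints_cases by metis
  then have "2 * pi * kdot k x + \<alpha> = (2 * pi * kdot k y + \<alpha>) + 2 * pi * of_int m"
    by (simp add: algebra_simps)
  then show "cos (2 * pi * kdot k x + \<alpha>) = cos (2 * pi * kdot k y + \<alpha>)"
    by (simp only: cos_add[of _ "2 * pi * of_int m"] cos_int_2pin sin_int_2pin mult_1_right mult_zero_right diff_zero)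
qed

lemma tcos_proj: "tcos k \<alpha> (torus_proj x) = cos (2 * pi * kdot k x + \<alpha>)"
  by transfer simp

lemma continuous_on_torusI:
  fixes f :: "'n::finite torus \<Rightarrow> 'b::topological_space"
  assumes "continuous_on UNIV (\<lambda>x. f (torus_proj x))"
  shows "continuous_on UNIV f"
proof -
  have "open (f -` U)" if "open U" for U
  proof -
    have "open ((\<lambda>x. f (torus_proj x)) -` U)"
      using open_vimage[OF that assms] .
    then show ?thesis unfolding open_torus_iff vimage_def by simp
  qed
  then show ?thesis by (simp add: continuous_on_open_vimage[OF open_UNIV])
qed

lemma continuous_tcos: "continuous_on A (tcos k \<alpha>)"
proof -
  have "continuous_on UNIV (tcos k \<alpha>)"
    by (rule continuous_on_torusI) (simp only: tcos_proj, intro continuous_intros)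
  then show ?thesis by (rule continuous_on_subset) simp
qed

lemma torus_proj_cube: "torus_proj ` cbox 0 1 = UNIV"
proof -
  have "X \<in> torus_proj ` cbox 0 1" for X :: "'n::finite torus"
  proof -
    obtain x where x: "X = torus_proj x" by (rule torus_proj_cases)
    define y where "y = (\<chi> i. frac (x $ i))"
    have "lattice_eq y x" unfolding lattice_eq_def y_def by (simp add: frac_def)
    then have "X = torus_proj y" unfolding x torus_proj_eq_iff by (rule lattice_eq_sym)
    moreover have "y \<in> cbox 0 1"
      unfolding y_def mem_box_cart by (simp add: frac_lt_1 less_imp_le)
    ultimately show ?thesis by blast
  qed
  then show ?thesis by blast
qed

lemma compact_torus: "compact (UNIV :: 'n::finite torus set)"
  unfolding torus_proj_cube[symmetric] by (intro compact_continuous_image continuous_on_torus_proj compact_cbox)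

inductive_set trig_polys :: "('n::finite torus \<Rightarrow> real) set" where
  gen: "(\<lambda>X. c * tcos k \<alpha> X) \<in> trig_polys"
| add: "f \<in> trig_polys \<Longrightarrow> g \<in> trig_polys \<Longrightarrow> (\<lambda>X. f X + g X) \<in> trig_polys"

lemma tcos_mult: "tcos k \<alpha> X * tcos l \<beta> X = 1/2 * tcos (k - l) (\<alpha> - \<beta>) X + 1/2 * tcos (k + l) (\<alpha> + \<beta>) X"
proof -
  obtain x where x: "X = torus_proj x" by (rule torus_proj_cases)
  show ?thesis
    unfolding x tcos_proj cos_times_cos kdot_diff_left kdot_add_left by (simp add: algebra_simps)
qed

lemma trig_polys_mult: "f \<in> trig_polys \<Longrightarrow> g \<in> trig_polys \<Longrightarrow> (\<lambda>X. f X * g X) \<in> trig_polys"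
proof (induction f rule: trig_polys.induct)
  case (gen c k \<alpha>)
  then show ?case
  proof (induction g rule: trig_polys.induct)
    case (gen d l \<beta>)
    have "(\<lambda>X. c * tcos k \<alpha> X * (d * tcos l \<beta> X)) =
        (\<lambda>X. (c * d / 2) * tcos (k - l) (\<alpha> - \<beta>) X + (c * d / 2) * tcos (k + l) (\<alpha> + \<beta>) X)"
      using tcos_mult[of k \<alpha> _ l \<beta>] by (simp add: fun_eq_iff algebra_simps)
    then show ?case by (simp only:) (intro trig_polys.intros)
  next
    case (add g h)
    then show ?case by (simp only: distrib_left) (rule trig_polys.add)
  qed
next
  case (add f h)
  have "(\<lambda>X. f X * g X + h X * g X) \<in> trig_polys"
    by (intro trig_polys.add add.IH add.prems)
  then show ?case by (simp only: distrib_right)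
qed

lemma continuous_trig_polys: "f \<in> trig_polys \<Longrightarrow> continuous_on A f"
  by (induction f rule: trig_polys.induct) (auto intro!: continuous_intros continuous_tcos)

lemma trig_polys_ring: "function_ring_on (trig_polys :: ('n::finite torus \<Rightarrow> real) set) UNIV"
proof
  show "compact (UNIV :: 'n torus set)" by (rule compact_torus)
  show "(\<lambda>_ :: 'n torus. c) \<in> trig_polys" for c
  proof -
    have "(\<lambda>X. c * tcos 0 0 X) = (\<lambda>_ :: 'n torus. c)"
    proof
      fix X :: "'n torus"
      obtain x where "X = torus_proj x" by (rule torus_proj_cases)
      then show "c * tcos 0 0 X = c" by (simp add: tcos_proj)
    qed
    then show ?thesis using trig_polys.gen[of c "0 :: int^'n" 0] by (simp only:)
  qed
next
  fix X Y :: "'n torus" assume "X \<noteq> Y"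
  obtain x where x: "X = torus_proj x" by (rule torus_proj_cases)
  obtain y where y: "Y = torus_proj y" by (rule torus_proj_cases)
  obtain i where i: "x $ i - y $ i \<notin> \<int>"
    using \<open>X \<noteq> Y\<close> unfolding x y torus_proj_eq_iff lattice_eq_def by blast
  define k :: "int^'n" where "k = axis i 1"
  have kx: "kdot k z = z $ i" for z
    unfolding kdot_def k_def axis_def by (simp add: if_distrib if_distribR cong: if_cong)
  \<comment> \<open>With this phase the function attains its maximum 1 at X, and at Y only if the
    i-th coordinates are congruent.\<close>
  define \<alpha> where "\<alpha> = - (2 * pi * x $ i)"
  have "tcos k \<alpha> X = 1" unfolding x tcos_proj kx \<alpha>_def by simp
  moreover have "tcos k \<alpha> Y \<noteq> 1"
  proof
    assume "tcos k \<alpha> Y = 1"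
    then have "cos (2 * pi * (y $ i - x $ i)) = 1"
      unfolding y tcos_proj kx \<alpha>_def by (simp add: algebra_simps)
    then obtain m :: int where "2 * pi * (y $ i - x $ i) = of_int m * 2 * pi"
      unfolding cos_one_2pi_int by blast
    then have "2 * pi * (y $ i - x $ i) = 2 * pi * of_int m" by simp
    then have "y $ i - x $ i = of_int m" by (simp only: mult_cancel_left) simp
    then have "x $ i - y $ i = of_int (- m)" by simp
    then show False using i by (metis Ints_of_int)
  qed
  ultimately show "\<exists>f\<in>trig_polys. f X \<noteq> f Y"
    by (intro bexI[OF _ trig_polys.gen[of 1 k \<alpha>]]) simp
qed (auto intro: continuous_trig_polys trig_polys.add trig_polys_mult)

interpretation haar: finite_measure "haar_torus :: 'n::finite torus measure"
proof (rule finite_measureI)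
  have "space (haar_torus :: 'n torus measure) = UNIV" unfolding haar_torus_def by simp
  then show "emeasure haar_torus (space (haar_torus :: 'n torus measure)) \<noteq> \<infinity>"
    by (simp add: emeasure_haar_torus_UNIV)
qed

lemma measurable_haar_continuous:
  "continuous_on UNIV f \<Longrightarrow> f \<in> borel_measurable haar_torus"
  unfolding haar_torus_def by (simp add: borel_measurable_continuous_onI)

lemma integrable_haar_continuous:
  fixes f :: "'n::finite torus \<Rightarrow> 'b::{banach, second_countable_topology}"
  assumes "continuous_on UNIV f"
  shows "integrable haar_torus f"
proof -
  have "bounded (range f)"
    using compact_continuous_image[OF assms compact_torus] by (rule compact_imp_bounded)
  then obtain B where "\<forall>X. norm (f X) \<le> B" unfolding bounded_iff by auto
  then show ?thesis
    using measurable_haar_continuous[OF assms] by (intro haar.integrable_const_bound[where B = B]) auto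
qed

lemma integral_haar:
  fixes f :: "'n::finite torus \<Rightarrow> 'b::{banach, second_countable_topology}"
  assumes "continuous_on UNIV f"
  shows "integral\<^sup>L haar_torus f = (\<integral>x. f (torus_proj x) \<partial>cube_measure)"
  unfolding haar_torus_def
  by (rule integral_distr[OF torus_proj_measurable borel_measurable_continuous_onI[OF assms]])

lemma measure_haar: "measure (haar_torus :: 'n::finite torus measure) UNIV = 1"
  by (simp add: measure_def emeasure_haar_torus_UNIV)

lemma space_haar [simp]: "space haar_torus = UNIV"
  unfolding haar_torus_def by simp

lemma tcos_proj_Re: "tcos k \<alpha> (torus_proj x) = Re (cis \<alpha> * cis (2 * pi * kdot k x))"
  by (simp add: tcos_proj cis_mult add.commute)

lemma integral_tcos:
  fixes k :: "int^'n::finite"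
  shows "integral\<^sup>L haar_torus (tcos k \<alpha>) = (if k = 0 then cos \<alpha> else 0)"
proof (cases "k = 0")
  case True
  have "tcos 0 \<alpha> X = cos \<alpha>" for X :: "'n torus"
    by (rule torus_proj_cases[of X]) (simp add: tcos_proj)
  then have "tcos 0 \<alpha> = (\<lambda>_ :: 'n torus. cos \<alpha>)" by (rule ext)
  then have "integral\<^sup>L haar_torus (tcos (0 :: int^'n) \<alpha>) = integral\<^sup>L (haar_torus :: 'n torus measure) (\<lambda>_. cos \<alpha>)"
    by (simp only:)
  also have "\<dots> = cos \<alpha>" by (simp add: measure_haar)
  finally show ?thesis using True by simp
next
  case False
  have int: "integrable cube_measure (\<lambda>x. cis (2 * pi * kdot k x))"
    by (rule integrable_cube_bounded[where B = 1]) (intro continuous_intros, simp)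
  have "integral\<^sup>L haar_torus (tcos k \<alpha>) = (\<integral>x. Re (cis \<alpha> * cis (2 * pi * kdot k x)) \<partial>cube_measure)"
    unfolding integral_haar[OF continuous_tcos] tcos_proj_Re ..
  also have "\<dots> = Re (\<integral>x. cis \<alpha> * cis (2 * pi * kdot k x) \<partial>cube_measure)"
    by (rule integral_Re) (intro integrable_mult_right int)
  also have "\<dots> = 0" by (simp add: integral_character_eq_0[OF False])
  finally show ?thesis using False by simp
qed

lemma torus_map_funpow: "(torus_map S ^^ n) (torus_proj x) = torus_proj (orbit (rmat S) x n)"
  by (induction n) (simp_all add: torus_map_proj)

lemma averages_trig_polys:
  assumes x: "x \<in> weyl_points S" and f: "f \<in> trig_polys"
  shows "(\<lambda>N. (\<Sum>n<N. f ((torus_map S ^^ n) (torus_proj x))) / real N) \<longlonglongrightarrow> integral\<^sup>L haar_torus f"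
  using f
proof (induction f rule: trig_polys.induct)
  case (gen c k \<alpha>)
  have "(\<lambda>N. (\<Sum>n<N. tcos k \<alpha> ((torus_map S ^^ n) (torus_proj x))) / real N) \<longlonglongrightarrow> (if k = 0 then cos \<alpha> else 0)"
  proof (cases "k = 0")
    case True
    have "\<forall>\<^sub>F N in sequentially. (\<Sum>n<N. tcos k \<alpha> ((torus_map S ^^ n) (torus_proj x))) / real N = cos \<alpha>"
      using eventually_gt_at_top[of "0::nat"]
      by eventually_elim (simp add: True torus_map_funpow tcos_proj)
    then show ?thesis using True by (simp add: tendsto_eventually)
  next
    case False
    let ?A = "\<lambda>N. (\<Sum>n<N. cis (2 * pi * kdot k (orbit (rmat S) x n))) / of_nat N"
    have "?A \<longlonglongrightarrow> 0" using x False unfolding weyl_points_def by blast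
    then have "(\<lambda>N. Re (cis \<alpha> * ?A N)) \<longlonglongrightarrow> Re (cis \<alpha> * 0)" by (intro tendsto_intros)
    moreover have "(\<Sum>n<N. tcos k \<alpha> ((torus_map S ^^ n) (torus_proj x))) / real N = Re (cis \<alpha> * ?A N)" for N
    proof -
      have "cis \<alpha> * ?A N = (\<Sum>n<N. cis \<alpha> * cis (2 * pi * kdot k (orbit (rmat S) x n))) / complex_of_real (real N)"
        by (simp add: sum_distrib_left)
      then show ?thesis unfolding torus_map_funpow tcos_proj_Re
        by (simp only: Re_divide_of_real Re_sum)
    qed
    ultimately have "(\<lambda>N. (\<Sum>n<N. tcos k \<alpha> ((torus_map S ^^ n) (torus_proj x))) / real N) \<longlonglongrightarrow> Re (cis \<alpha> * 0)"
      by (simp only:)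
    then show ?thesis using False by simp
  qed
  then have "(\<lambda>N. c * ((\<Sum>n<N. tcos k \<alpha> ((torus_map S ^^ n) (torus_proj x))) / real N)) \<longlonglongrightarrow>
      c * integral\<^sup>L haar_torus (tcos k \<alpha>)"
    unfolding integral_tcos by (intro tendsto_intros)
  then show ?case by (simp add: sum_distrib_left)
next
  case (add f g)
  have "integrable haar_torus f" "integrable haar_torus g"
    using add.hyps by (auto intro: integrable_haar_continuous continuous_trig_polys)
  then have "integral\<^sup>L haar_torus (\<lambda>X. f X + g X) = integral\<^sup>L haar_torus f + integral\<^sup>L haar_torus g" by simp
  then show ?case using tendsto_add[OF add.IH] by (simp add: sum.distrib add_divide_distrib)
qed

lemma averages_continuous:
  fixes f :: "'n::finite torus \<Rightarrow> real"
  assumes x: "x \<in> weyl_points S" and f: "continuous_on UNIV f"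
  shows "(\<lambda>N. (\<Sum>n<N. f ((torus_map S ^^ n) (torus_proj x))) / real N) \<longlonglongrightarrow> integral\<^sup>L haar_torus f"
proof (rule LIMSEQ_I)
  fix \<epsilon> :: real assume \<epsilon>: "\<epsilon> > 0"
  obtain g where g: "g \<in> trig_polys" and close: "\<forall>X\<in>UNIV. \<bar>f X - g X\<bar> < \<epsilon> / 4"
    using function_ring_on.Stone_Weierstrass_basic[OF trig_polys_ring f, of "\<epsilon> / 4"] \<epsilon> by auto
  let ?O = "\<lambda>n. (torus_map S ^^ n) (torus_proj x)"
  have "integral\<^sup>L haar_torus f - integral\<^sup>L haar_torus g = integral\<^sup>L haar_torus (\<lambda>X. f X - g X)"
    using integrable_haar_continuous[OF f] integrable_haar_continuous[OF continuous_trig_polys[OF g]] by simp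
  also have "\<bar>\<dots>\<bar> \<le> integral\<^sup>L haar_torus (\<lambda>X. \<bar>f X - g X\<bar>)"
    by (rule integral_abs_bound)
  also have "\<dots> \<le> integral\<^sup>L (haar_torus :: 'n torus measure) (\<lambda>_. \<epsilon> / 4)"
    using close less_imp_le
    by (intro integral_mono integrable_haar_continuous continuous_intros f continuous_trig_polys g) auto
  also have "\<dots> = \<epsilon> / 4" by (simp add: measure_haar)
  finally have int: "\<bar>integral\<^sup>L haar_torus f - integral\<^sup>L haar_torus g\<bar> \<le> \<epsilon> / 4" .
  have avg: "\<bar>(\<Sum>n<N. f (?O n)) / real N - (\<Sum>n<N. g (?O n)) / real N\<bar> \<le> \<epsilon> / 4" for N
  proof (cases "N = 0")
    case False
    have "\<bar>\<Sum>n<N. f (?O n) - g (?O n)\<bar> \<le> real (card {..<N}) * (\<epsilon> / 4)"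
      using close by (intro sum_norm_bound[of "{..<N}" "\<lambda>n. f (?O n) - g (?O n)", unfolded real_norm_def]) (simp add: less_imp_le)
    then have "\<bar>\<Sum>n<N. f (?O n) - g (?O n)\<bar> / real N \<le> \<epsilon> / 4"
      using False by (simp add: divide_le_eq mult.commute)
    then show ?thesis by (simp add: sum_subtractf diff_divide_distrib[symmetric])
  qed (use \<epsilon> in auto)
  obtain no where no: "\<forall>N\<ge>no. norm ((\<Sum>n<N. g (?O n)) / real N - integral\<^sup>L haar_torus g) < \<epsilon> / 4"
    using LIMSEQ_D[OF averages_trig_polys[OF x g], of "\<epsilon> / 4"] \<epsilon> by auto
  have "norm ((\<Sum>n<N. f (?O n)) / real N - integral\<^sup>L haar_torus f) < \<epsilon>" if "N \<ge> no" for N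
  proof -
    have "\<bar>(\<Sum>n<N. g (?O n)) / real N - integral\<^sup>L haar_torus g\<bar> < \<epsilon> / 4" using no that by simp
    then show ?thesis using avg[of N] int \<epsilon> unfolding real_norm_def by linarith
  qed
  then show "\<exists>no. \<forall>N\<ge>no. norm ((\<Sum>n<N. f (?O n)) / real N - integral\<^sup>L haar_torus f) < \<epsilon>" by blast
qed

lemma weyl_points_equidistributed:
  fixes S :: "int^'n::finite^'n"
  assumes x: "x \<in> weyl_points S"
  shows "torus_proj x \<in> equidistributed_points (torus_map S)"
  unfolding equidistributed_points_def
proof (intro CollectI allI impI)
  fix f :: "'n torus \<Rightarrow> complex" assume f: "continuous_on UNIV f"
  let ?O = "\<lambda>n. (torus_map S ^^ n) (torus_proj x)"
  have cont: "continuous_on UNIV (\<lambda>X. Re (f X))" "continuous_on UNIV (\<lambda>X. Im (f X))"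
    using f by (auto intro: continuous_on_Re continuous_on_Im)
  have int: "integrable haar_torus f" by (rule integrable_haar_continuous[OF f])
  have "(\<lambda>N. Complex ((\<Sum>n<N. Re (f (?O n))) / real N) ((\<Sum>n<N. Im (f (?O n))) / real N)) \<longlonglongrightarrow>
      Complex (integral\<^sup>L haar_torus (\<lambda>X. Re (f X))) (integral\<^sup>L haar_torus (\<lambda>X. Im (f X)))"
    by (intro tendsto_Complex averages_continuous x cont)
  moreover have "Complex (integral\<^sup>L haar_torus (\<lambda>X. Re (f X))) (integral\<^sup>L haar_torus (\<lambda>X. Im (f X))) = integral\<^sup>L haar_torus f"
    using integral_Re[OF int] integral_Im[OF int] by (simp add: complex_eq_iff)
  moreover have "Complex ((\<Sum>n<N. Re (f (?O n))) / real N) ((\<Sum>n<N. Im (f (?O n))) / real N) = (\<Sum>n<N. f (?O n)) / of_nat N" for N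
    by (simp add: complex_eq_iff Re_divide_of_nat Im_divide_of_nat)
  ultimately show "(\<lambda>N. (\<Sum>n<N. f (?O n)) / of_nat N) \<longlonglongrightarrow> integral\<^sup>L haar_torus f" by simp
qed

section \<open>Hausdorff measure on the torus\<close>

lemma hausdorff_premeasure_le:
  assumes "A \<subseteq> (\<Union>i. U i)" "\<And>i. bounded (U i) \<and> diameter (U i) \<le> \<delta>"
  shows "hausdorff_premeasure s \<delta> A \<le> (\<Sum>i. diam_pow s (U i))"
  unfolding hausdorff_premeasure_def using assms by (intro Inf_lower) blast

lemma diameter_torus_proj_cbox:
  fixes a :: "real^'n::finite"
  assumes "h \<ge> 0"
  shows "bounded (torus_proj ` cbox a (a + (\<chi> i. h)))"
    and "diameter (torus_proj ` cbox a (a + (\<chi> i. h))) \<le> real CARD('n) * h"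
proof -
  have d: "dist X Y \<le> real CARD('n) * h"
    if XY: "X \<in> torus_proj ` cbox a (a + (\<chi> i. h))" "Y \<in> torus_proj ` cbox a (a + (\<chi> i. h))" for X Y
  proof -
    obtain x where x: "X = torus_proj x" "x \<in> cbox a (a + (\<chi> i. h))" using XY(1) by blast
    obtain y where y: "Y = torus_proj y" "y \<in> cbox a (a + (\<chi> i. h))" using XY(2) by blast
    have "dist X Y \<le> dist x y" unfolding x(1) y(1) by (rule dist_torus_proj_le)
    also have "\<dots> \<le> (\<Sum>i\<in>UNIV. \<bar>(x - y) $ i\<bar>)" unfolding dist_norm by (rule norm_le_l1_cart)
    also have "\<dots> \<le> (\<Sum>i\<in>(UNIV::'n set). h)"
    proof (rule sum_mono)
      fix i
      have "a $ i \<le> x $ i \<and> x $ i \<le> a $ i + h" "a $ i \<le> y $ i \<and> y $ i \<le> a $ i + h"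
        using x(2) y(2) unfolding mem_box_cart by auto
      then show "\<bar>(x - y) $ i\<bar> \<le> h" unfolding vector_minus_component by linarith
    qed
    finally show ?thesis by simp
  qed
  then show "bounded (torus_proj ` cbox a (a + (\<chi> i. h)))"
    unfolding bounded_two_points by blast
  show "diameter (torus_proj ` cbox a (a + (\<chi> i. h))) \<le> real CARD('n) * h"
    unfolding diameter_def using d assms by (auto intro!: cSUP_least)
qed

lemma diam_pow_le:
  assumes "s > 0" "bounded U" "diameter U \<le> D"
  shows "diam_pow s U \<le> ennreal (D powr s)"
  unfolding diam_pow_def using assms diameter_ge_0[OF assms(2)]
  by (auto intro!: ennreal_leI powr_mono2)

text \<open>The M^d boxes of side 1 / M have total gauge at most d^s M^(d-s), which tends to
  zero.\<close>

lemma hausdorff_measure_torus_eq_0: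
  fixes A :: "'n::finite torus set"
  assumes s: "s > real CARD('n)"
  shows "hausdorff_measure s A = 0"
proof -
  let ?d = "real CARD('n)"
  have d: "?d > 0" by simp
  have s0: "s > 0" using s d by linarith
  have "hausdorff_premeasure s \<delta> A \<le> ennreal \<epsilon>" if \<delta>: "\<delta> > 0" and \<epsilon>: "\<epsilon> > 0" for \<delta> \<epsilon>
  proof -
    have lim: "((\<lambda>M::nat. ?d powr s * real M powr (?d - s)) \<longlongrightarrow> ?d powr s * 0) sequentially"
      using s by (intro tendsto_intros tendsto_neg_powr filterlim_real_sequentially) auto
    then have "\<forall>\<^sub>F M::nat in sequentially. ?d powr s * real M powr (?d - s) < \<epsilon>"
      using order_tendstoD(2)[OF lim, of \<epsilon>] \<epsilon> by simp
    moreover have "\<forall>\<^sub>F M::nat in sequentially. real M > ?d / \<delta>"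
      using filterlim_real_sequentially by (simp add: filterlim_at_top_dense)
    ultimately have "\<forall>\<^sub>F M::nat in sequentially. ?d powr s * real M powr (?d - s) < \<epsilon> \<and> real M > ?d / \<delta>"
      by (rule eventually_conj)
    then obtain M :: nat where M: "?d powr s * real M powr (?d - s) < \<epsilon>" "real M > ?d / \<delta>"
      unfolding eventually_sequentially by blast
    have M0: "real M > 0" using M(2) d \<delta> by (smt (verit) divide_pos_pos)
    have M\<delta>: "?d * (1 / real M) \<le> \<delta>" using M(2) M0 \<delta> by (simp add: field_simps)
    define P where "P = PiE (UNIV :: 'n set) (\<lambda>_. {..<M})"
    have P: "finite P" "card P = M ^ CARD('n)" unfolding P_def by (auto simp: card_PiE intro!: finite_PiE)
    define box where "box p = torus_proj ` cbox (\<chi> i. real (p i) / real M) ((\<chi> i. real (p i) / real M) + (\<chi> i. 1 / real M))"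
      for p :: "'n \<Rightarrow> nat"
    obtain e where e: "bij_betw e {0..<card P} P" using ex_bij_betw_nat_finite[OF P(1)] by blast
    define U where "U i = (if i < card P then box (e i) else {})" for i
    have box: "bounded (box p)" "diameter (box p) \<le> ?d * (1 / real M)" for p
      unfolding box_def using M0 by (intro diameter_torus_proj_cbox; simp)+
    have cover: "X \<in> (\<Union>i. U i)" for X
    proof -
      have "X \<in> torus_proj ` cbox 0 1" unfolding torus_proj_cube by simp
      then obtain x where x: "X = torus_proj x" "\<forall>i. 0 \<le> x $ i \<and> x $ i \<le> 1"
        by (auto simp: mem_box_cart)
      \<comment> \<open>The minimum serves coordinates equal to one, which belong to the last closed
        box.\<close>
      define p where "p i = min (nat \<lfloor>x $ i * real M\<rfloor>) (M - 1)" for i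
      have pM: "p i < M" for i using M0 unfolding p_def by auto
      have pi: "real (p i) \<le> x $ i * real M \<and> x $ i * real M \<le> real (p i) + 1" for i
      proof -
        have xi: "0 \<le> x $ i * real M" "x $ i * real M \<le> real M"
          using x(2) M0 by (auto simp: mult_left_le_one_le)
        have f: "real (nat \<lfloor>x $ i * real M\<rfloor>) \<le> x $ i * real M" using xi by (simp add: of_nat_floor)
        show ?thesis
        proof (cases "nat \<lfloor>x $ i * real M\<rfloor> \<le> M - 1")
          case True
          then have "p i = nat \<lfloor>x $ i * real M\<rfloor>" unfolding p_def by simp
          moreover have "x $ i * real M \<le> real (nat \<lfloor>x $ i * real M\<rfloor>) + 1" using xi by linarith
          ultimately show ?thesis using f by simp
        next
          case False
          then have p: "p i = M - 1" unfolding p_def by auto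
          have "real (M - 1) \<le> real (nat \<lfloor>x $ i * real M\<rfloor>)"
            using False by (simp only: of_nat_le_iff)
          moreover have "real M = real (M - 1) + 1" using M0 by simp
          ultimately show ?thesis unfolding p using f xi by linarith
        qed
      qed
      have "x \<in> cbox (\<chi> i. real (p i) / real M) ((\<chi> i. real (p i) / real M) + (\<chi> i. 1 / real M))"
        unfolding mem_box_cart
      proof (intro allI conjI)
        fix i
        show "(\<chi> i. real (p i) / real M) $ i \<le> x $ i"
          using pi[of i] M0 by (simp add: divide_le_eq)
        show "x $ i \<le> ((\<chi> i. real (p i) / real M) + (\<chi> i. 1 / real M)) $ i"
          using pi[of i] M0 by (simp add: add_divide_distrib[symmetric] le_divide_eq)
      qed
      then have "X \<in> box p" unfolding box_def x by blast
      moreover have "p \<in> P" unfolding P_def using pM by auto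
      then obtain i where "i < card P" "e i = p"
        using bij_betw_imp_surj_on[OF e] by (metis imageE atLeastLessThan_iff)
      ultimately show ?thesis unfolding U_def by auto
    qed
    have U: "bounded (U i) \<and> diameter (U i) \<le> \<delta>" for i
      unfolding U_def using box[of "e i"] M\<delta> \<delta> by (auto intro: order_trans)
    have "hausdorff_premeasure s \<delta> A \<le> (\<Sum>i. diam_pow s (U i))"
      using cover U by (intro hausdorff_premeasure_le) auto
    also have "\<dots> = (\<Sum>i<card P. diam_pow s (U i))"
      by (intro suminf_finite) (auto simp: U_def diam_pow_def)
    also have "\<dots> \<le> (\<Sum>i<card P. ennreal ((?d * (1 / real M)) powr s))"
      using box s0 by (intro sum_mono) (auto simp: U_def intro!: diam_pow_le)
    also have "\<dots> = ennreal (real (card P) * (?d * (1 / real M)) powr s)"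
      by (simp add: ennreal_mult ennreal_of_nat_eq_real_of_nat)
    also have "real (card P) * (?d * (1 / real M)) powr s = ?d powr s * real M powr (?d - s)"
    proof -
      have "real (card P) = real M powr ?d" unfolding P(2) using M0 by (simp add: powr_realpow)
      moreover have "(?d * (1 / real M)) powr s = ?d powr s * (1 / real M powr s)"
        using M0 d by (simp only: powr_mult powr_divide powr_one_eq_one)
      moreover have "real M powr (?d - s) = real M powr ?d / real M powr s" by (rule powr_diff)
      ultimately show ?thesis by simp
    qed
    also have "ennreal \<dots> \<le> ennreal \<epsilon>" using M(1) by (intro ennreal_leI) simp
    finally show ?thesis .
  qed
  then have le: "hausdorff_premeasure s \<delta> A \<le> 0" if "\<delta> > 0" for \<delta>
    using that by (intro ennreal_le_epsilon[of 0]) (simp only: add_0)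
  have "hausdorff_measure s A \<le> 0"
    unfolding hausdorff_measure_def by (intro SUP_least le) simp
  then show ?thesis by simp
qed

lemma hausdorff_dim_torus_le:
  fixes A :: "'n::finite torus set"
  shows "hausdorff_dim A \<le> of_nat CARD('n)"
proof -
  have "hausdorff_dim A \<le> of_nat CARD('n) + ennreal \<epsilon>" if "\<epsilon> > 0" for \<epsilon>
  proof -
    let ?s = "real CARD('n) + \<epsilon>"
    have "hausdorff_measure ?s A = 0" using that by (intro hausdorff_measure_torus_eq_0) simp
    then have "ennreal ?s \<in> {ennreal s | s. s \<ge> 0 \<and> hausdorff_measure s A = 0}"
      using that by (intro CollectI exI[of _ ?s]) simp
    then have "hausdorff_dim A \<le> ennreal ?s" unfolding hausdorff_dim_def by (rule Inf_lower)
    then show ?thesis using that by (simp add: ennreal_of_nat_eq_real_of_nat)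
  qed
  then show ?thesis by (rule ennreal_le_epsilon)
qed

text \<open>Diameters at most one allow the exponent to be raised from s to s'. A nonempty covering
  set lies in the ball around any of its points with its diameter as radius; radii are enlarged
  slightly because diameters may vanish.\<close>

lemma hausdorff_null_ball_cover:
  fixes E :: "'a::metric_space set"
  assumes null: "hausdorff_measure s E = 0" and s: "0 \<le> s" "s \<le> s'" "0 < s'"
    and \<epsilon>: "0 < \<epsilon>" "\<epsilon> \<le> 1"
  obtains X r where "\<forall>i::nat. 0 < r i" "\<forall>i. r i \<le> 1" "E \<subseteq> (\<Union>i. cball (X i) (r i))"
    "(\<Sum>i. ennreal (r i powr s')) \<le> ennreal \<epsilon>"
proof -
  have "hausdorff_premeasure s 1 E \<le> hausdorff_measure s E"
    unfolding hausdorff_measure_def by (intro SUP_upper) auto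
  then have "hausdorff_premeasure s 1 E < ennreal (\<epsilon> / 2)" using null \<epsilon> by simp
  then obtain z where z: "z < ennreal (\<epsilon> / 2)" "z \<in> {(\<Sum>i. diam_pow s (U i)) | U :: nat \<Rightarrow> 'a set.
            E \<subseteq> (\<Union>i. U i) \<and> (\<forall>i. bounded (U i) \<and> diameter (U i) \<le> 1)}"
    unfolding hausdorff_premeasure_def by (subst (asm) Inf_less_iff) (elim bexE, rule that)
  from z(2) obtain U :: "nat \<Rightarrow> 'a set" where zU: "z = (\<Sum>i. diam_pow s (U i))" and U0: "E \<subseteq> (\<Union>i. U i)"
    and U': "\<forall>i. bounded (U i) \<and> diameter (U i) \<le> 1" by blast
  have U: "E \<subseteq> (\<Union>i. U i)" "bounded (U i)" "diameter (U i) \<le> 1" for i using U0 U' by blast+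
  have sum: "(\<Sum>i. diam_pow s (U i)) < ennreal (\<epsilon> / 2)" using z(1) unfolding zU .
  define X where "X i = (SOME x. x \<in> U i)" for i
  \<comment> \<open>Geometric shares of \<epsilon> / 2 pay for the enlargement of the radii; the
    cover itself uses the other half.\<close>
  define q where "q i = (\<epsilon> / 2) * (1 / 2) ^ Suc i" for i
  define r where "r i = (if U i = {} then q i powr (1 / s') else max (diameter (U i)) (q i powr (1 / s')))" for i
  have q: "q i > 0" for i unfolding q_def using \<epsilon> by simp
  have qp: "(q i powr (1 / s')) powr s' = q i" for i using q[of i] s(3) by (simp add: powr_powr)
  have rpos: "0 < r i" for i
  proof -
    have "0 < q i powr (1 / s')" using q[of i] by simp
    then show ?thesis unfolding r_def by (simp add: less_max_iff_disj)
  qed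
  have rle: "ennreal (r i powr s') \<le> diam_pow s (U i) + ennreal (q i)" for i
  proof (cases "U i = {}")
    case False
    let ?D = "diameter (U i)"
    have D: "0 \<le> ?D" "?D \<le> 1" using diameter_ge_0[OF U(2)] U(3) by auto
    have "r i powr s' \<le> ?D powr s' + q i"
    proof (cases "q i powr (1 / s') \<le> ?D")
      case True
      then show ?thesis using False q[of i] unfolding r_def by (simp add: max_absorb1)
    next
      case False
      then show ?thesis using \<open>U i \<noteq> {}\<close> qp[of i] unfolding r_def by (simp add: max_absorb2)
    qed
    then have "ennreal (r i powr s') \<le> ennreal (?D powr s' + q i)" by (rule ennreal_leI)
    also have "\<dots> = ennreal (?D powr s') + ennreal (q i)"
      using q[of i] by (intro ennreal_plus) auto
    finally have 1: "ennreal (r i powr s') \<le> ennreal (?D powr s') + ennreal (q i)" .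
    have 2: "ennreal (?D powr s') \<le> diam_pow s (U i)"
    proof (cases "s = 0")
      case True
      then show ?thesis using False D s(3) unfolding diam_pow_def by (simp add: powr_le1)
    next
      case False
      then show ?thesis using \<open>U i \<noteq> {}\<close> D s unfolding diam_pow_def
        by (auto intro!: ennreal_leI powr_mono')
    qed
    show ?thesis by (rule order_trans[OF 1 add_right_mono[OF 2]])
  qed (simp add: r_def qp)
  have "(\<Sum>i. ennreal (r i powr s')) \<le> (\<Sum>i. diam_pow s (U i) + ennreal (q i))"
    by (intro suminf_le rle) auto
  also have "\<dots> = (\<Sum>i. diam_pow s (U i)) + (\<Sum>i. ennreal (q i))"
    by (intro suminf_add[symmetric]) auto
  also have "(\<Sum>i. ennreal (q i)) = ennreal (\<epsilon> / 2)"
  proof (rule suminf_ennreal_eq)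
    show "0 \<le> q i" for i using q[of i] by simp
    show "q sums (\<epsilon> / 2)"
      using sums_mult[OF power_half_series, of "\<epsilon> / 2"] unfolding q_def by simp
  qed
  also have "(\<Sum>i. diam_pow s (U i)) + ennreal (\<epsilon> / 2) \<le> ennreal (\<epsilon> / 2) + ennreal (\<epsilon> / 2)"
    using sum by (intro add_right_mono less_imp_le)
  also have "\<dots> = ennreal (\<epsilon> / 2 + \<epsilon> / 2)" using \<epsilon> by (intro ennreal_plus[symmetric]) auto
  also have "\<epsilon> / 2 + \<epsilon> / 2 = \<epsilon>" by simp
  finally have total: "(\<Sum>i. ennreal (r i powr s')) \<le> ennreal \<epsilon>" .
  \<comment> \<open>A single term of the sum is at most \<epsilon> \<le> 1.\<close>
  have r1: "r i \<le> 1" for i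
  proof (rule ccontr)
    assume "\<not> r i \<le> 1"
    then have "1 powr s' < r i powr s'" using s(3) by (intro powr_less_mono2) auto
    then have gt: "1 < r i powr s'" by (simp only: powr_one_eq_one)
    have "(\<Sum>j\<in>{i}. ennreal (r j powr s')) \<le> (\<Sum>i. ennreal (r i powr s'))"
      by (rule sum_le_suminf) simp_all
    then have "ennreal (r i powr s') \<le> (\<Sum>i. ennreal (r i powr s'))" by (simp only: sum.insert sum.empty finite.emptyI empty_iff add_0_right simp_thms)
    then have "ennreal (r i powr s') \<le> ennreal \<epsilon>" using total by (rule order_trans)
    then have "r i powr s' \<le> \<epsilon>" using \<epsilon>(1) by (subst (asm) ennreal_le_iff) auto
    then show False using \<epsilon>(2) gt by linarith
  qed
  have cover: "E \<subseteq> (\<Union>i. cball (X i) (r i))"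
  proof
    fix x assume "x \<in> E"
    then obtain i where i: "x \<in> U i" using U(1) by blast
    then have "X i \<in> U i" unfolding X_def by (rule someI)
    then have "dist (X i) x \<le> diameter (U i)" using i by (intro diameter_bounded_bound U)
    also have "\<dots> \<le> r i" using i unfolding r_def by auto
    finally show "x \<in> (\<Union>i. cball (X i) (r i))" by auto
  qed
  show ?thesis using rpos r1 by (intro that[OF _ _ cover total]) auto
qed

section \<open>Lifts to the unit cube and the measure of balls and tubes\<close>

definition rvec :: "int^'n \<Rightarrow> real^'n" where "rvec m = (\<chi> i. of_int (m $ i))"

lemma torus_proj_add_rvec [simp]: "torus_proj (x + rvec m) = torus_proj x"
  unfolding torus_proj_eq_iff lattice_eq_def rvec_def by simp

text \<open>The strict inequality lets a point of the fibre be picked although the distance is an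
  infimum. This is why radii are doubled whenever only a bound by r is given.\<close>

lemma dist_torus_less_lift:
  assumes "dist (torus_proj y) (torus_proj c) < r"
  obtains m where "norm (y - (c + rvec m)) < r"
proof -
  have "setdist {y} (torus_fibre (torus_proj c)) < r" using assms by (simp add: dist_torus_proj)
  then obtain y' z where "y' \<in> {y}" "z \<in> torus_fibre (torus_proj c)" "dist y' z < r"
    by (rule setdist_ltE) (use torus_fibre_nonempty in auto)
  then have z: "z \<in> torus_fibre (torus_proj c)" "dist y z < r" by auto
  have "\<forall>i. \<exists>m::int. z $ i - c $ i = of_int m"
    using z(1) unfolding torus_fibre_proj lattice_eq_def by (auto elim: Ints_cases)
  then obtain m :: "_ \<Rightarrow> int" where m: "\<forall>i. z $ i - c $ i = of_int (m i)" by metis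
  then have "\<forall>i. z $ i = c $ i + of_int (m i)" by (simp add: algebra_simps)
  then have "z = c + rvec (\<chi> i. m i)" unfolding rvec_def vec_eq_iff by simp
  then show ?thesis using that[of "\<chi> i. m i"] z(2) unfolding dist_norm by simp
qed

text \<open>The bound 7 covers every lattice translate relating a point within distance 6 of the unit cube to
  the cube.\<close>

definition small_ints :: "(int^'n) set" where
  "small_ints = {m. \<forall>i. \<bar>m $ i\<bar> \<le> 7}"

lemma finite_small_ints: "finite (small_ints :: (int^'n) set)"
proof -
  have "finite (PiE (UNIV::'n set) (\<lambda>_. {-7..7::int}))" by (intro finite_PiE) auto
  then have "finite ((\<lambda>f. \<chi> i. f i) ` PiE (UNIV::'n set) (\<lambda>_. {-7..7::int}))" by (rule finite_imageI)
  moreover have "(small_ints :: (int^'n) set) \<subseteq> (\<lambda>f. \<chi> i. f i) ` PiE (UNIV::'n set) (\<lambda>_. {-7..7::int})"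
  proof
    fix m :: "int^'n" assume "m \<in> small_ints"
    then have "(\<lambda>i. m $ i) \<in> PiE UNIV (\<lambda>_. {-7..7})" unfolding small_ints_def by (auto simp: abs_le_iff minus_le_iff)
    moreover have "m = (\<chi> i. m $ i)" by simp
    ultimately show "m \<in> (\<lambda>f. \<chi> i. f i) ` PiE UNIV (\<lambda>_. {-7..7})" by blast
  qed
  ultimately show ?thesis by (rule finite_subset[rotated])
qed

lemma small_intsI:
  assumes "x \<in> cbox 0 1" "c \<in> cbox 0 1" "norm (x + u - (c + rvec m)) \<le> a" "norm u \<le> b" "a + b \<le> 6"
  shows "m \<in> small_ints"
  unfolding small_ints_def
proof (intro CollectI allI)
  fix i
  have "\<bar>(x + u - (c + rvec m)) $ i\<bar> \<le> a" using component_le_norm_cart assms(3) by (rule order_trans)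
  moreover have "\<bar>u $ i\<bar> \<le> b" using component_le_norm_cart assms(4) by (rule order_trans)
  moreover have "0 \<le> x $ i \<and> x $ i \<le> 1" "0 \<le> c $ i \<and> c $ i \<le> 1" using assms(1,2) by (auto simp: mem_box_cart)
  ultimately have "\<bar>real_of_int (m $ i)\<bar> \<le> 7" using assms(5) unfolding rvec_def by simp linarith
  then show "\<bar>m $ i\<bar> \<le> 7" by linarith
qed

lemma cube_rep: obtains c where "c \<in> cbox 0 1" "X = torus_proj c"
  using torus_proj_cube by blast

text \<open>Base points whose segment in direction w meets a closed ball; for w = 0 it is the ball
  itself, seen in the cube.\<close>

definition tube :: "real^'n::finite \<Rightarrow> 'n torus \<Rightarrow> real \<Rightarrow> (real^'n) set" where
  "tube w X r = {x \<in> cbox 0 1. \<exists>t\<in>{0..1}. dist (torus_proj (x + t *\<^sub>R w)) X \<le> r}"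

lemma tube_0: "tube 0 X r = {x \<in> cbox 0 1. dist (torus_proj x) X \<le> r}"
  unfolding tube_def by auto

text \<open>A doubled radius is at most 6 when r \<le> 3, which is what \<open>small_ints\<close>
  can accommodate; the tube estimate applies this with 3 r.\<close>

lemma emeasure_torus_ball:
  obtains C :: real where "C > 0"
    "\<And>(X :: 'n::finite torus) r. \<lbrakk>0 < r; r \<le> 3\<rbrakk> \<Longrightarrow>
      tube 0 X r \<in> sets borel \<and> emeasure lborel (tube 0 X r) \<le> ennreal (C * r ^ CARD('n))"
proof -
  let ?Z = "small_ints :: (int^'n) set"
  define v where "v = unit_ball_vol (real DIM(real^'n))"
  have v: "v > 0" unfolding v_def by (simp add: unit_ball_vol_pos)
  define C where "C = (real (card ?Z) + 1) * (v * 2 ^ CARD('n))"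
  have "tube 0 X r \<in> sets borel \<and> emeasure lborel (tube 0 X r) \<le> ennreal (C * r ^ CARD('n))"
    if r: "0 < r" "r \<le> 3" for X :: "'n torus" and r
  proof -
    obtain c where c: "c \<in> cbox 0 1" "X = torus_proj c" by (rule cube_rep)
    let ?S = "{x \<in> cbox 0 1. dist (torus_proj x) X \<le> r}"
    have "closed ?S"
      by (intro closed_Collect_conj closed_Collect_le continuous_intros continuous_on_torus_proj)
        (simp add: closed_cbox)
    then have S: "?S \<in> sets borel" by (rule borel_closed)
    have sub: "?S \<subseteq> (\<Union>m\<in>?Z. cball (c + rvec m) (2 * r))"
    proof
      fix x assume x: "x \<in> ?S"
      then have "dist (torus_proj x) (torus_proj c) < 2 * r" using r c by auto
      then obtain m where m: "norm (x - (c + rvec m)) < 2 * r" by (rule dist_torus_less_lift)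
      then have "m \<in> ?Z" using x c r by (intro small_intsI[of x c 0 m "2 * r" 0]) auto
      moreover have "x \<in> cball (c + rvec m) (2 * r)" using m by (simp add: dist_norm norm_minus_commute)
      ultimately show "x \<in> (\<Union>m\<in>?Z. cball (c + rvec m) (2 * r))" by blast
    qed
    have "emeasure lborel ?S \<le> emeasure lborel (\<Union>m\<in>?Z. cball (c + rvec m) (2 * r))"
      using sub by (intro emeasure_mono sets.finite_UN finite_small_ints) auto
    also have "\<dots> \<le> (\<Sum>m\<in>?Z. emeasure lborel (cball (c + rvec m) (2 * r)))"
      by (intro emeasure_subadditive_finite finite_small_ints) auto
    also have "\<dots> = (\<Sum>m\<in>?Z. ennreal (v * (2 * r) ^ CARD('n)))"
      using r by (intro sum.cong refl) (simp add: emeasure_cball v_def)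
    also have "\<dots> = ennreal (real (card ?Z) * (v * (2 * r) ^ CARD('n)))"
      using v r by (simp add: ennreal_mult ennreal_of_nat_eq_real_of_nat)
    also have "\<dots> \<le> ennreal (C * r ^ CARD('n))"
      unfolding C_def using v r by (intro ennreal_leI) (simp add: power_mult_distrib algebra_simps)
    finally show ?thesis using S unfolding tube_0 by blast
  qed
  moreover have "C > 0" unfolding C_def using v by (simp add: add_nonneg_pos)
  ultimately show ?thesis using that by blast
qed

text \<open>The segment is cut into about |w| / r steps of length at most r, and the tube is covered
  by one ball of radius 3 r per step: about 1 / r balls of measure of order r^d. The finite union V
  of these balls is visibly Borel.\<close>

lemma emeasure_torus_tube:
  fixes w :: "real^'n::finite"
  obtains C :: real where "C > 0"
    "\<And>(X :: 'n torus) r. \<lbrakk>0 < r; r \<le> 1\<rbrakk> \<Longrightarrow> \<exists>V\<in>sets borel.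
      tube w X r \<subseteq> V \<and> emeasure lborel V \<le> ennreal (C * r ^ (CARD('n) - 1))"
proof -
  obtain C where C: "C > 0" "\<And>(X :: 'n torus) r. \<lbrakk>0 < r; r \<le> 3\<rbrakk> \<Longrightarrow>
      tube 0 X r \<in> sets borel \<and> emeasure lborel (tube 0 X r) \<le> ennreal (C * r ^ CARD('n))"
    using emeasure_torus_ball by blast
  define C' where "C' = (norm w + 3) * C * 3 ^ CARD('n)"
  have "\<exists>V\<in>sets borel. tube w X r \<subseteq> V \<and> emeasure lborel V \<le> ennreal (C' * r ^ (CARD('n) - 1))"
    if r: "0 < r" "r \<le> 1" for X :: "'n torus" and r
  proof -
    obtain c where c: "c \<in> cbox 0 1" "X = torus_proj c" by (rule cube_rep)
    define J where "J = nat \<lceil>norm w / r\<rceil> + 1"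
    have J: "norm w / r \<le> real J" "real J \<le> norm w / r + 2" "real J > 0"
    proof -
      have "0 \<le> norm w / r" using r by simp
      then show "norm w / r \<le> real J" "real J \<le> norm w / r + 2" unfolding J_def by linarith+
      show "real J > 0" unfolding J_def by simp
    qed
    \<comment> \<open>Of the radius 3 r, 2 r comes from choosing a lift and r from rounding t to j /
      J.\<close>
    define B where "B j = tube 0 (torus_proj (c - (real j / real J) *\<^sub>R w)) (3 * r)" for j
    have B: "B j \<in> sets borel \<and> emeasure lborel (B j) \<le> ennreal (C * (3 * r) ^ CARD('n))" for j
      unfolding B_def using r by (intro C(2)) auto
    define V where "V = (\<Union>j\<in>{..J}. B j)"
    have "V \<in> sets borel" unfolding V_def using B by (intro sets.finite_UN) auto
    moreover have "tube w X r \<subseteq> V"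
    proof
      fix x assume "x \<in> tube w X r"
      then obtain t where x: "x \<in> cbox 0 1" and t: "0 \<le> t" "t \<le> 1" "dist (torus_proj (x + t *\<^sub>R w)) X \<le> r"
        unfolding tube_def by auto
      then have "dist (torus_proj (x + t *\<^sub>R w)) (torus_proj c) < 2 * r" using r c by auto
      then obtain m where m: "norm (x + t *\<^sub>R w - (c + rvec m)) < 2 * r" by (rule dist_torus_less_lift)
      define j where "j = nat \<lfloor>t * real J\<rfloor>"
      have tJ: "0 \<le> t * real J" "t * real J \<le> 1 * real J" using t J(3) by (simp, intro mult_right_mono) auto
      have j: "real j \<le> t * real J" "t * real J \<le> real j + 1" unfolding j_def using tJ(1) by linarith+
      have "real j \<le> real J" using j(1) tJ(2) by linarith
      then have jJ: "j \<le> J" by simp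
      have "t - real j / real J = (t * real J - real j) / real J" using J(3) by (simp add: diff_divide_distrib)
      moreover have "\<bar>t * real J - real j\<bar> \<le> 1" using j by linarith
      ultimately have "\<bar>t - real j / real J\<bar> \<le> 1 / real J" using J(3) by (simp add: abs_divide divide_right_mono)
      then have "\<bar>t - real j / real J\<bar> * norm w \<le> 1 / real J * norm w" by (intro mult_right_mono) auto
      also have "\<dots> \<le> r" using J r by (simp add: field_simps)
      finally have tj: "norm ((t - real j / real J) *\<^sub>R w) \<le> r" by simp
      have eq: "x - (c - (real j / real J) *\<^sub>R w + rvec m) = (x + t *\<^sub>R w - (c + rvec m)) - (t - real j / real J) *\<^sub>R w"
        by (simp add: algebra_simps)
      have "norm (x - (c - (real j / real J) *\<^sub>R w + rvec m)) \<le> 3 * r"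
        using norm_triangle_ineq4[of "x + t *\<^sub>R w - (c + rvec m)" "(t - real j / real J) *\<^sub>R w"] m tj
        unfolding eq by linarith
      then have "dist (torus_proj x) (torus_proj (c - (real j / real J) *\<^sub>R w + rvec m)) \<le> 3 * r"
        using dist_torus_proj_le[of x "c - (real j / real J) *\<^sub>R w + rvec m"] unfolding dist_norm[of x] by linarith
      then have "x \<in> B j" unfolding B_def tube_0 using x by simp
      then show "x \<in> V" unfolding V_def using jJ by blast
    qed
    moreover have "emeasure lborel V \<le> ennreal (C' * r ^ (CARD('n) - 1))"
    proof -
      have "emeasure lborel V \<le> (\<Sum>j\<in>{..J}. emeasure lborel (B j))"
        unfolding V_def using B by (intro emeasure_subadditive_finite) auto
      also have "\<dots> \<le> (\<Sum>j\<in>{..J}. ennreal (C * (3 * r) ^ CARD('n)))"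
        using B by (intro sum_mono) auto
      also have "\<dots> = ennreal (real (J + 1) * (C * (3 * r) ^ CARD('n)))"
        using C(1) r by (simp add: ennreal_mult ennreal_of_nat_eq_real_of_nat del: of_nat_add of_nat_Suc)
      also have "\<dots> \<le> ennreal (C' * r ^ (CARD('n) - 1))"
      proof (rule ennreal_leI)
        have "real (J + 1) \<le> (norm w + 3) / r"
        proof -
          have "1 \<le> 1 / r" using r by simp
          then show ?thesis using J(2) by (simp add: add_divide_distrib)
        qed
        then have "real (J + 1) * (C * (3 * r) ^ CARD('n)) \<le> (norm w + 3) / r * (C * (3 * r) ^ CARD('n))"
          using C(1) r by (intro mult_right_mono) auto
        also have "r ^ CARD('n) = r * r ^ (CARD('n) - 1)"
          by (rule power_eq_if[THEN trans]) simp
        then have "(norm w + 3) / r * (C * (3 * r) ^ CARD('n)) = C' * r ^ (CARD('n) - 1)"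
          unfolding C'_def power_mult_distrib using r by simp
        finally show "real (J + 1) * (C * (3 * r) ^ CARD('n)) \<le> C' * r ^ (CARD('n) - 1)" .
      qed
      finally show ?thesis .
    qed
    ultimately show ?thesis by blast
  qed
  moreover have "C' > 0" unfolding C'_def using C(1) by (simp add: add_nonneg_pos)
  ultimately show ?thesis using that by blast
qed

section \<open>The slicing argument\<close>

lemma torus_ball_infinite:
  assumes "\<epsilon> > 0"
  shows "infinite (ball (torus_proj 0 :: 'n::finite torus) \<epsilon>)"
proof
  assume fin: "finite (ball (torus_proj 0 :: 'n torus) \<epsilon>)"
  obtain i :: 'n where True by blast
  let ?f = "\<lambda>s::real. torus_proj (s *\<^sub>R axis i 1) :: 'n torus"
  \<comment> \<open>Parameters below 1/2 differ by less than one, so they give distinct points of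
    the torus.\<close>
  define h where "h = min \<epsilon> (1 / 2)"
  have h: "0 < h" "h \<le> \<epsilon>" "h \<le> 1 / 2" using assms unfolding h_def by auto
  have "?f ` {0<..<h} \<subseteq> ball (torus_proj 0) \<epsilon>"
  proof
    fix Y assume "Y \<in> ?f ` {0<..<h}"
    then obtain s where s: "0 < s" "s < h" "Y = ?f s" by auto
    have "dist (torus_proj 0) Y \<le> norm (0 - s *\<^sub>R (axis i 1 :: real^'n))"
      unfolding s(3) dist_norm[symmetric] by (rule dist_torus_proj_le)
    also have "\<dots> = s" using s by simp
    finally show "Y \<in> ball (torus_proj 0) \<epsilon>" using s h by simp
  qed
  moreover have "inj_on ?f {0<..<h}"
  proof (rule inj_onI)
    fix s t assume st: "s \<in> {0<..<h}" "t \<in> {0<..<h}" "?f s = ?f t"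
    then have "(s *\<^sub>R axis i 1 :: real^'n) $ i - (t *\<^sub>R axis i 1 :: real^'n) $ i \<in> \<int>"
      unfolding torus_proj_eq_iff lattice_eq_def by blast
    then have "s - t \<in> \<int>" by (simp add: axis_def)
    then obtain m :: int where m: "s - t = of_int m" by (rule Ints_cases)
    have "\<bar>s - t\<bar> < 1" using st h by auto
    then have "m = 0" unfolding m by linarith
    then show "s = t" using m by simp
  qed
  moreover have "infinite {0<..<h}" using h by (simp add: infinite_Ioo)
  ultimately show False using fin by (metis finite_imageD finite_subset)
qed

text \<open>Removing the finitely many earlier orbit points from the ball leaves an open set missed
  by the whole orbit, nonempty because the ball is infinite.\<close>

lemma nondense_if_tail_avoids_ball:
  fixes Y :: "'n::finite torus"
  assumes \<epsilon>: "\<epsilon> > 0" and avoid: "\<And>n. n \<ge> N \<Longrightarrow> (F ^^ n) Y \<notin> ball (torus_proj 0) \<epsilon>"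
  shows "Y \<in> nondense_points F"
  unfolding nondense_points_def
proof
  assume "Y \<in> dense_points F"
  then have dense: "closure (range (\<lambda>n. (F ^^ n) Y)) = UNIV" unfolding dense_points_def by blast
  define W where "W = ball (torus_proj 0 :: 'n torus) \<epsilon> - (\<lambda>n. (F ^^ n) Y) ` {..<N}"
  have "open W" unfolding W_def by (intro open_Diff open_ball finite_imp_closed) auto
  moreover have "W \<noteq> {}"
  proof
    assume "W = {}"
    then have "ball (torus_proj 0 :: 'n torus) \<epsilon> \<subseteq> (\<lambda>n. (F ^^ n) Y) ` {..<N}" unfolding W_def by blast
    then show False using torus_ball_infinite[OF \<epsilon>, where 'n = 'n] finite_subset by blast
  qed
  ultimately have "W \<inter> range (\<lambda>n. (F ^^ n) Y) \<noteq> {}"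
    using open_Int_closure_eq_empty[of W "range (\<lambda>n. (F ^^ n) Y)"] dense by simp
  then obtain n where n: "(F ^^ n) Y \<in> W" by blast
  show False
  proof (cases "n < N")
    case True
    then show False using n unfolding W_def by blast
  next
    case False
    then show False using n avoid[of n] unfolding W_def by simp
  qed
qed

lemma exists_large_coordinate:
  fixes v :: "real^'n"
  shows "\<exists>j. norm v \<le> real CARD('n) * \<bar>v $ j\<bar>"
proof (rule ccontr)
  assume "\<not> ?thesis"
  then have lt: "real CARD('n) * \<bar>v $ j\<bar> < norm v" for j by (simp add: not_le)
  have "real CARD('n) * norm v \<le> real CARD('n) * (\<Sum>j\<in>UNIV. \<bar>v $ j\<bar>)"
    by (intro mult_left_mono norm_le_l1_cart) simp
  also have "\<dots> = (\<Sum>j\<in>UNIV. real CARD('n) * \<bar>v $ j\<bar>)" by (rule sum_distrib_left)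
  also have "\<dots> < (\<Sum>j\<in>(UNIV::'n set). norm v)"
    by (intro sum_strict_mono lt) auto
  finally show False by simp
qed

text \<open>A coordinate of largest modulus is comparable to the norm; it may change with n, as only
  scalar sizes are compared afterwards.\<close>

lemma geometric_growth_coordinates:
  fixes v :: "nat \<Rightarrow> real^'n"
  assumes "geometric_growth v"
  obtains j where "geometric_growth (\<lambda>n. v n $ j n)"
proof -
  have "\<forall>n. \<exists>j. norm (v n) \<le> real CARD('n) * \<bar>v n $ j\<bar>" by (intro allI exists_large_coordinate)
  then obtain j where j: "\<forall>n. norm (v n) \<le> real CARD('n) * \<bar>v n $ j n\<bar>" by (rule choice[THEN exE])
  obtain r C where r: "0 < r" "r < 1" "C > 0" and nz: "\<forall>n. v n \<noteq> 0"
    and C: "\<forall>i n. i \<le> n \<longrightarrow> norm (v i) \<le> C * r ^ (n - i) * norm (v n)"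
    by (rule geometric_growthE[OF assms])
  have "geometric_growth (\<lambda>n. v n $ j n)"
  proof (rule geometric_growthI[OF _ r(1,2)])
    show "v n $ j n \<noteq> 0" for n
    proof
      assume "v n $ j n = 0"
      then have "norm (v n) \<le> 0" using spec[OF j, of n] by simp
      then show False using nz by simp
    qed
    fix i n :: nat assume "i \<le> n"
    have "norm (v i $ j i) \<le> norm (v i)" by (simp add: component_le_norm_cart)
    also have "\<dots> \<le> C * r ^ (n - i) * norm (v n)" using C \<open>i \<le> n\<close> by blast
    also have "\<dots> \<le> C * r ^ (n - i) * (real CARD('n) * \<bar>v n $ j n\<bar>)"
      using r j by (intro mult_left_mono) auto
    finally show "norm (v i $ j i) \<le> (C * real CARD('n)) * r ^ (n - i) * norm (v n $ j n)"
      by (simp add: mult_ac)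
  qed
  then show ?thesis by (rule that)
qed

lemma geometric_growth_scaleR:
  assumes "geometric_growth a" "c \<noteq> 0"
  shows "geometric_growth (\<lambda>n. c *\<^sub>R a n)"
proof -
  obtain r C where r: "0 < r" "r < 1" "C > 0" and nz: "\<forall>n. a n \<noteq> 0"
    and C: "\<forall>i n. i \<le> n \<longrightarrow> norm (a i) \<le> C * r ^ (n - i) * norm (a n)"
    by (rule geometric_growthE[OF assms(1)])
  show ?thesis
  proof (rule geometric_growthI[OF _ r(1,2)])
    show "c *\<^sub>R a n \<noteq> 0" for n using nz assms(2) by simp
    fix i n :: nat assume "i \<le> n"
    then have "\<bar>c\<bar> * norm (a i) \<le> \<bar>c\<bar> * (C * r ^ (n - i) * norm (a n))" using C by (intro mult_left_mono) auto
    then show "norm (c *\<^sub>R a i) \<le> C * r ^ (n - i) * norm (c *\<^sub>R a n)" by (simp add: mult_ac)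
  qed
qed

text \<open>The chosen coordinate of the n-th image is affine in t. An image close to the origin of
  the torus would put it close to an integer, and the condition |a_n| \<ge> 1 fails only for
  finitely many n.\<close>

lemma nondense_if_coordinates_avoid:
  fixes T :: "int^'n::finite^'n"
  assumes grow: "geometric_growth (\<lambda>n. orbit (rmat T) w n $ j n)"
    and \<epsilon>: "\<epsilon> > 0"
    and avoid: "\<And>n z. 1 \<le> \<bar>orbit (rmat T) w n $ j n\<bar> \<Longrightarrow>
      \<epsilon> \<le> \<bar>(orbit (rmat T) w n $ j n) * t + orbit (rmat T) x n $ j n - of_int z\<bar>"
  shows "torus_proj (x + t *\<^sub>R w) \<in> nondense_points (torus_map T)"
proof -
  let ?a = "\<lambda>n. orbit (rmat T) w n $ j n"
  have "\<forall>\<^sub>F n in sequentially. 1 \<le> norm (?a n)"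
    using geometric_growth_at_top[OF grow] by (simp add: filterlim_at_top)
  then obtain N where N: "\<forall>n\<ge>N. 1 \<le> norm (?a n)" unfolding eventually_sequentially by blast
  show ?thesis
  proof (rule nondense_if_tail_avoids_ball[OF \<epsilon>])
    fix n assume "N \<le> n"
    then have an: "1 \<le> \<bar>?a n\<bar>" using N by simp
    show "(torus_map T ^^ n) (torus_proj (x + t *\<^sub>R w)) \<notin> ball (torus_proj 0) \<epsilon>"
    proof
      assume "(torus_map T ^^ n) (torus_proj (x + t *\<^sub>R w)) \<in> ball (torus_proj 0) \<epsilon>"
      then have "dist (torus_proj (orbit (rmat T) (x + t *\<^sub>R w) n)) (torus_proj 0) < \<epsilon>"
        by (simp add: torus_map_funpow dist_commute)
      then obtain m where m: "norm (orbit (rmat T) (x + t *\<^sub>R w) n - (0 + rvec m)) < \<epsilon>"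
        by (rule dist_torus_less_lift)
      have "\<bar>(orbit (rmat T) (x + t *\<^sub>R w) n - (0 + rvec m)) $ j n\<bar> < \<epsilon>"
        using component_le_norm_cart m by (rule le_less_trans)
      moreover have "(orbit (rmat T) (x + t *\<^sub>R w) n - (0 + rvec m)) $ j n =
          ?a n * t + orbit (rmat T) x n $ j n - of_int (m $ j n)"
        unfolding orbit_add orbit_scaleR rvec_def by (simp add: mult.commute)
      ultimately show False using avoid[OF an, of "m $ j n"] by simp
    qed
  qed
qed

text \<open>A tree keeping R - 1 of R children has dimension log (R - 1) / log R, which exceeds any
  given \<sigma> < 1 for large R; here R^(1-\<sigma>) \<ge> 2 suffices.\<close>

lemma exists_scale:
  assumes "0 < \<sigma>" "\<sigma> < 1"
  obtains R :: nat where "R \<ge> 3" "real R powr \<sigma> \<le> real (R - 1)"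
proof -
  have "\<forall>\<^sub>F R::nat in sequentially. real R \<ge> max 3 (2 powr (1 / (1 - \<sigma>)))"
    using filterlim_real_sequentially unfolding filterlim_at_top by blast
  then obtain R :: nat where R: "real R \<ge> 3" "real R \<ge> 2 powr (1 / (1 - \<sigma>))"
    unfolding eventually_sequentially by (metis max.boundedE order_refl)
  have "(2 powr (1 / (1 - \<sigma>))) powr (1 - \<sigma>) \<le> real R powr (1 - \<sigma>)"
    using R(2) assms by (intro powr_mono2) auto
  then have "2 \<le> real R powr (1 - \<sigma>)" using assms by (simp add: powr_powr)
  then have "2 * real R powr \<sigma> \<le> real R powr (1 - \<sigma>) * real R powr \<sigma>" by (intro mult_right_mono) auto
  also have "\<dots> = real R" using R(1) by (simp add: powr_add[symmetric])
  finally have "real R powr \<sigma> \<le> real R - 1" using R(1) by linarith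
  then show ?thesis using R(1) by (intro that[of R]) (auto simp: of_nat_diff)
qed

text \<open>Chebyshev's inequality selects a base point \<open>x\<close> whose segment in direction \<open>w\<close> meets only
  few of the covering balls, measured with exponent \<open>\<sigma>\<close> instead of \<open>e + \<sigma>\<close>.\<close>

lemma exists_sparse_segment:
  fixes X :: "nat \<Rightarrow> 'n::finite torus" and w :: "real^'n"
  assumes good: "AE x in cube_measure. x \<in> W"
    and \<eta>: "\<eta> > 0"
    and tube: "\<And>i. \<exists>V\<in>sets borel. tube w (X i) (r i) \<subseteq> V \<and> emeasure lborel V \<le> ennreal (C * r i ^ e)"
    and C: "C > 0" and r: "\<And>i. 0 < r i"
    and sum: "(\<Sum>i. ennreal (r i powr (real e + \<sigma>))) \<le> ennreal \<epsilon>" and \<epsilon>: "0 < \<epsilon>" "C * \<epsilon> < \<eta>"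
  obtains x where "x \<in> W" "x \<in> cbox 0 1"
    "\<forall>F. finite F \<longrightarrow> F \<subseteq> {i. x \<in> tube w (X i) (r i)} \<longrightarrow> (\<Sum>i\<in>F. r i powr \<sigma>) \<le> \<eta>"
proof -
  have "\<forall>i. \<exists>V. V \<in> sets borel \<and> tube w (X i) (r i) \<subseteq> V \<and> emeasure lborel V \<le> ennreal (C * r i ^ e)"
    using tube by blast
  then obtain V where "\<forall>i. V i \<in> sets borel \<and> tube w (X i) (r i) \<subseteq> V i \<and> emeasure lborel (V i) \<le> ennreal (C * r i ^ e)"
    by (rule choice[THEN exE])
  then have V: "V i \<in> sets borel" "tube w (X i) (r i) \<subseteq> V i" "emeasure lborel (V i) \<le> ennreal (C * r i ^ e)" for i
    by blast+
  \<comment> \<open>Each ball is weighted by its \<sigma>-content on a segment; the measure of the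
    tube contributes the missing factor r^e.\<close>
  define g where "g i x = ennreal (r i powr \<sigma>) * indicator (V i) x" for i x
  have gm: "g i \<in> borel_measurable cube_measure" for i
    unfolding g_def using V(1) by (intro measurable_restrict_space1) simp
  have gi: "(\<integral>\<^sup>+x. g i x \<partial>cube_measure) \<le> ennreal C * ennreal (r i powr (real e + \<sigma>))" for i
  proof -
    have "(\<integral>\<^sup>+x. g i x \<partial>cube_measure) = (\<integral>\<^sup>+x. g i x * indicator (cbox 0 1) x \<partial>lborel)"
      by (intro nn_integral_restrict_space) simp
    also have "\<dots> \<le> (\<integral>\<^sup>+x. g i x \<partial>lborel)"
      by (intro nn_integral_mono) (auto simp: indicator_def)
    also have "\<dots> = ennreal (r i powr \<sigma>) * emeasure lborel (V i)"
      unfolding g_def using V(1) by (intro nn_integral_cmult_indicator) simp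
    also have "\<dots> \<le> ennreal (r i powr \<sigma>) * ennreal (C * r i ^ e)"
      by (intro mult_left_mono V) simp
    also have "\<dots> = ennreal (r i powr \<sigma> * (C * r i ^ e))"
      using C r[of i] by (intro ennreal_mult[symmetric]) auto
    also have "r i powr \<sigma> * (C * r i ^ e) = C * r i powr (real e + \<sigma>)"
      unfolding powr_add powr_realpow[OF r] by (simp only: mult_ac)
    also have "ennreal \<dots> = ennreal C * ennreal (r i powr (real e + \<sigma>))"
      using C by (intro ennreal_mult) auto
    finally show ?thesis .
  qed
  have "(\<integral>\<^sup>+x. (\<Sum>i. g i x) \<partial>cube_measure) = (\<Sum>i. (\<integral>\<^sup>+x. g i x \<partial>cube_measure))"
    by (rule nn_integral_suminf[OF gm])
  also have "\<dots> \<le> (\<Sum>i. ennreal C * ennreal (r i powr (real e + \<sigma>)))"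
    by (intro suminf_le gi) auto
  also have "\<dots> = ennreal C * (\<Sum>i. ennreal (r i powr (real e + \<sigma>)))"
    by (rule ennreal_suminf_cmult)
  also have "\<dots> \<le> ennreal C * ennreal \<epsilon>" by (intro mult_left_mono sum) simp
  also have "\<dots> = ennreal (C * \<epsilon>)" using C \<epsilon> by (intro ennreal_mult[symmetric]) auto
  also have "\<dots> < ennreal \<eta>" using \<epsilon> \<eta> by (intro ennreal_lessI) auto
  finally have small: "(\<integral>\<^sup>+x. (\<Sum>i. g i x) \<partial>cube_measure) < ennreal \<eta>" .
  \<comment> \<open>On a probability space a function with mean below \<eta> is below \<eta>
    somewhere on a set of full measure.\<close>
  have "\<exists>x. x \<in> W \<and> x \<in> cbox 0 1 \<and> (\<Sum>i. g i x) < ennreal \<eta>"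
  proof (rule ccontr)
    assume "\<not> ?thesis"
    then have "AE x in cube_measure. ennreal \<eta> \<le> (\<Sum>i. g i x)"
      using good AE_space[of "cube_measure :: (real^'n) measure"]
      by (elim AE_mp, intro AE_I2) (auto simp: space_restrict_space not_less)
    then have "(\<integral>\<^sup>+x. ennreal \<eta> \<partial>(cube_measure :: (real^'n) measure)) \<le> (\<integral>\<^sup>+x. (\<Sum>i. g i x) \<partial>cube_measure)"
      by (rule nn_integral_mono_AE)
    moreover have "(\<integral>\<^sup>+x. ennreal \<eta> \<partial>(cube_measure :: (real^'n) measure)) = ennreal \<eta>"
      unfolding nn_integral_const emeasure_cube_measure by simp
    ultimately show False using small by simp
  qed
  then obtain x where x: "x \<in> W" "x \<in> cbox 0 1" "(\<Sum>i. g i x) < ennreal \<eta>" by blast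
  show ?thesis
  proof (rule that[OF x(1,2)], intro allI impI)
    fix F assume F: "finite F" "F \<subseteq> {i. x \<in> tube w (X i) (r i)}"
    have "x \<in> V i" if "i \<in> F" for i using V(2)[of i] F(2) that by blast
    then have "(\<Sum>i\<in>F. ennreal (r i powr \<sigma>)) = (\<Sum>i\<in>F. g i x)"
      unfolding g_def by (intro sum.cong refl) simp
    also have "\<dots> \<le> (\<Sum>i. g i x)" by (rule sum_le_suminf) (simp_all add: F)
    finally have "ennreal (\<Sum>i\<in>F. r i powr \<sigma>) < ennreal \<eta>"
      using x(3) by (simp add: sum_ennreal)
    then show "(\<Sum>i\<in>F. r i powr \<sigma>) \<le> \<eta>" using \<eta> by (simp add: ennreal_less_iff sum_nonneg)
  qed
qed

text \<open>A lower bound for Hausdorff content in the form used: \<epsilon> precedes the cover,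
  because the constants of the tube estimate and of \<open>avoid_one_dim\<close> do not depend on
  it.\<close>

lemma exists_point_avoiding_cover:
  fixes S :: "int^'n::finite^'n" and T :: "nat \<Rightarrow> int^'n^'n"
  assumes S: "toral_endomorphism S" "quasihyperbolic S"
    and w: "w \<in> bounded_orbits S" "\<And>k. geometric_growth (orbit (rmat (T k)) w)"
    and \<sigma>: "0 < \<sigma>" "\<sigma> < 1"
  obtains \<epsilon> :: real where "0 < \<epsilon>" "\<epsilon> \<le> 1"
    "\<forall>X r. (\<forall>i::nat. 0 < r i) \<and> (\<forall>i. r i \<le> 1) \<and>
        (\<Sum>i. ennreal (r i powr (real (CARD('n) - 1) + \<sigma>))) \<le> ennreal \<epsilon> \<longrightarrow>
      (\<exists>Y. Y \<in> equidistributed_points (torus_map S) \<and> (\<forall>k. Y \<in> nondense_points (torus_map (T k))) \<and>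
        (\<forall>i. Y \<notin> cball (X i) (r i)))"
proof -
  have "w \<noteq> 0"
    using geometric_growthE[OF w(2)[of 0]] by (metis orbit_0)
  \<comment> \<open>Two parameters whose points lie within 2 r of the same lift of a centre satisfy
    |t - t'| |u| \<le> 4 r, so length 4 turns a ball of radius r into a deleted interval of radius
    r.\<close>
  define u where "u = (4 / norm w) *\<^sub>R w"
  have nu: "norm u = 4" unfolding u_def using \<open>w \<noteq> 0\<close> by simp
  have uB: "t *\<^sub>R u \<in> bounded_orbits S" for t
    unfolding u_def by (intro subspace_scale subspace_bounded_orbits w)
  have "geometric_growth (orbit (rmat (T k)) u)" for k
    unfolding u_def orbit_scaleR using \<open>w \<noteq> 0\<close> by (intro geometric_growth_scaleR w) simp
  then have "\<forall>k. \<exists>j. geometric_growth (\<lambda>n. orbit (rmat (T k)) u n $ j n)"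
    using geometric_growth_coordinates by blast
  then obtain j where j: "\<forall>k. geometric_growth (\<lambda>n. orbit (rmat (T k)) u n $ j k n)" by (rule choice[THEN exE])
  define a where "a k n = orbit (rmat (T k)) u n $ j k n" for k n
  have ga: "geometric_growth (a k)" for k using j unfolding a_def[abs_def] by blast
  obtain R where R: "R \<ge> 3" "real R powr \<sigma> \<le> real (R - 1)" by (rule exists_scale[OF \<sigma>])
  let ?Z = "small_ints :: (int^'n) set"
  show ?thesis
  proof (rule avoid_one_dim[OF R(1) \<sigma>(1) R(2) ga, where M = "real (card ?Z)" and 'z = "int^'n"])
    fix \<eta> :: real
    assume \<eta>: "\<eta> > 0"
      and avoid: "\<And>b c r (I::nat set) Z. \<lbrakk>finite (Z::(int^'n) set); real (card Z) \<le> real (card ?Z); \<And>i. i \<in> I \<Longrightarrow> 0 < r i;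
              \<And>F. finite F \<Longrightarrow> F \<subseteq> I \<Longrightarrow> (\<Sum>i\<in>F. r i powr \<sigma>) \<le> \<eta>\<rbrakk> \<Longrightarrow>
            \<exists>t\<in>{0..1}. (\<forall>i\<in>I. \<forall>m\<in>Z. \<bar>t - c (i::nat) m\<bar> > r i) \<and>
              (\<forall>k. \<exists>\<epsilon>>0. \<forall>n. 1 \<le> \<bar>a k n\<bar> \<longrightarrow> (\<forall>z::int. \<epsilon> \<le> \<bar>a k n * t + b k n - of_int z\<bar>))"
    obtain C where C: "C > 0"
      and tube: "\<And>(X :: 'n torus) r. \<lbrakk>0 < r; r \<le> 1\<rbrakk> \<Longrightarrow> \<exists>V\<in>sets borel.
        tube u X r \<subseteq> V \<and> emeasure lborel V \<le> ennreal (C * r ^ (CARD('n) - 1))"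
      using emeasure_torus_tube[of u] by blast
    define \<epsilon> where "\<epsilon> = min 1 (\<eta> / (2 * C))"
    have \<epsilon>: "0 < \<epsilon>" "\<epsilon> \<le> 1" unfolding \<epsilon>_def using \<eta> C by auto
    have "\<epsilon> \<le> \<eta> / (2 * C)" unfolding \<epsilon>_def by simp
    then have "C * \<epsilon> \<le> \<eta> / 2" using C by (simp add: field_simps)
    then have C\<epsilon>: "C * \<epsilon> < \<eta>" using \<eta> by linarith
    show ?thesis
    proof (rule that[OF \<epsilon>], intro allI impI, elim conjE)
      fix X :: "nat \<Rightarrow> 'n torus" and r :: "nat \<Rightarrow> real"
      assume r': "\<forall>i. 0 < r i" "\<forall>i. r i \<le> 1"
        and sum: "(\<Sum>i. ennreal (r i powr (real (CARD('n) - 1) + \<sigma>))) \<le> ennreal \<epsilon>"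
      have r: "0 < r i" "r i \<le> 1" for i using r' by blast+
      obtain x where x: "x \<in> weyl_points S" "x \<in> cbox 0 1"
        and sparse: "\<forall>F. finite F \<longrightarrow> F \<subseteq> {i. x \<in> tube u (X i) (r i)} \<longrightarrow> (\<Sum>i\<in>F. r i powr \<sigma>) \<le> \<eta>"
        by (rule exists_sparse_segment[OF AE_weyl_points[OF S] \<eta> tube[OF r] C r(1) sum \<epsilon>(1) C\<epsilon>])
      define I where "I = {i. x \<in> tube u (X i) (r i)}"
      have "\<forall>i. \<exists>c. c \<in> cbox 0 1 \<and> X i = torus_proj c" by (metis cube_rep)
      then obtain c where "\<forall>i. c i \<in> cbox 0 1 \<and> X i = torus_proj (c i)" by (rule choice[THEN exE])
      then have c: "c i \<in> cbox 0 1" "X i = torus_proj (c i)" for i by blast+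
      define near where "near i m t \<longleftrightarrow> norm (x + t *\<^sub>R u - (c i + rvec m)) \<le> 2 * r i" for i m t
      \<comment> \<open>Any one hitting time serves as centre of the deleted interval; if there is
        none, the value is arbitrary and the deletion harmless.\<close>
      define q where "q i m = (SOME t. near i m t)" for i m
      have q: "\<bar>t - q i m\<bar> \<le> r i" if "near i m t" for i m t
      proof -
        have nq: "near i m (q i m)" unfolding q_def using that by (rule someI)
        have eq: "(t - q i m) *\<^sub>R u = (x + t *\<^sub>R u - (c i + rvec m)) - (x + q i m *\<^sub>R u - (c i + rvec m))"
          by (simp add: algebra_simps)
        have "norm ((t - q i m) *\<^sub>R u) \<le> 2 * r i + 2 * r i"
          using norm_triangle_ineq4[of "x + t *\<^sub>R u - (c i + rvec m)" "x + q i m *\<^sub>R u - (c i + rvec m)"]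
            that nq unfolding near_def eq by linarith
        then show ?thesis by (simp add: nu)
      qed
      define b where "b k n = orbit (rmat (T k)) x n $ j k n" for k n
      have sp: "(\<Sum>i\<in>F. r i powr \<sigma>) \<le> \<eta>" if "finite F" "F \<subseteq> I" for F
        using sparse that unfolding I_def by blast
      obtain t where t: "t \<in> {0..1}" and tq: "\<forall>i\<in>I. \<forall>m\<in>?Z. \<bar>t - q i m\<bar> > r i"
        and tb: "\<forall>k. \<exists>\<epsilon>>0. \<forall>n. 1 \<le> \<bar>a k n\<bar> \<longrightarrow> (\<forall>z::int. \<epsilon> \<le> \<bar>a k n * t + b k n - of_int z\<bar>)"
        using avoid[OF finite_small_ints order_refl r(1) sp, of I q b] by blast
      let ?Y = "torus_proj (x + t *\<^sub>R u)"
      have "?Y \<in> equidistributed_points (torus_map S)"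
        by (intro weyl_points_equidistributed weyl_points_add_bounded S x uB)
      moreover have "?Y \<in> nondense_points (torus_map (T k))" for k
      proof -
        obtain \<epsilon>' where "\<epsilon>' > 0" and e: "\<forall>n. 1 \<le> \<bar>a k n\<bar> \<longrightarrow> (\<forall>z::int. \<epsilon>' \<le> \<bar>a k n * t + b k n - of_int z\<bar>)"
          using tb by blast
        show ?thesis
        proof (rule nondense_if_coordinates_avoid[OF _ \<open>\<epsilon>' > 0\<close>])
          show "geometric_growth (\<lambda>n. orbit (rmat (T k)) u n $ j k n)" using j by blast
          show "\<epsilon>' \<le> \<bar>orbit (rmat (T k)) u n $ j k n * t + orbit (rmat (T k)) x n $ j k n - of_int z\<bar>"
            if "1 \<le> \<bar>orbit (rmat (T k)) u n $ j k n\<bar>" for n z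
            using e that unfolding a_def b_def by blast
        qed
      qed
      moreover have "?Y \<notin> cball (X i) (r i)" for i
      proof
        assume "?Y \<in> cball (X i) (r i)"
        then have d: "dist ?Y (X i) \<le> r i" by (simp add: dist_commute)
        then have "i \<in> I" unfolding I_def tube_def using t x(2) by blast
        have "dist ?Y (torus_proj (c i)) < 2 * r i" using d r(1)[of i] unfolding c(2)[symmetric] by linarith
        then obtain m where m: "norm (x + t *\<^sub>R u - (c i + rvec m)) < 2 * r i" by (rule dist_torus_less_lift)
        \<comment> \<open>Together with the doubled radius 2 this uses the full distance 6 granted
          to \<open>small_ints\<close>.\<close>
        have "norm (t *\<^sub>R u) \<le> 4" using t nu by (simp add: abs_le_iff)
        then have "m \<in> ?Z"
          using small_intsI[OF x(2) c(1)[of i], of "t *\<^sub>R u" m "2 * r i" 4] m r(2)[of i] by simp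
        moreover have "near i m t" unfolding near_def using m by simp
        ultimately show False using tq \<open>i \<in> I\<close> q[of i m t] by fastforce
      qed
      ultimately show "\<exists>Y. Y \<in> equidistributed_points (torus_map S) \<and> (\<forall>k. Y \<in> nondense_points (torus_map (T k))) \<and>
          (\<forall>i. Y \<notin> cball (X i) (r i))" by blast
    qed
  qed
qed

text \<open>The averaging argument with w = 0 and \<sigma> = 0: \<open>r i powr 0\<close> is one, so
  the sum counts the balls containing the point, and the bound 1/2 leaves none.\<close>

lemma hausdorff_measure_equidistributed_nonzero:
  fixes S :: "int^'n::finite^'n"
  assumes S: "toral_endomorphism S" "quasihyperbolic S" and s: "0 \<le> s" "s < real CARD('n)"
  shows "hausdorff_measure s (equidistributed_points (torus_map S)) \<noteq> 0"
proof
  assume null: "hausdorff_measure s (equidistributed_points (torus_map S)) = 0"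
  obtain C :: real where C: "C > 0" "\<And>(X :: 'n torus) r. \<lbrakk>0 < r; r \<le> 3\<rbrakk> \<Longrightarrow>
      tube 0 X r \<in> sets borel \<and> emeasure lborel (tube 0 X r) \<le> ennreal (C * r ^ CARD('n))"
    using emeasure_torus_ball by blast
  define \<epsilon> where "\<epsilon> = min 1 (1 / (4 * C))"
  have \<epsilon>: "0 < \<epsilon>" "\<epsilon> \<le> 1" unfolding \<epsilon>_def using C(1) by auto
  have "\<epsilon> \<le> 1 / (4 * C)" unfolding \<epsilon>_def by simp
  then have C\<epsilon>: "C * \<epsilon> < 1 / 2" using C(1) by (simp add: field_simps)
  have d: "0 < real CARD('n)" by simp
  obtain X r where r': "\<forall>i::nat. 0 < r i" "\<forall>i. r i \<le> 1"
    and cover: "equidistributed_points (torus_map S) \<subseteq> (\<Union>i. cball (X i) (r i))"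
    and sum: "(\<Sum>i. ennreal (r i powr real CARD('n))) \<le> ennreal \<epsilon>"
    by (rule hausdorff_null_ball_cover[OF null s(1) less_imp_le[OF s(2)] d \<epsilon>])
  have r: "0 < r i" "r i \<le> 1" for i using r' by blast+
  have r3: "r i \<le> 3" for i using r(2)[of i] by linarith
  have tubes: "\<exists>V\<in>sets borel. tube 0 (X i) (r i) \<subseteq> V \<and> emeasure lborel V \<le> ennreal (C * r i ^ CARD('n))" for i
    using C(2)[OF r(1)[of i] r3[of i], of "X i"] by (intro bexI[of _ "tube 0 (X i) (r i)"]) auto
  have sum0: "(\<Sum>i. ennreal (r i powr (real CARD('n) + 0))) \<le> ennreal \<epsilon>" using sum by simp
  have half: "(0::real) < 1 / 2" by simp
  obtain x where x: "x \<in> weyl_points S" "x \<in> cbox 0 1"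
    and sparse: "\<forall>F. finite F \<longrightarrow> F \<subseteq> {i. x \<in> tube 0 (X i) (r i)} \<longrightarrow> (\<Sum>i\<in>F. r i powr 0) \<le> 1 / 2"
    by (rule exists_sparse_segment[OF AE_weyl_points[OF S] half tubes C(1) r(1) sum0 \<epsilon>(1) C\<epsilon>])
  have "torus_proj x \<in> (\<Union>i. cball (X i) (r i))"
    using cover weyl_points_equidistributed[OF x(1)] by blast
  then obtain i where "dist (torus_proj x) (X i) \<le> r i" by (auto simp: dist_commute)
  then have "x \<in> tube 0 (X i) (r i)" unfolding tube_0 using x(2) by blast
  then show False using sparse[THEN spec, of "{i}"] r(1)[of i] by simp
qed

theorem corollary1p2:
  fixes S :: "int^'d::finite^'d"
    and T :: "'k \<Rightarrow> int^'d^'d"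
    and K :: "'k set"
  assumes "toral_endomorphism S" and "quasihyperbolic S"
    and "countable K"
    and "\<And>k. k \<in> K \<Longrightarrow> toral_automorphism (T k)"
    and "\<And>k. k \<in> K \<Longrightarrow> quasihyperbolic (T k)"
    and "\<And>k. k \<in> K \<Longrightarrow>
           (contracted_space S + neutral_eigenspace S)
             + (contracted_space (T k) + neutral_eigenspace (T k)) = UNIV"
  shows "hausdorff_dim (equidistributed_points (torus_map S)
           \<inter> (\<Inter>k\<in>K. nondense_points (torus_map (T k)))) = of_nat CARD('d)"
proof -
  let ?E = "equidistributed_points (torus_map S) \<inter> (\<Inter>k\<in>K. nondense_points (torus_map (T k)))"
  let ?d = "real CARD('d)"
  have lower: "hausdorff_measure s ?E \<noteq> 0" if s: "0 \<le> s" "s < ?d" for s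
  proof (cases "K = {}")
    case True
    then show ?thesis using hausdorff_measure_equidistributed_nonzero[OF assms(1,2) s] by simp
  next
    case False
    obtain w where w: "w \<in> bounded_orbits S" "\<forall>k\<in>K. geometric_growth (orbit (rmat (T k)) w)"
      by (rule exists_common_growth_direction[OF assms(3-6)])
    \<comment> \<open>The enumeration repeats members if K is finite, which does not change the
      intersection.\<close>
    define T' where "T' = (\<lambda>n. T (from_nat_into K n))"
    have gT: "geometric_growth (orbit (rmat (T' n)) w)" for n
      unfolding T'_def using w(2) from_nat_into[OF False] by blast
    \<comment> \<open>The second entry ensures s \<le> d - 1 + \<sigma> and is below one; the 1/2
      keeps \<sigma> positive when s \<le> d - 1.\<close>
    define \<sigma> where "\<sigma> = max (1 / 2) (s - real (CARD('d) - 1))"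
    have d1: "real (CARD('d) - 1) = ?d - 1" by (simp add: of_nat_diff Suc_leI)
    have \<sigma>: "0 < \<sigma>" "\<sigma> < 1" "s \<le> real (CARD('d) - 1) + \<sigma>" "0 < real (CARD('d) - 1) + \<sigma>"
    proof -
      have d: "1 \<le> ?d" by (simp add: Suc_leI)
      have \<sigma>0: "1 / 2 \<le> \<sigma>" "s - (?d - 1) \<le> \<sigma>" "\<sigma> < 1"
        unfolding \<sigma>_def d1 using s by auto
      show "0 < \<sigma>" "\<sigma> < 1" "s \<le> real (CARD('d) - 1) + \<sigma>" "0 < real (CARD('d) - 1) + \<sigma>"
        using \<sigma>0 d unfolding d1 by linarith+
    qed
    obtain \<epsilon> :: real where \<epsilon>: "0 < \<epsilon>" "\<epsilon> \<le> 1"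
      and avoid: "\<forall>X r. (\<forall>i::nat. 0 < r i) \<and> (\<forall>i. r i \<le> 1) \<and>
          (\<Sum>i. ennreal (r i powr (real (CARD('d) - 1) + \<sigma>))) \<le> ennreal \<epsilon> \<longrightarrow>
        (\<exists>Y. Y \<in> equidistributed_points (torus_map S) \<and> (\<forall>k. Y \<in> nondense_points (torus_map (T' k))) \<and>
          (\<forall>i. Y \<notin> cball (X i) (r i)))"
      by (rule exists_point_avoiding_cover[OF assms(1,2) w(1) gT \<sigma>(1,2)])
    show ?thesis
    proof
      assume null: "hausdorff_measure s ?E = 0"
      obtain X r where r: "\<forall>i::nat. 0 < r i" "\<forall>i. r i \<le> 1" and cover: "?E \<subseteq> (\<Union>i. cball (X i) (r i))"
        and sum: "(\<Sum>i. ennreal (r i powr (real (CARD('d) - 1) + \<sigma>))) \<le> ennreal \<epsilon>"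
        by (rule hausdorff_null_ball_cover[OF null s(1) \<sigma>(3,4) \<epsilon>])
      have "\<exists>Y. Y \<in> equidistributed_points (torus_map S) \<and> (\<forall>k. Y \<in> nondense_points (torus_map (T' k))) \<and>
          (\<forall>i. Y \<notin> cball (X i) (r i))"
        using r sum by (intro avoid[THEN spec, THEN spec, THEN mp]) (intro conjI)
      then obtain Y where Y: "Y \<in> equidistributed_points (torus_map S)" "\<forall>k. Y \<in> nondense_points (torus_map (T' k))"
        "\<forall>i. Y \<notin> cball (X i) (r i)"
        by (elim exE conjE)
      have "Y \<in> nondense_points (torus_map (T k))" if k: "k \<in> K" for k
      proof -
        obtain n where "from_nat_into K n = k" using from_nat_into_surj[OF assms(3) k] by blast
        then show ?thesis using Y(2) unfolding T'_def by blast
      qed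
      then have "Y \<in> ?E" using Y(1) by blast
      then obtain i where "Y \<in> cball (X i) (r i)" using cover by blast
      then show False using Y(3) by blast
    qed
  qed
  have "of_nat CARD('d) \<le> hausdorff_dim ?E"
    unfolding hausdorff_dim_def
  proof (rule Inf_greatest)
    fix z assume "z \<in> {ennreal s | s. s \<ge> 0 \<and> hausdorff_measure s ?E = 0}"
    then obtain s where s: "z = ennreal s" "0 \<le> s" "hausdorff_measure s ?E = 0" by blast
    then have "?d \<le> s" using lower[of s] by (meson not_le)
    then show "of_nat CARD('d) \<le> z" unfolding s(1) by (simp add: ennreal_of_nat_eq_real_of_nat ennreal_leI)
  qed
  then show ?thesis using hausdorff_dim_torus_le by (rule antisym[rotated])
qed

end
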